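(* Let $E\to M$ be an exact Courant algebroid with anchor $\pi$, $C\subset M$ a submanifold, and $K\to C$ an isotropic subbundle of $E|_C$ such that $\pi(K^\perp)=TC$, $\Gamma_{bas}(K^\perp)$ spans $K^\perp$ at every point of $C$, and the quotient $\underline{C}$ of $C$ by the foliation integrating $\pi(K)$ is a smooth manifold; let $\underline{E}\to\underline{C}$ be the reduced exact Courant algebroid. Let $\mathcal{J}$ be a generalized complex structure on $E$ such that $\mathcal{J}K\cap K^\perp$ has constant rank and is contained in $K$. Assume further that $\mathcal{J}$ applied to any basic section of $\mathcal{J}K^\perp\cap K^\perp$ is again a basic section. Then $\mathcal{J}$ descends to a generalized complex structure $\underline{\mathcal{J}}$ on $\underline{E}\to\underline{C}$.
   Context: A Courant algebroid over a manifold $M$ is a vector bundle $E\to M$ with a fibrewise non-degenerate symmetric bilinear form $\langle\cdot,\cdot\rangle$, a bilinear bracket $[\cdot,\cdot]$ on $\Gamma(E)$ and a bundle map $\pi:E\to TM$ (the anchor) such that for all $e_1,e_2,e_3\in\Gamma(E)$, $f\in C^\infty(M)$: (C1) $[e_1,[e_2,e_3]]=[[e_1,e_2],e_3]+[e_2,[e_1,e_3]]$; (C2) $\pi([e_1,e_2])=[\pi(e_1),\pi(e_2)]$; (C3) $[e_1,fe_2]=f[e_1,e_2]+(\pi(e_1)f)e_2$; (C4) $\pi(e_1)\langle e_2,e_3\rangle=\langle[e_1,e_2],e_3\rangle+\langle e_2,[e_1,e_3]\rangle$; (C5) $[e_1,e_1]=\mathcal{D}\langle e_1,e_1\rangle$,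 where $\mathcal{D}=\frac12\pi^*\circ d$ and $E^*\cong E$ via $\langle\cdot,\cdot\rangle$. It is exact if $0\to T^*M\xrightarrow{\pi^*}E\xrightarrow{\pi}TM\to0$ is exact. A generalized complex structure on $E$ is a vector bundle endomorphism $\mathcal{J}$ of $E$ that preserves $\langle\cdot,\cdot\rangle$, satisfies $\mathcal{J}^2=-\mathrm{Id}_E$, and has vanishing Nijenhuis tensor $N_{\mathcal J}(e_1,e_2)=[\mathcal{J}e_1,\mathcal{J}e_2]-[e_1,e_2]-\mathcal{J}([e_1,\mathcal{J}e_2]+[\mathcal{J}e_1,e_2])$. $K^\perp$ is the orthogonal of $K$ in $E|_C$; $K$ isotropic means $K\subset K^\perp$. Brackets over $C$: for $e_1,e_2\in\Gamma(K^\perp)$ the restriction $[\tilde e_1,\tilde e_2]|_C$, with $\tilde e_i$ extensions to sections of $E$ over $M$, is well defined up to sections of $K$; bracket inclusions for sections over $C$ are understood in this sense. Basic sections: $\Gamma_{bas}(K^\perp):=\{e\in\Gamma(K^\perp):[\Gamma(K),e]\subset\Gamma(K)\}$. A basic section of $\mathcal{J}K^\perp\cap K^\perp$ is an element of $\Gamma_{bas}(K^\perp)$ taking values in $\mathcal{J}K^\perp\cap K^\perp$. Reduced Courant algebroid: under the stated hypotheses on $(E,C,K)$, $\pi(K)$ is a regular integrable distribution and there is an exact Courant algebroid $\underline{E}\to\underline{C}$ whose pullback to $C$ is $K^\perp/K$: two elements of $K^\perp/K$ over points $p,q$ in the same leaf of $\pi(K)$ are identified iff they are the images of the values at $p$ and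 $q$ of one basic section. Thus $\Gamma(\underline{E})\cong\Gamma_{bas}(K^\perp)/\Gamma(K)$, and pairing, bracket and anchor are induced from those of $E$ on $\Gamma_{bas}(K^\perp)$. Smooth quotient means the projection $C\to\underline{C}$ is a submersion. "$\mathcal{J}$ descends to $\underline{\mathcal{J}}$" means that whenever $e\in K^\perp\cap\mathcal{J}K^\perp$ maps to $\underline{e}\in\underline{E}$ under $K^\perp\to K^\perp/K\to\underline{E}$, the element $\mathcal{J}e$ maps to $\underline{\mathcal{J}}\,\underline{e}$, and every element of $\underline{E}$ is obtained in this way. *)

theory Defs
  imports "HOL-Analysis.Analysis"
begin

section \<open>Smooth manifolds\<close>

text \<open>
  The model space of an \<open>n\<close>-dimensional manifold is \<open>Euclidean_space n\<close>, whose points are the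
  sequences \<open>x :: nat \<Rightarrow> real\<close> with \<open>x i = 0\<close> for \<open>i \<ge> n\<close>. Dimensions are thus natural numbers
  (0 included) and \<open>Euclidean_space k\<close> is literally a coordinate subspace of
  \<open>Euclidean_space n\<close> for \<open>k \<le> n\<close>.
\<close>

definition partial_deriv :: "nat \<Rightarrow> ((nat \<Rightarrow> real) \<Rightarrow> real) \<Rightarrow> (nat \<Rightarrow> real) \<Rightarrow> real" where
  "partial_deriv i f x = deriv (\<lambda>t. f (x(i := t))) (x i)"

text \<open>\<open>Ck_on k n S f\<close>: on the open subset \<open>S\<close> of \<open>Euclidean_space n\<close>, all iterated partial
  derivatives of \<open>f\<close> of order at most \<open>k\<close> exist and are continuous.\<close>

fun Ck_on :: "nat \<Rightarrow> nat \<Rightarrow> (nat \<Rightarrow> real) set \<Rightarrow> ((nat \<Rightarrow> real) \<Rightarrow> real) \<Rightarrow> bool" where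
  "Ck_on 0 n S f \<longleftrightarrow> continuous_map (subtopology (Euclidean_space n) S) euclideanreal f"
| "Ck_on (Suc k) n S f \<longleftrightarrow>
     continuous_map (subtopology (Euclidean_space n) S) euclideanreal f \<and>
     (\<forall>i<n. (\<forall>x\<in>S. (\<lambda>t. f (x(i := t))) differentiable (at (x i))) \<and>
            Ck_on k n S (partial_deriv i f))"

definition smooth_on :: "nat \<Rightarrow> (nat \<Rightarrow> real) set \<Rightarrow> ((nat \<Rightarrow> real) \<Rightarrow> real) \<Rightarrow> bool" where
  "smooth_on n S f \<longleftrightarrow> (\<forall>k. Ck_on k n S f)"

type_synonym 'm chart = "'m set \<times> ('m \<Rightarrow> nat \<Rightarrow> real)"

record 'm manifold =
  points :: "'m set"
  dimn :: nat
  charts :: "'m chart set"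

definition is_chart :: "nat \<Rightarrow> 'm chart \<Rightarrow> bool" where
  "is_chart n = (\<lambda>(U, \<phi>). inj_on \<phi> U \<and> openin (Euclidean_space n) (\<phi> ` U))"

definition smooth_transition :: "nat \<Rightarrow> 'm chart \<Rightarrow> 'm chart \<Rightarrow> bool" where
  "smooth_transition n = (\<lambda>(U, \<phi>) (V, \<psi>).
     openin (Euclidean_space n) (\<phi> ` (U \<inter> V)) \<and>
     (\<forall>i<n. smooth_on n (\<phi> ` (U \<inter> V)) (\<lambda>x. \<psi> (inv_into U \<phi> x) i)))"

definition is_atlas :: "'m manifold \<Rightarrow> bool" where
  "is_atlas M \<longleftrightarrow>
     (\<forall>c\<in>charts M. is_chart (dimn M) c) \<and> (\<Union>(fst ` charts M)) = points M \<and>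
     (\<forall>c\<in>charts M. \<forall>d\<in>charts M. smooth_transition (dimn M) c d)"

definition mtopology :: "'m manifold \<Rightarrow> 'm topology" where
  "mtopology M = topology (\<lambda>W. W \<subseteq> points M \<and>
     (\<forall>(U, \<phi>)\<in>charts M. openin (Euclidean_space (dimn M)) (\<phi> ` (U \<inter> W))))"

lemma openin_mtopology:
  assumes "is_atlas M"
  shows "openin (mtopology M) W \<longleftrightarrow> W \<subseteq> points M \<and>
     (\<forall>(U, \<phi>)\<in>charts M. openin (Euclidean_space (dimn M)) (\<phi> ` (U \<inter> W)))"
proof -
  have inj: "inj_on \<phi> U" if "(U, \<phi>) \<in> charts M" for U \<phi>
    using assms that by (auto simp: is_atlas_def is_chart_def)
  have "istopology (\<lambda>W. W \<subseteq> points M \<and>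
     (\<forall>(U, \<phi>)\<in>charts M. openin (Euclidean_space (dimn M)) (\<phi> ` (U \<inter> W))))"
    unfolding istopology_def
  proof (intro conjI allI impI ballI; clarify?)
    fix S T U \<phi>
    assume c: "(U, \<phi>) \<in> charts M"
      and S: "\<forall>(U, \<phi>)\<in>charts M. openin (Euclidean_space (dimn M)) (\<phi> ` (U \<inter> S))"
      and T: "\<forall>(U, \<phi>)\<in>charts M. openin (Euclidean_space (dimn M)) (\<phi> ` (U \<inter> T))"
    have "\<phi> ` (U \<inter> (S \<inter> T)) = \<phi> ` (U \<inter> S) \<inter> \<phi> ` (U \<inter> T)"
      using inj[OF c] by (auto simp: inj_on_def)
    then show "openin (Euclidean_space (dimn M)) (\<phi> ` (U \<inter> (S \<inter> T)))"
      using S T c by fastforce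
  next
    fix \<K> U \<phi>
    assume c: "(U, \<phi>) \<in> charts M"
      and K: "\<forall>K\<in>\<K>. K \<subseteq> points M \<and>
        (\<forall>(U, \<phi>)\<in>charts M. openin (Euclidean_space (dimn M)) (\<phi> ` (U \<inter> K)))"
    have "\<phi> ` (U \<inter> \<Union>\<K>) = \<Union>((\<lambda>K. \<phi> ` (U \<inter> K)) ` \<K>)"
      by auto
    then show "openin (Euclidean_space (dimn M)) (\<phi> ` (U \<inter> \<Union>\<K>))"
      using K c by fastforce
  qed auto
  then show ?thesis
    unfolding mtopology_def by (simp add: topology_inverse')
qed

definition smooth_manifold :: "'m manifold \<Rightarrow> bool" where
  "smooth_manifold M \<longleftrightarrow>
     is_atlas M \<and> Hausdorff_space (mtopology M) \<and> second_countable (mtopology M)"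

text \<open>The given atlas need not be maximal; \<open>maximal_atlas\<close> is the smooth structure it generates.\<close>

definition maximal_atlas :: "'m manifold \<Rightarrow> 'm chart set" where
  "maximal_atlas M = {c. fst c \<subseteq> points M \<and> is_chart (dimn M) c \<and>
     (\<forall>d\<in>charts M. smooth_transition (dimn M) c d \<and> smooth_transition (dimn M) d c)}"

definition smooth_fun_on :: "'m manifold \<Rightarrow> 'm set \<Rightarrow> ('m \<Rightarrow> real) \<Rightarrow> bool" where
  "smooth_fun_on M W f \<longleftrightarrow>
     (\<forall>(U, \<phi>)\<in>charts M. smooth_on (dimn M) (\<phi> ` (U \<inter> W)) (f \<circ> inv_into U \<phi>))"

abbreviation smooth_fun :: "'m manifold \<Rightarrow> ('m \<Rightarrow> real) \<Rightarrow> bool" where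
  "smooth_fun M f \<equiv> smooth_fun_on M (points M) f"

definition smooth_map :: "'m manifold \<Rightarrow> 'n manifold \<Rightarrow> ('m \<Rightarrow> 'n) \<Rightarrow> bool" where
  "smooth_map M N F \<longleftrightarrow> F ` points M \<subseteq> points N \<and>
     (\<forall>(U, \<phi>)\<in>charts M. \<forall>(V, \<psi>)\<in>charts N.
        openin (mtopology M) {p\<in>U. F p \<in> V} \<and>
        (\<forall>i<dimn N. smooth_on (dimn M) (\<phi> ` {p\<in>U. F p \<in> V}) (\<lambda>x. \<psi> (F (inv_into U \<phi> x)) i)))"

text \<open>
  Tangent vectors at \<open>p\<close> are the derivations at \<open>p\<close> of the algebra of smooth functions; they are
  set to 0 on non-smooth functions, so that equal derivations are equal HOL functions. Linear
  operations on tangent vectors are pointwise.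
\<close>

definition tangent :: "'m manifold \<Rightarrow> 'm \<Rightarrow> (('m \<Rightarrow> real) \<Rightarrow> real) set" where
  "tangent M p = {v.
     (\<forall>f. \<not> smooth_fun M f \<longrightarrow> v f = 0) \<and>
     (\<forall>f g. smooth_fun M f \<longrightarrow> smooth_fun M g \<longrightarrow>
        (\<forall>a b. v (\<lambda>x. a * f x + b * g x) = a * v f + b * v g) \<and>
        v (\<lambda>x. f x * g x) = f p * v g + g p * v f)}"

definition cotangent :: "'m manifold \<Rightarrow> 'm \<Rightarrow> ((('m \<Rightarrow> real) \<Rightarrow> real) \<Rightarrow> real) set" where
  "cotangent M p = {\<xi>.
     (\<forall>v. v \<notin> tangent M p \<longrightarrow> \<xi> v = 0) \<and>
     (\<forall>v\<in>tangent M p. \<forall>w\<in>tangent M p. \<forall>a b. \<xi> (\<lambda>f. a * v f + b * w f) = a * \<xi> v + b * \<xi> w)}"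

definition differential ::
    "'m manifold \<Rightarrow> ('m \<Rightarrow> real) \<Rightarrow> 'm \<Rightarrow> (('m \<Rightarrow> real) \<Rightarrow> real) \<Rightarrow> real" where
  "differential M f p = (\<lambda>v. if v \<in> tangent M p then v f else 0)"

definition tangent_map ::
    "'n manifold \<Rightarrow> ('m \<Rightarrow> 'n) \<Rightarrow> (('m \<Rightarrow> real) \<Rightarrow> real) \<Rightarrow> ('n \<Rightarrow> real) \<Rightarrow> real" where
  "tangent_map N F v = (\<lambda>g. if smooth_fun N g then v (g \<circ> F) else 0)"

definition submersion :: "'m manifold \<Rightarrow> 'n manifold \<Rightarrow> ('m \<Rightarrow> 'n) \<Rightarrow> bool" where
  "submersion M N F \<longleftrightarrow> smooth_map M N F \<and>
     (\<forall>p\<in>points M. tangent_map N F ` tangent M p = tangent N (F p))"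

text \<open>Embedded submanifolds of dimension \<open>k\<close>, with the smooth structure given by slice charts.\<close>

definition slice_charts :: "'m manifold \<Rightarrow> 'm set \<Rightarrow> nat \<Rightarrow> 'm chart set" where
  "slice_charts M C k = {(U, \<phi>). (U, \<phi>) \<in> maximal_atlas M \<and>
     \<phi> ` (U \<inter> C) = \<phi> ` U \<inter> topspace (Euclidean_space k)}"

definition embedded_submanifold :: "'m manifold \<Rightarrow> 'm set \<Rightarrow> nat \<Rightarrow> bool" where
  "embedded_submanifold M C k \<longleftrightarrow> C \<subseteq> points M \<and> k \<le> dimn M \<and>
     (\<forall>p\<in>C. \<exists>(U, \<phi>)\<in>slice_charts M C k. p \<in> U)"

definition submanifold_of :: "'m manifold \<Rightarrow> 'm set \<Rightarrow> nat \<Rightarrow> 'm manifold" where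
  "submanifold_of M C k =
     \<lparr>points = C, dimn = k, charts = (\<lambda>(U, \<phi>). (U \<inter> C, \<phi>)) ` slice_charts M C k\<rparr>"

section \<open>Leaves of a distribution\<close>

text \<open>
  A distribution on \<open>N\<close> is a family \<open>D\<close> of subsets \<open>D p\<close> of \<open>tangent N p\<close>. A connected integral
  manifold carries its own manifold structure, whose topology may be finer than the subspace
  topology (it is only immersed). Leaves are the maximal ones.
\<close>

definition connected_integral_manifold ::
    "'m manifold \<Rightarrow> ('m \<Rightarrow> (('m \<Rightarrow> real) \<Rightarrow> real) set) \<Rightarrow> 'm manifold \<Rightarrow> bool" where
  "connected_integral_manifold N D L \<longleftrightarrow>
     smooth_manifold L \<and> points L \<noteq> {} \<and> connected_space (mtopology L) \<and>
     points L \<subseteq> points N \<and> smooth_map L N (\<lambda>p. p) \<and>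
     (\<forall>p\<in>points L. inj_on (tangent_map N (\<lambda>p. p)) (tangent L p) \<and>
                   tangent_map N (\<lambda>p. p) ` tangent L p = D p)"

definition leaves :: "'m manifold \<Rightarrow> ('m \<Rightarrow> (('m \<Rightarrow> real) \<Rightarrow> real) set) \<Rightarrow> 'm set set" where
  "leaves N D = {points L | L. connected_integral_manifold N D L \<and>
     (\<forall>L'. connected_integral_manifold N D L' \<longrightarrow> points L' \<inter> points L \<noteq> {} \<longrightarrow>
           points L' \<subseteq> points L)}"

definition leaf_of :: "'m manifold \<Rightarrow> ('m \<Rightarrow> (('m \<Rightarrow> real) \<Rightarrow> real) set) \<Rightarrow> 'm \<Rightarrow> 'm set" where
  "leaf_of N D p = (THE l. l \<in> leaves N D \<and> p \<in> l)"

section \<open>Vector bundles\<close>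

text \<open>
  The fibre of a vector bundle over \<open>p\<close> is a linear subspace \<open>fibre E p\<close> of the type \<open>'v\<close>, the
  total space being the disjoint union of the fibres. Since \<open>'v\<close> may be infinite-dimensional (for
  instance the direct sum of all the fibres), every vector bundle is of this form up to
  isomorphism; no relation between different fibres is implied. Local trivialisations are given
  as local frames \<open>(U, b)\<close>, the frame at \<open>p \<in> U\<close> being \<open>b 0 p, \<dots>, b (r - 1) p\<close>.
\<close>

record ('m, 'v) vbundle =
  fibre :: "'m \<Rightarrow> 'v set"
  fibre_dim :: nat
  frames :: "('m set \<times> (nat \<Rightarrow> 'm \<Rightarrow> 'v)) set"

definition is_basis :: "nat \<Rightarrow> (nat \<Rightarrow> 'v::real_vector) \<Rightarrow> 'v set \<Rightarrow> bool" where
  "is_basis r b V \<longleftrightarrow>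
     inj_on b {..<r} \<and> independent (b ` {..<r}) \<and> span (b ` {..<r}) = V"

definition linear_on_space ::
    "'v::real_vector set \<Rightarrow> ('v \<Rightarrow> 'w::real_vector) \<Rightarrow> bool" where
  "linear_on_space V f \<longleftrightarrow>
     (\<forall>v\<in>V. \<forall>w\<in>V. \<forall>a b. f (a *\<^sub>R v + b *\<^sub>R w) = a *\<^sub>R f v + b *\<^sub>R f w)"

definition vector_bundle :: "'m manifold \<Rightarrow> ('m, 'v::real_vector, 'z) vbundle_scheme \<Rightarrow> bool" where
  "vector_bundle M E \<longleftrightarrow>
     (\<forall>(U, b)\<in>frames E. openin (mtopology M) U \<and>
        (\<forall>p\<in>U. is_basis (fibre_dim E) (\<lambda>i. b i p) (fibre E p))) \<and>
     (\<Union>(fst ` frames E)) = points M \<and>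
     (\<forall>(U, b)\<in>frames E. \<forall>(V, c)\<in>frames E. \<exists>g.
        (\<forall>i<fibre_dim E. \<forall>j<fibre_dim E. smooth_fun_on M (U \<inter> V) (g i j)) \<and>
        (\<forall>p\<in>U \<inter> V. \<forall>j<fibre_dim E. c j p = (\<Sum>i<fibre_dim E. g i j p *\<^sub>R b i p)))"

definition smooth_section_on ::
    "'m manifold \<Rightarrow> ('m, 'v::real_vector, 'z) vbundle_scheme \<Rightarrow> 'm set \<Rightarrow> ('m \<Rightarrow> 'v) \<Rightarrow> bool" where
  "smooth_section_on M E W s \<longleftrightarrow>
     (\<forall>p\<in>W. s p \<in> fibre E p) \<and>
     (\<forall>(U, b)\<in>frames E. \<exists>a. (\<forall>i<fibre_dim E. smooth_fun_on M (U \<inter> W) (a i)) \<and>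
        (\<forall>p\<in>U \<inter> W. s p = (\<Sum>i<fibre_dim E. a i p *\<^sub>R b i p)))"

text \<open>Global sections are normalised to be 0 off the base.\<close>

definition sections ::
    "'m manifold \<Rightarrow> ('m, 'v::real_vector, 'z) vbundle_scheme \<Rightarrow> ('m \<Rightarrow> 'v) set" where
  "sections M E = {s. smooth_section_on M E (points M) s \<and> (\<forall>p. p \<notin> points M \<longrightarrow> s p = 0)}"

definition restrict_bundle ::
    "('m, 'v, 'z) vbundle_scheme \<Rightarrow> 'm manifold \<Rightarrow> ('m, 'v) vbundle" where
  "restrict_bundle E S =
     \<lparr>fibre = fibre E, fibre_dim = fibre_dim E, frames = (\<lambda>(U, b). (U \<inter> points S, b)) ` frames E\<rparr>"

definition subbundle ::
    "'m manifold \<Rightarrow> ('m, 'v::real_vector, 'z) vbundle_scheme \<Rightarrow> ('m \<Rightarrow> 'v set) \<Rightarrow> bool" where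
  "subbundle M E K \<longleftrightarrow>
     (\<forall>p\<in>points M. subspace (K p) \<and> K p \<subseteq> fibre E p) \<and>
     (\<exists>r. \<forall>p\<in>points M. \<exists>W b. openin (mtopology M) W \<and> p \<in> W \<and>
        (\<forall>i<r. smooth_section_on M E W (b i)) \<and>
        (\<forall>x\<in>W. is_basis r (\<lambda>i. b i x) (K x)))"

definition bundle_endomorphism ::
    "'m manifold \<Rightarrow> ('m, 'v::real_vector, 'z) vbundle_scheme \<Rightarrow> ('m \<Rightarrow> 'v \<Rightarrow> 'v) \<Rightarrow> bool" where
  "bundle_endomorphism M E J \<longleftrightarrow>
     (\<forall>p\<in>points M. J p ` fibre E p \<subseteq> fibre E p \<and> linear_on_space (fibre E p) (J p)) \<and>
     (\<forall>(U, b)\<in>frames E. \<exists>g.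
        (\<forall>i<fibre_dim E. \<forall>j<fibre_dim E. smooth_fun_on M U (g i j)) \<and>
        (\<forall>p\<in>U. \<forall>j<fibre_dim E. J p (b j p) = (\<Sum>i<fibre_dim E. g i j p *\<^sub>R b i p)))"

definition apply_endo :: "'m manifold \<Rightarrow> ('m \<Rightarrow> 'v \<Rightarrow> 'v) \<Rightarrow> ('m \<Rightarrow> 'v::zero) \<Rightarrow> 'm \<Rightarrow> 'v" where
  "apply_endo M J e = (\<lambda>p. if p \<in> points M then J p (e p) else 0)"

section \<open>Courant algebroids and generalized complex structures\<close>

record ('m, 'v) courant = "('m, 'v) vbundle" +
  pairing :: "'m \<Rightarrow> 'v \<Rightarrow> 'v \<Rightarrow> real"
  bracket :: "('m \<Rightarrow> 'v) \<Rightarrow> ('m \<Rightarrow> 'v) \<Rightarrow> 'm \<Rightarrow> 'v"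
  anchor :: "'m \<Rightarrow> 'v \<Rightarrow> ('m \<Rightarrow> real) \<Rightarrow> real"

definition smooth_metric :: "'m manifold \<Rightarrow> ('m, 'v::real_vector) courant \<Rightarrow> bool" where
  "smooth_metric M A \<longleftrightarrow>
     (\<forall>p\<in>points M.
        (\<forall>v\<in>fibre A p. linear_on_space (fibre A p) (pairing A p v)) \<and>
        (\<forall>v\<in>fibre A p. \<forall>w\<in>fibre A p. pairing A p v w = pairing A p w v) \<and>
        (\<forall>v\<in>fibre A p. (\<forall>w\<in>fibre A p. pairing A p v w = 0) \<longrightarrow> v = 0)) \<and>
     (\<forall>(U, b)\<in>frames A. \<forall>i<fibre_dim A. \<forall>j<fibre_dim A.
        smooth_fun_on M U (\<lambda>p. pairing A p (b i p) (b j p)))"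

definition smooth_anchor :: "'m manifold \<Rightarrow> ('m, 'v::real_vector) courant \<Rightarrow> bool" where
  "smooth_anchor M A \<longleftrightarrow>
     (\<forall>p\<in>points M. anchor A p ` fibre A p \<subseteq> tangent M p \<and>
        (\<forall>v\<in>fibre A p. \<forall>w\<in>fibre A p. \<forall>a b.
           anchor A p (a *\<^sub>R v + b *\<^sub>R w) = (\<lambda>f. a * anchor A p v f + b * anchor A p w f))) \<and>
     (\<forall>(U, b)\<in>frames A. \<forall>i<fibre_dim A. \<forall>f. smooth_fun M f \<longrightarrow>
        smooth_fun_on M U (\<lambda>p. anchor A p (b i p) f))"

text \<open>The composite of \<open>\<pi>\<^sup>* : T\<^sup>*M \<rightarrow> E\<^sup>*\<close> with the isomorphism \<open>E\<^sup>* \<cong> E\<close> given by the pairing.\<close>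

definition anchor_dual ::
    "('m, 'v) courant \<Rightarrow> 'm \<Rightarrow> ((('m \<Rightarrow> real) \<Rightarrow> real) \<Rightarrow> real) \<Rightarrow> 'v" where
  "anchor_dual A p \<xi> =
     (THE w. w \<in> fibre A p \<and> (\<forall>v\<in>fibre A p. pairing A p w v = \<xi> (anchor A p v)))"

definition courant_D ::
    "'m manifold \<Rightarrow> ('m, 'v::real_vector) courant \<Rightarrow> ('m \<Rightarrow> real) \<Rightarrow> 'm \<Rightarrow> 'v" where
  "courant_D M A f p = (1/2) *\<^sub>R anchor_dual A p (differential M f p)"

definition courant_algebroid :: "'m manifold \<Rightarrow> ('m, 'v::real_vector) courant \<Rightarrow> bool" where
  "courant_algebroid M A \<longleftrightarrow>
     vector_bundle M A \<and> smooth_metric M A \<and> smooth_anchor M A \<and>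
     (\<forall>e1\<in>sections M A. \<forall>e2\<in>sections M A. bracket A e1 e2 \<in> sections M A) \<and>
     (\<forall>e1\<in>sections M A. \<forall>e2\<in>sections M A. \<forall>e3\<in>sections M A. \<forall>a b. \<forall>p\<in>points M.
        bracket A (\<lambda>q. a *\<^sub>R e1 q + b *\<^sub>R e2 q) e3 p
          = a *\<^sub>R bracket A e1 e3 p + b *\<^sub>R bracket A e2 e3 p \<and>
        bracket A e3 (\<lambda>q. a *\<^sub>R e1 q + b *\<^sub>R e2 q) p
          = a *\<^sub>R bracket A e3 e1 p + b *\<^sub>R bracket A e3 e2 p) \<and>
     (\<forall>e1\<in>sections M A. \<forall>e2\<in>sections M A. \<forall>e3\<in>sections M A. \<forall>p\<in>points M.
        bracket A e1 (bracket A e2 e3) p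
          = bracket A (bracket A e1 e2) e3 p + bracket A e2 (bracket A e1 e3) p) \<and>
     (\<forall>e1\<in>sections M A. \<forall>e2\<in>sections M A. \<forall>f. smooth_fun M f \<longrightarrow> (\<forall>p\<in>points M.
        anchor A p (bracket A e1 e2 p) f
          = anchor A p (e1 p) (\<lambda>q. anchor A q (e2 q) f)
            - anchor A p (e2 p) (\<lambda>q. anchor A q (e1 q) f))) \<and>
     (\<forall>e1\<in>sections M A. \<forall>e2\<in>sections M A. \<forall>f. smooth_fun M f \<longrightarrow> (\<forall>p\<in>points M.
        bracket A e1 (\<lambda>q. f q *\<^sub>R e2 q) p
          = f p *\<^sub>R bracket A e1 e2 p + anchor A p (e1 p) f *\<^sub>R e2 p)) \<and>
     (\<forall>e1\<in>sections M A. \<forall>e2\<in>sections M A. \<forall>e3\<in>sections M A. \<forall>p\<in>points M.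
        anchor A p (e1 p) (\<lambda>q. pairing A q (e2 q) (e3 q))
          = pairing A p (bracket A e1 e2 p) (e3 p) + pairing A p (e2 p) (bracket A e1 e3 p)) \<and>
     (\<forall>e\<in>sections M A. \<forall>p\<in>points M.
        bracket A e e p = courant_D M A (\<lambda>q. pairing A q (e q) (e q)) p)"

definition exact_courant_algebroid :: "'m manifold \<Rightarrow> ('m, 'v::real_vector) courant \<Rightarrow> bool" where
  "exact_courant_algebroid M A \<longleftrightarrow> courant_algebroid M A \<and>
     (\<forall>p\<in>points M.
        inj_on (anchor_dual A p) (cotangent M p) \<and>
        anchor_dual A p ` cotangent M p = {v\<in>fibre A p. anchor A p v = (\<lambda>f. 0)} \<and>
        anchor A p ` fibre A p = tangent M p)"

definition nijenhuis :: "'m manifold \<Rightarrow> ('m, 'v::real_vector) courant \<Rightarrow> ('m \<Rightarrow> 'v \<Rightarrow> 'v) \<Rightarrow>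
    ('m \<Rightarrow> 'v) \<Rightarrow> ('m \<Rightarrow> 'v) \<Rightarrow> 'm \<Rightarrow> 'v" where
  "nijenhuis M A J e1 e2 p =
     bracket A (apply_endo M J e1) (apply_endo M J e2) p - bracket A e1 e2 p
     - J p (bracket A e1 (apply_endo M J e2) p + bracket A (apply_endo M J e1) e2 p)"

definition generalized_complex_structure ::
    "'m manifold \<Rightarrow> ('m, 'v::real_vector) courant \<Rightarrow> ('m \<Rightarrow> 'v \<Rightarrow> 'v) \<Rightarrow> bool" where
  "generalized_complex_structure M A J \<longleftrightarrow>
     bundle_endomorphism M A J \<and>
     (\<forall>p\<in>points M. \<forall>v\<in>fibre A p. \<forall>w\<in>fibre A p.
        pairing A p (J p v) (J p w) = pairing A p v w) \<and>
     (\<forall>p\<in>points M. \<forall>v\<in>fibre A p. J p (J p v) = - v) \<and>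
     (\<forall>e1\<in>sections M A. \<forall>e2\<in>sections M A. \<forall>p\<in>points M. nijenhuis M A J e1 e2 p = 0)"

section \<open>Reduction\<close>

text \<open>Throughout, \<open>S\<close> is the submanifold \<open>C\<close> of \<open>M\<close> with its manifold structure, so
  \<open>points S = C\<close>.\<close>

definition orth :: "('m, 'v) courant \<Rightarrow> ('m \<Rightarrow> 'v set) \<Rightarrow> 'm \<Rightarrow> 'v set" where
  "orth A K p = {v\<in>fibre A p. \<forall>w\<in>K p. pairing A p v w = 0}"

definition isotropic :: "('m, 'v) courant \<Rightarrow> 'm manifold \<Rightarrow> ('m \<Rightarrow> 'v set) \<Rightarrow> bool" where
  "isotropic A S K \<longleftrightarrow> (\<forall>p\<in>points S. K p \<subseteq> orth A K p)"

definition sections_in :: "('m, 'v::real_vector) courant \<Rightarrow> 'm manifold \<Rightarrow> ('m \<Rightarrow> 'v set) \<Rightarrow>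
    ('m \<Rightarrow> 'v) set" where
  "sections_in A S K = {s\<in>sections S (restrict_bundle A S). \<forall>p\<in>points S. s p \<in> K p}"

text \<open>
  The bracket at \<open>p\<close> of sections over \<open>C\<close> is a set of values, one for each choice of extensions to
  \<open>M\<close>. An extension only has to agree with the section on \<open>C\<close> near \<open>p\<close>, since a section over a
  non-closed \<open>C\<close> need not extend globally; if a global extension exists this changes nothing, the
  bracket being local.
\<close>

definition extends_near :: "'m manifold \<Rightarrow> ('m, 'v::real_vector) courant \<Rightarrow> 'm manifold \<Rightarrow>
    'm \<Rightarrow> ('m \<Rightarrow> 'v) \<Rightarrow> ('m \<Rightarrow> 'v) \<Rightarrow> bool" where
  "extends_near M A S p e x \<longleftrightarrow> x \<in> sections M A \<and>
     (\<exists>U. openin (mtopology M) U \<and> p \<in> U \<and> (\<forall>q\<in>U \<inter> points S. x q = e q))"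

definition bracket_values :: "'m manifold \<Rightarrow> ('m, 'v::real_vector) courant \<Rightarrow> 'm manifold \<Rightarrow>
    ('m \<Rightarrow> 'v) \<Rightarrow> ('m \<Rightarrow> 'v) \<Rightarrow> 'm \<Rightarrow> 'v set" where
  "bracket_values M A S e1 e2 p =
     {bracket A x1 x2 p | x1 x2. extends_near M A S p e1 x1 \<and> extends_near M A S p e2 x2}"

definition basic_sections :: "'m manifold \<Rightarrow> ('m, 'v::real_vector) courant \<Rightarrow> 'm manifold \<Rightarrow>
    ('m \<Rightarrow> 'v set) \<Rightarrow> ('m \<Rightarrow> 'v) set" where
  "basic_sections M A S K = {e\<in>sections_in A S (orth A K).
     \<forall>k\<in>sections_in A S K. \<forall>p\<in>points S. bracket_values M A S k e p \<subseteq> K p}"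

text \<open>The distribution \<open>\<pi>(K)\<close>, as a family of subspaces of the tangent spaces of \<open>C\<close> itself.\<close>

definition anchor_distribution :: "'m manifold \<Rightarrow> ('m, 'v) courant \<Rightarrow> 'm manifold \<Rightarrow>
    ('m \<Rightarrow> 'v set) \<Rightarrow> 'm \<Rightarrow> (('m \<Rightarrow> real) \<Rightarrow> real) set" where
  "anchor_distribution M A S K p =
     {w\<in>tangent S p. tangent_map M (\<lambda>q. q) w \<in> anchor A p ` K p}"

text \<open>
  \<open>B\<close> is the reduced exact Courant algebroid over \<open>Q\<close>, where \<open>q\<close> is the projection from \<open>C\<close> to
  \<open>Q\<close> and \<open>\<Phi> p\<close> is the map from \<open>K\<^sup>\<bottom>\<close> at \<open>p\<close> via \<open>K\<^sup>\<bottom>/K\<close> to the fibre of \<open>B\<close> at \<open>q p\<close>.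
\<close>

definition section_maps_to :: "'m manifold \<Rightarrow> ('m \<Rightarrow> 'n) \<Rightarrow> ('m \<Rightarrow> 'v \<Rightarrow> 'w) \<Rightarrow>
    ('m \<Rightarrow> 'v) \<Rightarrow> ('n \<Rightarrow> 'w) \<Rightarrow> bool" where
  "section_maps_to S q \<Phi> e s \<longleftrightarrow> (\<forall>p\<in>points S. \<Phi> p (e p) = s (q p))"

definition reduced_courant_algebroid ::
    "'m manifold \<Rightarrow> ('m, 'v::real_vector) courant \<Rightarrow> 'm manifold \<Rightarrow> ('m \<Rightarrow> 'v set) \<Rightarrow>
     'n manifold \<Rightarrow> ('m \<Rightarrow> 'n) \<Rightarrow> ('n, 'w::real_vector) courant \<Rightarrow> ('m \<Rightarrow> 'v \<Rightarrow> 'w) \<Rightarrow> bool" where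
  "reduced_courant_algebroid M A S K Q q B \<Phi> \<longleftrightarrow>
     exact_courant_algebroid Q B \<and>
     \<comment> \<open>the pullback of \<open>B\<close> to \<open>C\<close> is \<open>K\<^sup>\<bottom>/K\<close>\<close>
     (\<forall>p\<in>points S.
        linear_on_space (orth A K p) (\<Phi> p) \<and>
        \<Phi> p ` orth A K p = fibre B (q p) \<and>
        {v\<in>orth A K p. \<Phi> p v = 0} = K p) \<and>
     \<comment> \<open>identification along the leaves by means of basic sections\<close>
     (\<forall>p\<in>points S. \<forall>p'\<in>points S. q p = q p' \<longrightarrow>
        (\<forall>v\<in>orth A K p. \<forall>v'\<in>orth A K p'.
           \<Phi> p v = \<Phi> p' v' \<longleftrightarrow>
           (\<exists>e\<in>basic_sections M A S K. v - e p \<in> K p \<and> v' - e p' \<in> K p'))) \<and>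
     \<comment> \<open>sections of \<open>B\<close> are basic sections modulo sections of \<open>K\<close>\<close>
     (\<forall>e\<in>basic_sections M A S K. \<exists>s\<in>sections Q B. section_maps_to S q \<Phi> e s) \<and>
     (\<forall>s\<in>sections Q B. \<exists>e\<in>basic_sections M A S K. section_maps_to S q \<Phi> e s) \<and>
     \<comment> \<open>pairing, anchor and bracket are induced\<close>
     (\<forall>p\<in>points S. \<forall>v\<in>orth A K p. \<forall>w\<in>orth A K p.
        pairing B (q p) (\<Phi> p v) (\<Phi> p w) = pairing A p v w) \<and>
     (\<forall>p\<in>points S. \<forall>v\<in>orth A K p. \<forall>X\<in>tangent S p.
        tangent_map M (\<lambda>q. q) X = anchor A p v \<longrightarrow>
        anchor B (q p) (\<Phi> p v) = tangent_map Q q X) \<and>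
     (\<forall>e1\<in>basic_sections M A S K. \<forall>e2\<in>basic_sections M A S K.
      \<forall>s1\<in>sections Q B. \<forall>s2\<in>sections Q B.
        section_maps_to S q \<Phi> e1 s1 \<longrightarrow> section_maps_to S q \<Phi> e2 s2 \<longrightarrow>
        (\<forall>p\<in>points S. \<forall>x\<in>bracket_values M A S e1 e2 p.
           \<Phi> p x = bracket B s1 s2 (q p)))"

definition descends_to :: "('m, 'v::real_vector) courant \<Rightarrow> 'm manifold \<Rightarrow> ('m \<Rightarrow> 'v set) \<Rightarrow>
    'n manifold \<Rightarrow> ('m \<Rightarrow> 'n) \<Rightarrow> ('n, 'w::real_vector) courant \<Rightarrow> ('m \<Rightarrow> 'v \<Rightarrow> 'w) \<Rightarrow>
    ('m \<Rightarrow> 'v \<Rightarrow> 'v) \<Rightarrow> ('n \<Rightarrow> 'w \<Rightarrow> 'w) \<Rightarrow> bool" where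
  "descends_to A S K Q q B \<Phi> J J' \<longleftrightarrow>
     (\<forall>p\<in>points S. \<forall>e\<in>orth A K p \<inter> J p ` orth A K p.
        J p e \<in> orth A K p \<and> \<Phi> p (J p e) = J' (q p) (\<Phi> p e)) \<and>
     (\<forall>l\<in>points Q. \<forall>x\<in>fibre B l. \<exists>p\<in>points S. q p = l \<and>
        (\<exists>e\<in>orth A K p \<inter> J p ` orth A K p. \<Phi> p e = x))"

end

theory Submission
  imports Defs
begin

text \<open>
  Write \<open>D = K\<^sup>\<bottom> \<inter> J K\<^sup>\<bottom>\<close>. Taking orthogonals in \<open>J K \<inter> K\<^sup>\<bottom> \<subseteq> K\<close> gives \<open>K\<^sup>\<bottom> = D + K\<close>, and \<open>J\<close> preserves both
  \<open>D\<close> and \<open>D \<inter> K\<close>, so it induces an endomorphism of \<open>K\<^sup>\<bottom>/K\<close> at every point of \<open>C\<close>. It is constant along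
  the leaves because every basic section \<open>e\<close> can be corrected by a section \<open>\<kappa>\<close> of \<open>K\<close> so that \<open>e + \<kappa>\<close> lies in
  \<open>D\<close>. Indeed \<open>\<kappa>\<close> solves \<open>\<langle>\<kappa>, J w\<rangle> = - \<langle>e, J w\<rangle>\<close> for all \<open>w\<close> in \<open>K\<close>, a linear equation for a skew form on \<open>K\<close>
  whose radical \<open>J K \<inter> K\<^sup>\<bottom>\<close> has constant rank; it is solved locally by symplectic Gram-Schmidt, and the
  solutions, forming an affine space, are glued by a partition of unity. Sections of \<open>K\<close> are basic since
  basic sections span \<open>K\<^sup>\<bottom>\<close>, so \<open>e + \<kappa>\<close> and \<open>J (e + \<kappa>)\<close> are basic. Hence the induced structure maps smooth
  sections to smooth sections, and its Nijenhuis tensor is computed upstairs from extensions to \<open>M\<close>, where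
  brackets of basic sections take values in \<open>K\<^sup>\<bottom>\<close>.
\<close>

section \<open>Calculus on open subsets of Euclidean space\<close>

text \<open>The pointwise splitting \<open>K\<^sup>\<bottom> = D + K\<close> does not suffice:
  points of one leaf are compared only through basic sections, which live over all of
  \<open>C\<close>. The splitting must therefore be realised smoothly and globally, by a section
  that stays basic, and before \<open>J\<close> is applied, since the hypothesis on \<open>J\<close>
  concerns only sections with values in \<open>D\<close>. No choice is canonical:
  \<open>\<kappa>\<close> is determined only up to
  \<open>D \<inter> K = J K \<inter> K\<^sup>\<bottom>\<close>, the radical of
  \<open>\<langle>v, J w\<rangle>\<close> on \<open>K\<close>. Its constant rank allows a degenerate
  linear system to be solved with smooth dependence on the point. The same identity shows why
  \<open>J\<close> preserves \<open>D \<inter> K\<close>: for \<open>v\<close> in it,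
  \<open>J v\<close> lies in \<open>D\<close> and in \<open>J K\<close>, hence in
  \<open>J K \<inter> K\<^sup>\<bottom> \<subseteq> K\<close>. In the Nijenhuis tensor the delicate
  term is \<open>J\<close> applied to a sum of two brackets, known only to lie in
  \<open>K\<^sup>\<bottom>\<close>. Vanishing upstairs equates this term with a difference of values
  in \<open>K\<^sup>\<bottom>\<close>, and this puts the argument of \<open>J\<close> into
  \<open>D\<close>.\<close>

abbreviation ES :: "nat \<Rightarrow> (nat \<Rightarrow> real) set" where
  "ES n \<equiv> {x. \<forall>i\<ge>n. x i = 0}"

lemma Euclidean_space_eq: "Euclidean_space n = top_of_set (ES n)"
  by (simp add: Euclidean_space_def euclidean_product_topology)

lemma continuous_map_Euclidean_space_iff:
  assumes "openin (Euclidean_space n) S"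
  shows "continuous_map (subtopology (Euclidean_space n) S) euclideanreal f \<longleftrightarrow> continuous_on S f"
proof -
  have "ES n \<inter> S = S"
    using openin_subset[OF assms] by (auto simp: topspace_Euclidean_space)
  then show ?thesis
    by (simp add: Euclidean_space_eq subtopology_subtopology)
qed

lemma openin_Euclidean_space_ES:
  assumes "openin (Euclidean_space n) S" "x \<in> S"
  shows "x \<in> ES n"
  using openin_subset[OF assms(1)] assms(2) by (auto simp: topspace_Euclidean_space)

lemma openin_Euclidean_space_box:
  assumes "openin (Euclidean_space n) S" "x \<in> S"
  obtains e where "e > 0" "\<And>z. z \<in> ES n \<Longrightarrow> (\<forall>i<n. \<bar>z i - x i\<bar> < e) \<Longrightarrow> z \<in> S"
proof -
  obtain T where T: "open T" "S = ES n \<inter> T"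
    using assms(1) by (auto simp: Euclidean_space_eq openin_open)
  have op: "openin (product_topology (\<lambda>i. euclidean) UNIV) T"
    using T(1) by (simp add: euclidean_product_topology)
  then obtain U where U: "x \<in> Pi\<^sub>E UNIV U" "\<And>i. open (U i)" "finite {i. U i \<noteq> UNIV}" "Pi\<^sub>E UNIV U \<subseteq> T"
    using product_topology_open_contains_basis[OF op] assms(2) T(2) by force
  have "\<exists>e>0. \<forall>y. \<bar>y - x i\<bar> < e \<longrightarrow> y \<in> U i" for i
  proof -
    have "x i \<in> U i" using U(1) by auto
    then show ?thesis using U(2)[of i] by (auto simp: open_dist dist_real_def)
  qed
  then obtain e where e: "\<And>i. e i > 0" "\<And>i y. \<bar>y - x i\<bar> < e i \<Longrightarrow> y \<in> U i"
    by metis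
  \<comment> \<open>The 1 keeps the minimum meaningful for \<open>n = 0\<close>. Coordinates from
    \<open>n\<close> on impose nothing, as both points vanish there.\<close>
  define d where "d = Min (insert 1 (e ` {..<n}))"
  have "d > 0" unfolding d_def using e(1) by auto
  moreover have "z \<in> S" if z: "z \<in> ES n" "\<forall>i<n. \<bar>z i - x i\<bar> < d" for z
  proof -
    have xz: "x i = 0" "z i = 0" if "i \<ge> n" for i
      using that z openin_Euclidean_space_ES[OF assms] by auto
    have "z i \<in> U i" for i
    proof (cases "i < n")
      case True
      then have "d \<le> e i" unfolding d_def by auto
      then show ?thesis using z(2) True e(2)[of "z i" i] by force
    next
      case False
      then show ?thesis using xz[of i] U(1) by (metis PiE_E UNIV_I linorder_not_le)
    qed
    then have "z \<in> T" using U(4) by (auto simp: PiE_iff)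
    then show ?thesis using T z by auto
  qed
  ultimately show ?thesis using that by blast
qed

lemma eventually_line_in_open:
  assumes "openin (Euclidean_space n) S" "x \<in> S" "i < n"
  shows "\<forall>\<^sub>F t in nhds (x i). x(i := t) \<in> S"
proof -
  obtain e where e: "e > 0" "\<And>z. z \<in> ES n \<Longrightarrow> (\<forall>i<n. \<bar>z i - x i\<bar> < e) \<Longrightarrow> z \<in> S"
    using openin_Euclidean_space_box[OF assms(1,2)] by blast
  have "x(i := t) \<in> S" if "dist t (x i) < e" for t
    using that openin_Euclidean_space_ES[OF assms(1,2)] assms(3) e(1)
    by (intro e(2)) (auto simp: dist_real_def)
  then show ?thesis
    using e(1) by (auto simp: eventually_nhds_metric)
qed

lemma Ck_on_imp_continuous_on:
  assumes "Ck_on k n S f" "openin (Euclidean_space n) S"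
  shows "continuous_on S f"
  using assms by (cases k) (auto simp: continuous_map_Euclidean_space_iff)

lemma Ck_on_Suc_has_derivative:
  assumes "Ck_on (Suc k) n S f" "x \<in> S" "i < n"
  shows "((\<lambda>t. f (x(i := t))) has_real_derivative partial_deriv i f x) (at (x i))"
  using assms unfolding partial_deriv_def
  by (simp add: DERIV_deriv_iff_real_differentiable)

text \<open>\<open>partial_deriv\<close> looks at a total function along a coordinate line.
  Agreement on \<open>S\<close> passes to derivatives because a line through a point of the open set
  \<open>S\<close> stays in \<open>S\<close> for a while.\<close>

lemma Ck_on_cong:
  assumes "Ck_on k n S f" "openin (Euclidean_space n) S" "\<And>x. x \<in> S \<Longrightarrow> f x = g x"
  shows "Ck_on k n S g"
  using assms
proof (induction k arbitrary: f g)
  case 0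
  then show ?case
    by (simp add: continuous_map_Euclidean_space_iff cong: continuous_on_cong)
next
  case (Suc k)
  have ev: "\<forall>\<^sub>F t in nhds (x i). f (x(i := t)) = g (x(i := t))" if "x \<in> S" "i < n" for x i
    using eventually_line_in_open[OF Suc.prems(2) that] by eventually_elim (use Suc.prems(3) in auto)
  have d: "((\<lambda>t. g (x(i := t))) has_real_derivative partial_deriv i f x) (at (x i))" if "x \<in> S" "i < n" for x i
    by (rule iffD1[OF DERIV_cong_ev[OF refl ev[OF that] refl] Ck_on_Suc_has_derivative[OF Suc.prems(1) that]])
  then have eq: "partial_deriv i g x = partial_deriv i f x" if "x \<in> S" "i < n" for x i
    using that by (simp add: partial_deriv_def DERIV_imp_deriv)
  have "continuous_on S g"
    using Ck_on_imp_continuous_on[OF Suc.prems(1,2)] Suc.prems(3) by (simp cong: continuous_on_cong)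
  moreover have "(\<lambda>t. g (x(i := t))) differentiable (at (x i))" if "x \<in> S" "i < n" for x i
    using d[OF that] by (auto simp: real_differentiable_def)
  moreover have "Ck_on k n S (partial_deriv i g)" if "i < n" for i
    using Suc.IH[of "partial_deriv i f" "partial_deriv i g"] Suc.prems that eq by auto
  ultimately show ?case
    using Suc.prems(2) by (simp add: continuous_map_Euclidean_space_iff)
qed

text \<open>Any formula \<open>g i\<close> that is correct on \<open>S\<close> may stand for the
  partial derivative, so the closure proofs below need not manipulate \<open>deriv\<close>
  itself.\<close>

lemma Ck_on_SucI:
  assumes "openin (Euclidean_space n) S" "continuous_on S f"
    and "\<And>i. i < n \<Longrightarrow> Ck_on k n S (g i)"
    and "\<And>i x. i < n \<Longrightarrow> x \<in> S \<Longrightarrow> ((\<lambda>t. f (x(i := t))) has_real_derivative g i x) (at (x i))"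
  shows "Ck_on (Suc k) n S f"
proof -
  have "Ck_on k n S (partial_deriv i f)" if "i < n" for i
  proof (rule Ck_on_cong[OF assms(3)[OF that] assms(1)])
    show "g i x = partial_deriv i f x" if "x \<in> S" for x
      using assms(4)[OF \<open>i < n\<close> that] by (simp add: partial_deriv_def DERIV_imp_deriv)
  qed
  moreover have "(\<lambda>t. f (x(i := t))) differentiable (at (x i))" if "x \<in> S" "i < n" for x i
    using assms(4)[OF that(2,1)] by (auto simp: real_differentiable_def)
  ultimately show ?thesis
    using assms(1,2) by (simp add: continuous_map_Euclidean_space_iff)
qed

lemma Ck_on_Suc_imp: "Ck_on (Suc k) n S f \<Longrightarrow> Ck_on k n S f"
proof (induction k arbitrary: f)
  case 0
  then show ?case by simp
next
  case (Suc k)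
  note * = Suc.prems[unfolded Ck_on.simps(2)[of "Suc k"]]
  have "Ck_on k n S (partial_deriv i f)" if "i < n" for i
    using * that by (intro Suc.IH) blast
  then show ?case
    using * by (simp only: Ck_on.simps(2)[of k]) blast
qed

text \<open>For the passage to slices: in the first \<open>m\<close> directions the partial
  derivatives of the restriction are the same total functions, so only the sets on which continuity
  is required change.\<close>

lemma Ck_on_restrict:
  assumes "Ck_on k n S f" "m \<le> n" "T \<subseteq> S"
  shows "Ck_on k m (T \<inter> ES m) f"
proof -
  have sub: "ES m \<inter> (T \<inter> ES m) \<subseteq> ES n \<inter> S"
    using assms(2,3) by auto
  show ?thesis
    using assms(1)
  proof (induction k arbitrary: f)
    case 0
    then show ?case
      using continuous_on_subset[OF _ sub, of f] by (simp add: Euclidean_space_eq subtopology_subtopology)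
  next
    case (Suc k)
    then show ?case
      using continuous_on_subset[OF _ sub, of f] assms(2,3)
      by (auto simp: Euclidean_space_eq subtopology_subtopology)
  qed
qed

lemma Ck_on_subset:
  assumes "Ck_on k n S f" "T \<subseteq> S"
  shows "Ck_on k n T f"
  using assms
proof (induction k arbitrary: f)
  case 0
  then show ?case
    using continuous_on_subset[of "ES n \<inter> S" f "ES n \<inter> T"]
    by (auto simp: Euclidean_space_eq subtopology_subtopology)
next
  case (Suc k)
  then show ?case
    using continuous_on_subset[of "ES n \<inter> S" f "ES n \<inter> T"]
    by (auto simp: Euclidean_space_eq subtopology_subtopology)
qed

lemma Ck_on_local:
  assumes "openin (Euclidean_space n) S"
    and "\<And>x. x \<in> S \<Longrightarrow> \<exists>T. openin (Euclidean_space n) T \<and> x \<in> T \<and> T \<subseteq> S \<and> Ck_on k n T f"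
  shows "Ck_on k n S f"
  using assms(2)
proof -
  have cont: "continuous_on S f"
    if *: "\<And>x. x \<in> S \<Longrightarrow> \<exists>T. openin (Euclidean_space n) T \<and> x \<in> T \<and> T \<subseteq> S \<and> continuous_on T f" for f
    unfolding continuous_on_eq_continuous_within
  proof
    fix x assume "x \<in> S"
    then obtain T where T: "openin (Euclidean_space n) T" "x \<in> T" "T \<subseteq> S" "continuous_on T f"
      using * by blast
    then obtain U where U: "open U" "T = ES n \<inter> U"
      by (auto simp: Euclidean_space_eq openin_open)
    have "S \<subseteq> ES n"
      using openin_Euclidean_space_ES[OF assms(1)] by blast
    then have "at x within S = at x within T"
      using U T by (intro at_within_nhd[of x U]) auto
    then show "continuous (at x within S) f"
      using T by (simp add: continuous_on_eq_continuous_within)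
  qed
  show ?thesis
    using assms(2)
  proof (induction k arbitrary: f)
    case 0
    then have "continuous_on S f"
      by (intro cont) (metis Ck_on_imp_continuous_on)
    then show ?case
      using assms(1) by (simp add: continuous_map_Euclidean_space_iff)
  next
    case (Suc k)
    have "continuous_on S f"
      by (intro cont) (metis Ck_on_imp_continuous_on Suc.prems)
    moreover have "(\<lambda>t. f (x(i := t))) differentiable (at (x i))" if "x \<in> S" "i < n" for x i
      using Suc.prems that by force
    moreover have "Ck_on k n S (partial_deriv i f)" if "i < n" for i
      using Suc.prems that by (intro Suc.IH) force
    ultimately show ?case
      using assms(1) by (simp add: continuous_map_Euclidean_space_iff)
  qed
qed

section \<open>Closure properties of functions with continuous partial derivatives\<close>

lemma Ck_on_const:
  assumes "openin (Euclidean_space n) S"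
  shows "Ck_on k n S (\<lambda>x. c)"
proof (induction k arbitrary: c)
  case 0
  then show ?case by simp
next
  case (Suc k)
  show ?case
    by (rule Ck_on_SucI[where g="\<lambda>i x. 0"]) (use assms Suc in auto)
qed

lemma Ck_on_coord:
  assumes "openin (Euclidean_space n) S"
  shows "Ck_on k n S (\<lambda>x. x j)"
proof -
  have cont: "continuous_on S (\<lambda>x. x j :: real)"
    by (rule continuous_on_subset[OF continuous_on_product_coordinates]) auto
  show ?thesis
  proof (cases k)
    case 0
    then show ?thesis using cont assms by (simp add: continuous_map_Euclidean_space_iff)
  next
    case (Suc l)
    have "Ck_on (Suc l) n S (\<lambda>x. x j)"
    proof (rule Ck_on_SucI[where g="\<lambda>i x. if i = j then 1 else 0", OF assms cont])
      show "((\<lambda>t. (x(i := t)) j) has_real_derivative (if i = j then 1 else 0)) (at (x i))" for i x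
        by (auto intro!: derivative_eq_intros)
    qed (rule Ck_on_const[OF assms])
    then show ?thesis using Suc by simp
  qed
qed

lemma Ck_on_add:
  assumes "openin (Euclidean_space n) S" "Ck_on k n S f" "Ck_on k n S g"
  shows "Ck_on k n S (\<lambda>x. f x + g x)"
  using assms(2,3)
proof (induction k arbitrary: f g)
  case 0
  then show ?case
    using assms(1) by (simp add: continuous_map_Euclidean_space_iff continuous_on_add)
next
  case (Suc k)
  show ?case
  proof (rule Ck_on_SucI[where g="\<lambda>i x. partial_deriv i f x + partial_deriv i g x", OF assms(1)])
    show "continuous_on S (\<lambda>x. f x + g x)"
      by (rule continuous_on_add; rule Ck_on_imp_continuous_on[OF _ assms(1)]) (rule Suc.prems)+
    show "Ck_on k n S (\<lambda>x. partial_deriv i f x + partial_deriv i g x)" if "i < n" for i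
      using Suc that by auto
    show "((\<lambda>t. f (x(i := t)) + g (x(i := t))) has_real_derivative
         partial_deriv i f x + partial_deriv i g x) (at (x i))" if "i < n" "x \<in> S" for i x
      by (intro DERIV_add Ck_on_Suc_has_derivative[OF Suc.prems(1) that(2,1)]
          Ck_on_Suc_has_derivative[OF Suc.prems(2) that(2,1)])
  qed
qed

lemma Ck_on_mult:
  assumes "openin (Euclidean_space n) S" "Ck_on k n S f" "Ck_on k n S g"
  shows "Ck_on k n S (\<lambda>x. f x * g x)"
  using assms(2,3)
proof (induction k arbitrary: f g)
  case 0
  then show ?case
    using assms(1) by (simp add: continuous_map_Euclidean_space_iff continuous_on_mult)
next
  case (Suc k)
  show ?case
  proof (rule Ck_on_SucI[where g="\<lambda>i x. partial_deriv i f x * g x + f x * partial_deriv i g x", OF assms(1)])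
    show "continuous_on S (\<lambda>x. f x * g x)"
      by (rule continuous_on_mult; rule Ck_on_imp_continuous_on[OF _ assms(1)]) (rule Suc.prems)+
    show "Ck_on k n S (\<lambda>x. partial_deriv i f x * g x + f x * partial_deriv i g x)" if "i < n" for i
      using Suc.prems that Ck_on_Suc_imp[OF Suc.prems(1)] Ck_on_Suc_imp[OF Suc.prems(2)]
      by (intro Ck_on_add[OF assms(1)] Suc.IH) auto
    show "((\<lambda>t. f (x(i := t)) * g (x(i := t))) has_real_derivative
         partial_deriv i f x * g x + f x * partial_deriv i g x) (at (x i))" if "i < n" "x \<in> S" for i x
      by (rule DERIV_cong[OF DERIV_mult[OF Ck_on_Suc_has_derivative[OF Suc.prems(1) that(2,1)]
          Ck_on_Suc_has_derivative[OF Suc.prems(2) that(2,1)]]]) (simp add: algebra_simps)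
  qed
qed

text \<open>The derivative contains the reciprocal at one order less, so the induction on
  \<open>k\<close> closes on itself.\<close>

lemma Ck_on_inverse:
  assumes "openin (Euclidean_space n) S" "Ck_on k n S f" "\<And>x. x \<in> S \<Longrightarrow> f x \<noteq> 0"
  shows "Ck_on k n S (\<lambda>x. inverse (f x))"
  using assms(2)
proof (induction k)
  case 0
  then show ?case
    using assms(1,3) by (simp add: continuous_map_Euclidean_space_iff continuous_on_inverse)
next
  case (Suc k)
  show ?case
  proof (rule Ck_on_SucI[where g="\<lambda>i x. (-1 * partial_deriv i f x) * (inverse (f x) * inverse (f x))", OF assms(1)])
    show "continuous_on S (\<lambda>x. inverse (f x))"
      by (rule continuous_on_inverse[OF Ck_on_imp_continuous_on[OF Suc.prems assms(1)]]) (use assms(3) in blast)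
    show "Ck_on k n S (\<lambda>x. (-1 * partial_deriv i f x) * (inverse (f x) * inverse (f x)))" if "i < n" for i
    proof -
      have "Ck_on k n S (partial_deriv i f)"
        using Suc.prems that by simp
      moreover have "Ck_on k n S (\<lambda>x. inverse (f x))"
        by (rule Suc.IH[OF Ck_on_Suc_imp[OF Suc.prems]])
      ultimately show ?thesis
        by (intro Ck_on_mult[OF assms(1)] Ck_on_const[OF assms(1)])
    qed
    show "((\<lambda>t. inverse (f (x(i := t)))) has_real_derivative
         (-1 * partial_deriv i f x) * (inverse (f x) * inverse (f x))) (at (x i))" if "i < n" "x \<in> S" for i x
      by (rule DERIV_cong[OF DERIV_inverse'[OF Ck_on_Suc_has_derivative[OF Suc.prems that(2,1)]]])
        (use assms(3)[OF that(2)] in \<open>simp_all add: algebra_simps\<close>)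
  qed
qed

text \<open>The family \<open>flat m\<close> is closed under differentiation up to linear combinations, which makes
  \<open>flat 0\<close> smooth.\<close>

definition flat :: "nat \<Rightarrow> real \<Rightarrow> real" where
  "flat m t = (if t > 0 then exp (- inverse t) * inverse t ^ m else 0)"

lemma flat_has_derivative:
  "(flat m has_real_derivative (- real m * flat (Suc m) t + flat (Suc (Suc m)) t)) (at t)"
proof -
  consider "t > 0" | "t < 0" | "t = 0" by linarith
  then show ?thesis
  proof cases
    case 1
    have ev: "\<forall>\<^sub>F s in nhds t. flat m s = exp (- inverse s) * inverse s ^ m"
      using eventually_nhds_in_open[of "{0<..}" t] 1 by (auto simp: flat_def elim!: eventually_mono)
    have "((\<lambda>s. exp (- inverse s) * inverse s ^ m) has_real_derivative
        (- real m * flat (Suc m) t + flat (Suc (Suc m)) t)) (at t)"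
    proof -
      have "((\<lambda>s. inverse s ^ m) has_real_derivative - real m * inverse t ^ Suc m) (at t)"
        by (rule DERIV_cong[OF DERIV_power[OF DERIV_inverse]])
          (use 1 in \<open>cases m; simp add: algebra_simps\<close>)+
      moreover have "((\<lambda>s. exp (- inverse s)) has_real_derivative exp (- inverse t) * inverse t ^ 2) (at t)"
        using 1 by (auto intro!: derivative_eq_intros simp: power2_eq_square)
      ultimately show ?thesis
        by (rule DERIV_cong[OF DERIV_mult[rotated]])
          (use 1 in \<open>simp add: flat_def algebra_simps power2_eq_square\<close>)
    qed
    then show ?thesis
      using DERIV_cong_ev[OF refl ev refl] by simp
  next
    case 2
    have ev: "\<forall>\<^sub>F s in nhds t. flat m s = 0"
      using eventually_nhds_in_open[of "{..<0}" t] 2 by (auto simp: flat_def elim!: eventually_mono)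
    show ?thesis
      by (rule iffD2[OF DERIV_cong_ev[OF refl ev refl]]) (use 2 in \<open>simp add: flat_def\<close>)
  next
    case 3
    \<comment> \<open>With \<open>u = 1 / h\<close> the right difference quotient at 0 is
      \<open>u ^ Suc m / exp u\<close>, and the exponential outgrows every power.\<close>
    have "((\<lambda>h::real. (exp (- inverse h) * inverse h ^ m) / h) \<longlongrightarrow> 0) (at_right 0)"
    proof (rule Lim_transform_eventually)
      show "((\<lambda>h::real. inverse h ^ Suc m / exp (inverse h)) \<longlongrightarrow> 0) (at_right 0)"
        using filterlim_compose[OF tendsto_power_div_exp_0 filterlim_inverse_at_top_right] .
    qed (simp add: exp_minus divide_inverse mult_ac)
    then have "((\<lambda>h. (flat m (0 + h) - flat m 0) / h) \<longlongrightarrow> 0) (at_right 0)"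
      by (rule Lim_transform_eventually)
        (rule eventually_mono[OF eventually_at_right_less], simp add: flat_def)
    moreover have "((\<lambda>h. (flat m (0 + h) - flat m 0) / h) \<longlongrightarrow> 0) (at_left 0)"
    proof (rule Lim_transform_eventually[OF tendsto_const])
      show "\<forall>\<^sub>F h in at_left 0. 0 = (flat m (0 + h) - flat m 0) / h"
        by (simp add: eventually_at_filter flat_def)
    qed
    ultimately have "((\<lambda>h. (flat m (0 + h) - flat m 0) / h) \<longlongrightarrow> 0) (at 0)"
      by (rule filterlim_split_at[rotated])
    then show ?thesis
      using 3 by (simp add: DERIV_def flat_def)
  qed
qed

lemma Ck_on_flat:
  assumes "openin (Euclidean_space n) S" "Ck_on k n S f"
  shows "Ck_on k n S (\<lambda>x. flat m (f x))"
proof -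
  have cont: "continuous_on S (\<lambda>x. flat m (f x))" if "continuous_on S f" for m
  proof (rule continuous_on_compose2[OF _ that])
    show "continuous_on UNIV (flat m)"
      using flat_has_derivative DERIV_isCont by (intro continuous_at_imp_continuous_on) blast
  qed auto
  show ?thesis
    using assms(2)
  proof (induction k arbitrary: m)
    case 0
    then show ?case
      using assms(1) cont by (simp add: continuous_map_Euclidean_space_iff)
  next
    case (Suc k)
    have f: "Ck_on k n S f" using Suc.prems by (rule Ck_on_Suc_imp)
    show ?case
    proof (rule Ck_on_SucI[where g="\<lambda>i x. (- real m * flat (Suc m) (f x) + flat (Suc (Suc m)) (f x)) * partial_deriv i f x",
            OF assms(1)])
      show "continuous_on S (\<lambda>x. flat m (f x))"
        using Ck_on_imp_continuous_on[OF Suc.prems assms(1)] cont by blast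
      show "Ck_on k n S (\<lambda>x. (- real m * flat (Suc m) (f x) + flat (Suc (Suc m)) (f x)) * partial_deriv i f x)"
        if "i < n" for i
      proof -
        have "Ck_on k n S (partial_deriv i f)"
          using Suc.prems that by simp
        then show ?thesis
          by (intro Ck_on_mult[OF assms(1)] Ck_on_add[OF assms(1)] Ck_on_const[OF assms(1)] Suc.IH[OF f])
      qed
      show "((\<lambda>t. flat m (f (x(i := t)))) has_real_derivative
        (- real m * flat (Suc m) (f x) + flat (Suc (Suc m)) (f x)) * partial_deriv i f x) (at (x i))"
        if "i < n" "x \<in> S" for i x
        by (rule DERIV_cong[OF DERIV_chain2[OF flat_has_derivative
            Ck_on_Suc_has_derivative[OF Suc.prems that(2,1)]]]) simp
    qed
  qed
qed

section \<open>The chain rule\<close>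

lemma MVT_symmetric:
  fixes f :: "real \<Rightarrow> real"
  assumes "a \<noteq> b" "\<And>s. min a b \<le> s \<Longrightarrow> s \<le> max a b \<Longrightarrow> (f has_real_derivative f' s) (at s)"
  obtains z where "min a b < z" "z < max a b" "f b - f a = f' z * (b - a)"
proof (cases "a < b")
  case True
  then show ?thesis using MVT2[of a b f f'] assms that by (auto simp: min_def max_def mult.commute)
next
  case False
  then have "b < a" using assms(1) by simp
  then obtain z where "b < z" "z < a" "f a - f b = (a - b) * f' z"
    using MVT2[of b a f f'] assms by (auto simp: min_def max_def)
  then show ?thesis using \<open>b < a\<close> that[of z] by (auto simp: min_def max_def algebra_simps)
qed

text \<open>Changing one coordinate at a time reduces the chain rule along a curve to the mean value
  theorem in each coordinate.\<close>

lemma has_derivative_along_curve: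
  assumes T: "openin (Euclidean_space m) T"
    and g: "Ck_on (Suc 0) m T g"
    and y: "\<forall>\<^sub>F t in nhds t0. y t \<in> ES m" "y t0 \<in> T"
      "\<And>j. j < m \<Longrightarrow> ((\<lambda>t. y t j) has_real_derivative d j) (at t0)"
  shows "((\<lambda>t. g (y t)) has_real_derivative (\<Sum>j<m. partial_deriv j g (y t0) * d j)) (at t0)"
proof -
  \<comment> \<open>The first \<open>j\<close> coordinates follow the curve, the others stay frozen
    at time \<open>t0\<close>; the claim below unfreezes them one by one.\<close>
  define mix where "mix j t = (\<lambda>i. if i < j then y t i else y t0 i)" for j t
  have y0: "y t0 \<in> ES m" using openin_Euclidean_space_ES[OF T y(2)] .
  have mixES: "mix j t \<in> ES m" if "j \<le> m" for j t
    using that y0 by (auto simp: mix_def)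
  have close: "\<forall>\<^sub>F t in at t0. \<forall>i<m. \<bar>y t i - y t0 i\<bar> < e" if "e > 0" for e
  proof -
    have "\<forall>\<^sub>F t in at t0. \<bar>y t i - y t0 i\<bar> < e" if "i < m" for i
    proof -
      have "((\<lambda>t. y t i) \<longlongrightarrow> y t0 i) (at t0)"
        using y(3)[OF that] DERIV_isCont isCont_def by blast
      then show ?thesis
        using \<open>e > 0\<close> by (auto simp: tendsto_iff dist_real_def)
    qed
    then have "\<forall>\<^sub>F t in at t0. \<forall>i\<in>{..<m}. \<bar>y t i - y t0 i\<bar> < e"
      by (intro eventually_ball_finite) auto
    then show ?thesis by (auto elim!: eventually_mono)
  qed
  have claim: "((\<lambda>t. g (mix j t)) has_real_derivative (\<Sum>i<j. partial_deriv i g (y t0) * d i)) (at t0)"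
    if "j \<le> m" for j
    using that
  proof (induction j)
    case 0
    then show ?case by (simp add: mix_def)
  next
    case (Suc j)
    then have j: "j < m" by simp
    define P where "P = partial_deriv j g (y t0)"
    define D where "D t = g (mix (Suc j) t) - g (mix j t)" for t
    \<comment> \<open>The slope of \<open>g\<close> in direction \<open>j\<close>, to be compared
      with \<open>P\<close> by the mean value theorem. The default \<open>P\<close> covers times at
      which the coordinate has not moved, so that \<open>Dc\<close> holds without dividing by 0 and
      the limit of \<open>c\<close> is still \<open>P\<close>.\<close>
    define c where "c t = (if y t j = y t0 j then P else D t / (y t j - y t0 j))" for t
    have mixj: "mix (Suc j) t = (mix j t)(j := y t j)" "mix j t = (mix j t)(j := y t0 j)" for t
      by (auto simp: mix_def fun_eq_iff less_Suc_eq)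
    have Dc: "D t = c t * (y t j - y t0 j)" for t
      using mixj[of t] by (auto simp: c_def D_def)
    have "(c \<longlongrightarrow> P) (at t0)"
    proof (rule tendstoI)
      fix \<eta> :: real assume "\<eta> > 0"
      have contP: "continuous_on T (partial_deriv j g)"
        using g j T by (auto simp: continuous_map_Euclidean_space_iff)
      have "openin (top_of_set T) (T \<inter> partial_deriv j g -` ball P \<eta>)"
        using continuous_openin_preimage_gen[OF contP open_ball] .
      then have op: "openin (Euclidean_space m) (T \<inter> partial_deriv j g -` ball P \<eta>)"
        using openin_trans T unfolding Euclidean_space_eq by blast
      moreover have "y t0 \<in> T \<inter> partial_deriv j g -` ball P \<eta>"
        using y(2) \<open>\<eta> > 0\<close> by (simp add: P_def)
      ultimately obtain e where e: "e > 0"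
        "\<And>z. z \<in> ES m \<Longrightarrow> (\<forall>i<m. \<bar>z i - y t0 i\<bar> < e) \<Longrightarrow> z \<in> T \<inter> partial_deriv j g -` ball P \<eta>"
        using openin_Euclidean_space_box by blast
      show "\<forall>\<^sub>F t in at t0. dist (c t) P < \<eta>"
        using close[OF e(1)]
      proof eventually_elim
        case (elim t)
        show ?case
        proof (cases "y t j = y t0 j")
          case True
          then show ?thesis using \<open>\<eta> > 0\<close> by (simp add: c_def)
        next
          case False
          have inT: "(mix j t)(j := s) \<in> T \<inter> partial_deriv j g -` ball P \<eta>"
            if "min (y t0 j) (y t j) \<le> s" "s \<le> max (y t0 j) (y t j)" for s
          proof (rule e(2))
            show "(mix j t)(j := s) \<in> ES m" using mixES[of j t] j by auto
            show "\<forall>i<m. \<bar>((mix j t)(j := s)) i - y t0 i\<bar> < e"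
            proof (intro allI impI)
              fix i assume i: "i < m"
              have "\<bar>s - y t0 j\<bar> \<le> \<bar>y t j - y t0 j\<bar>" using that by linarith
              then show "\<bar>((mix j t)(j := s)) i - y t0 i\<bar> < e"
                using elim i j e(1) by (auto simp: mix_def intro: le_less_trans)
            qed
          qed
          have der: "((\<lambda>s. g ((mix j t)(j := s))) has_real_derivative partial_deriv j g ((mix j t)(j := s))) (at s)"
            if "min (y t0 j) (y t j) \<le> s" "s \<le> max (y t0 j) (y t j)" for s
            using Ck_on_Suc_has_derivative[OF g, of "(mix j t)(j := s)" j] inT[OF that] j by simp
          obtain z where z: "min (y t0 j) (y t j) < z" "z < max (y t0 j) (y t j)"
            "g ((mix j t)(j := y t j)) - g ((mix j t)(j := y t0 j)) =
              partial_deriv j g ((mix j t)(j := z)) * (y t j - y t0 j)"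
            using MVT_symmetric[OF False[symmetric], of "\<lambda>s. g ((mix j t)(j := s))", OF der] by blast
          then have "c t = partial_deriv j g ((mix j t)(j := z))"
            using False mixj[of t] by (simp add: c_def D_def)
          then show ?thesis
            using inT[of z] z(1,2) by (simp add: dist_commute)
        qed
      qed
    qed
    moreover have "((\<lambda>t. (y t j - y t0 j) / (t - t0)) \<longlongrightarrow> d j) (at t0)"
      using y(3)[OF j] by (simp add: has_field_derivative_iff)
    ultimately have "((\<lambda>t. c t * ((y t j - y t0 j) / (t - t0))) \<longlongrightarrow> P * d j) (at t0)"
      by (rule tendsto_mult)
    then have "(D has_real_derivative P * d j) (at t0)"
      using Dc[of t0] by (simp add: has_field_derivative_iff Dc)
    then have "((\<lambda>t. g (mix j t) + D t) has_real_derivative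
        (\<Sum>i<j. partial_deriv i g (y t0) * d i) + P * d j) (at t0)"
      using Suc by (intro DERIV_add) auto
    then show ?case
      by (simp add: D_def P_def)
  qed
  have "\<forall>\<^sub>F t in nhds t0. g (mix m t) = g (y t)"
    using y(1)
  proof eventually_elim
    case (elim t)
    then have "mix m t = y t" using y0 by (auto simp: mix_def fun_eq_iff)
    then show ?case by simp
  qed
  from DERIV_cong_ev[OF refl this refl] claim[of m] show ?thesis by simp
qed

lemma Ck_on_sum:
  assumes "openin (Euclidean_space n) S" "\<And>i. i \<in> I \<Longrightarrow> Ck_on k n S (f i)"
  shows "Ck_on k n S (\<lambda>x. \<Sum>i\<in>I. f i x)"
  using assms(2)
proof (induction I rule: infinite_finite_induct)
  case (insert i I)
  then show ?case
    using Ck_on_add[OF assms(1), of k "f i" "\<lambda>x. \<Sum>i\<in>I. f i x"] by simp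
qed (simp_all add: Ck_on_const[OF assms(1)])

lemma continuous_on_into_ES:
  assumes "\<And>x. x \<in> S \<Longrightarrow> F x \<in> ES m" "\<And>j. j < m \<Longrightarrow> continuous_on S (\<lambda>x. F x j)"
  shows "continuous_on S (F :: _ \<Rightarrow> nat \<Rightarrow> real)"
proof (rule continuous_on_coordinatewise_then_product)
  fix j
  show "continuous_on S (\<lambda>x. F x j)"
  proof (cases "j < m")
    case False
    then have "F x j = 0" if "x \<in> S" for x using assms(1)[OF that] by auto
    then show ?thesis by (simp cong: continuous_on_cong)
  qed (use assms(2) in auto)
qed

text \<open>The induction varies \<open>g\<close> only: the chain rule produces
  \<open>partial_deriv j g\<close> composed with the same \<open>F\<close>, of which one order less
  is then required.\<close>

lemma Ck_on_compose:
  assumes S: "openin (Euclidean_space n) S" and T: "openin (Euclidean_space m) T"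
    and F: "\<And>x. x \<in> S \<Longrightarrow> F x \<in> T" "\<And>j. j < m \<Longrightarrow> Ck_on k n S (\<lambda>x. F x j)"
    and g: "Ck_on k m T g"
  shows "Ck_on k n S (\<lambda>x. g (F x))"
  using F(2) g
proof (induction k arbitrary: g)
  have FES: "F x \<in> ES m" if "x \<in> S" for x
    using openin_Euclidean_space_ES[OF T F(1)[OF that]] .
  have cont: "continuous_on S (\<lambda>x. g (F x))"
    if "\<And>j. j < m \<Longrightarrow> continuous_on S (\<lambda>x. F x j)" "continuous_on T g" for g
    using continuous_on_into_ES[OF FES that(1)] F(1)
    by (intro continuous_on_compose2[OF that(2)]) auto
  {
    case 0
    then have "continuous_on S (\<lambda>x. g (F x))"
      by (rule cont[OF Ck_on_imp_continuous_on[OF _ S] Ck_on_imp_continuous_on[OF _ T]]) blast+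
    then show ?case
      using S by (simp add: continuous_map_Euclidean_space_iff)
  next
    case (Suc k)
    have F': "Ck_on k n S (\<lambda>x. F x j)" if "j < m" for j
      using Suc.prems(1)[OF that] by (rule Ck_on_Suc_imp)
    show ?case
    proof (rule Ck_on_SucI[where g="\<lambda>i x. \<Sum>j<m. partial_deriv j g (F x) * partial_deriv i (\<lambda>x. F x j) x", OF S])
      show "continuous_on S (\<lambda>x. g (F x))"
        by (rule cont[OF Ck_on_imp_continuous_on[OF Suc.prems(1) S] Ck_on_imp_continuous_on[OF Suc.prems(2) T]])
      show "Ck_on k n S (\<lambda>x. \<Sum>j<m. partial_deriv j g (F x) * partial_deriv i (\<lambda>x. F x j) x)" if "i < n" for i
      proof (rule Ck_on_sum[OF S], rule Ck_on_mult[OF S])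
        fix j assume "j \<in> {..<m}"
        then show "Ck_on k n S (\<lambda>x. partial_deriv j g (F x))"
          using Suc.prems(2) by (intro Suc.IH[OF F']) auto
        show "Ck_on k n S (partial_deriv i (\<lambda>x. F x j))"
          using Suc.prems(1)[of j] that \<open>j \<in> {..<m}\<close> by simp
      qed
      show "((\<lambda>t. g (F (x(i := t)))) has_real_derivative
          (\<Sum>j<m. partial_deriv j g (F x) * partial_deriv i (\<lambda>x. F x j) x)) (at (x i))"
        if "i < n" "x \<in> S" for i x
      proof -
        have g1: "Ck_on (Suc 0) m T g"
        proof -
          have "Ck_on 0 m T (partial_deriv j g)" if "j < m" for j
            using Suc.prems(2) that T Ck_on_imp_continuous_on[of k m T "partial_deriv j g"]
            by (auto simp: continuous_map_Euclidean_space_iff)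
          then show ?thesis using Suc.prems(2) by auto
        qed
        have ev: "\<forall>\<^sub>F t in nhds (x i). F (x(i := t)) \<in> ES m"
          using eventually_line_in_open[OF S that(2,1)] by eventually_elim (rule FES)
        have der: "((\<lambda>t. F (x(i := t)) j) has_real_derivative partial_deriv i (\<lambda>x. F x j) x) (at (x i))"
          if "j < m" for j
          using Ck_on_Suc_has_derivative[OF Suc.prems(1)[OF that] \<open>x \<in> S\<close> \<open>i < n\<close>] .
        have "F (x(i := x i)) \<in> T" using F(1)[OF that(2)] by simp
        from has_derivative_along_curve[OF T g1, of "\<lambda>t. F (x(i := t))" "x i", OF ev this der]
        show ?thesis by simp
      qed
    qed
  }
qed

lemma smooth_on_cong:
  assumes "smooth_on n S f" "openin (Euclidean_space n) S" "\<And>x. x \<in> S \<Longrightarrow> f x = g x"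
  shows "smooth_on n S g"
  using assms Ck_on_cong unfolding smooth_on_def by blast

lemma smooth_on_subset: "smooth_on n S f \<Longrightarrow> T \<subseteq> S \<Longrightarrow> smooth_on n T f"
  using Ck_on_subset unfolding smooth_on_def by blast

lemma smooth_on_restrict: "smooth_on n S f \<Longrightarrow> m \<le> n \<Longrightarrow> T \<subseteq> S \<Longrightarrow> smooth_on m (T \<inter> ES m) f"
  using Ck_on_restrict unfolding smooth_on_def by blast

lemma smooth_on_local:
  assumes "openin (Euclidean_space n) S"
    and "\<And>x. x \<in> S \<Longrightarrow> \<exists>T. openin (Euclidean_space n) T \<and> x \<in> T \<and> T \<subseteq> S \<and> smooth_on n T f"
  shows "smooth_on n S f"
  unfolding smooth_on_def
proof
  show "Ck_on k n S f" for k
    using assms(2) unfolding smooth_on_def by (intro Ck_on_local[OF assms(1)]) blast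
qed

lemma smooth_on_compose:
  assumes "openin (Euclidean_space n) S" "openin (Euclidean_space m) T"
    and "\<And>x. x \<in> S \<Longrightarrow> F x \<in> T" "\<And>j. j < m \<Longrightarrow> smooth_on n S (\<lambda>x. F x j)" "smooth_on m T g"
  shows "smooth_on n S (\<lambda>x. g (F x))"
  using assms Ck_on_compose[OF assms(1,2), of F] unfolding smooth_on_def by blast

lemma smooth_on_imp_continuous_on:
  "smooth_on n S f \<Longrightarrow> openin (Euclidean_space n) S \<Longrightarrow> continuous_on S f"
  unfolding smooth_on_def using Ck_on_imp_continuous_on by blast

section \<open>Smooth functions on manifolds\<close>

lemma maximal_atlasD:
  assumes "(U, \<phi>) \<in> maximal_atlas M"
  shows "U \<subseteq> points M" "is_chart (dimn M) (U, \<phi>)" "inj_on \<phi> U" "openin (Euclidean_space (dimn M)) (\<phi> ` U)"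
    "d \<in> charts M \<Longrightarrow> smooth_transition (dimn M) (U, \<phi>) d"
    "d \<in> charts M \<Longrightarrow> smooth_transition (dimn M) d (U, \<phi>)"
  using assms by (auto simp: maximal_atlas_def is_chart_def)

lemma charts_subset_maximal_atlas: "is_atlas M \<Longrightarrow> charts M \<subseteq> maximal_atlas M"
  by (auto simp: is_atlas_def maximal_atlas_def split_beta)

lemma is_atlas_obtain_chart:
  assumes "is_atlas M" "p \<in> points M"
  obtains U \<phi> where "(U, \<phi>) \<in> charts M" "(U, \<phi>) \<in> maximal_atlas M" "p \<in> U"
proof -
  have "p \<in> \<Union>(fst ` charts M)" using assms by (auto simp: is_atlas_def)
  then show ?thesis using that charts_subset_maximal_atlas[OF assms(1)] by auto
qed

lemma smooth_transitionD:
  assumes "smooth_transition n (U, \<phi>) (V, \<psi>)"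
  shows "openin (Euclidean_space n) (\<phi> ` (U \<inter> V))"
    "i < n \<Longrightarrow> smooth_on n (\<phi> ` (U \<inter> V)) (\<lambda>x. \<psi> (inv_into U \<phi> x) i)"
  using assms by (auto simp: smooth_transition_def)

lemma transition_continuous_on:
  assumes "smooth_transition n (U, \<phi>) (V, \<psi>)" "is_chart n (U, \<phi>)" "is_chart n (V, \<psi>)"
  shows "continuous_on (\<phi> ` (U \<inter> V)) (\<lambda>y. \<psi> (inv_into U \<phi> y))"
proof (rule continuous_on_into_ES)
  show "\<psi> (inv_into U \<phi> y) \<in> ES n" if "y \<in> \<phi> ` (U \<inter> V)" for y
  proof -
    from that obtain x where "x \<in> U" "x \<in> V" "y = \<phi> x" by blast
    then have "\<psi> (inv_into U \<phi> y) \<in> \<psi> ` V"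
      using assms(2) by (simp add: is_chart_def)
    then show ?thesis
      using openin_Euclidean_space_ES[of n "\<psi> ` V"] assms(3) by (auto simp: is_chart_def)
  qed
  show "continuous_on (\<phi> ` (U \<inter> V)) (\<lambda>y. \<psi> (inv_into U \<phi> y) j)" if "j < n" for j
    using smooth_on_imp_continuous_on[OF smooth_transitionD(2)[OF assms(1) that] smooth_transitionD(1)[OF assms(1)]] .
qed

lemma openin_transition_preimage:
  assumes "smooth_transition n (U, \<phi>) (V, \<psi>)" "is_chart n (U, \<phi>)" "is_chart n (V, \<psi>)"
    and "openin (Euclidean_space n) G"
  shows "openin (Euclidean_space n) (\<phi> ` {x \<in> U \<inter> V. \<psi> x \<in> G})"
proof -
  obtain G' where G': "open G'" "G = ES n \<inter> G'"
    using assms(4) by (auto simp: Euclidean_space_eq openin_open)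
  let ?F = "\<lambda>y. \<psi> (inv_into U \<phi> y)"
  have inj: "inj_on \<phi> U" using assms(2) by (simp add: is_chart_def)
  have V: "\<psi> x \<in> ES n" if "x \<in> V" for x
    using openin_Euclidean_space_ES[of n "\<psi> ` V"] assms(3) that by (auto simp: is_chart_def)
  have "openin (top_of_set (\<phi> ` (U \<inter> V))) (\<phi> ` (U \<inter> V) \<inter> ?F -` G')"
    using continuous_openin_preimage_gen[OF transition_continuous_on[OF assms(1-3)] G'(1)] .
  moreover have "\<phi> ` {x \<in> U \<inter> V. \<psi> x \<in> G} = \<phi> ` (U \<inter> V) \<inter> ?F -` G'"
    using V G'(2) inj by (auto simp: inv_into_f_f)
  ultimately show ?thesis
    using openin_trans[OF _ smooth_transitionD(1)[OF assms(1), unfolded Euclidean_space_eq]]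
    by (simp add: Euclidean_space_eq)
qed

text \<open>Together with the image version that follows, this makes every chart of the maximal
  atlas a homeomorphism, although \<open>mtopology\<close> tests the given charts only.\<close>

lemma openin_chart_vimage:
  assumes "is_atlas M" "(U, \<phi>) \<in> maximal_atlas M" "openin (Euclidean_space (dimn M)) G"
  shows "openin (mtopology M) {x \<in> U. \<phi> x \<in> G}"
proof -
  note c = maximal_atlasD[OF assms(2)]
  have "openin (Euclidean_space (dimn M)) (\<psi> ` (V \<inter> {x \<in> U. \<phi> x \<in> G}))" if "(V, \<psi>) \<in> charts M" for V \<psi>
  proof -
    have "(V, \<psi>) \<in> maximal_atlas M" using charts_subset_maximal_atlas[OF assms(1)] that by blast
    from openin_transition_preimage[OF c(6)[OF that] maximal_atlasD(2)[OF this] c(2) assms(3)]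
    moreover have "V \<inter> {x \<in> U. \<phi> x \<in> G} = {x \<in> V \<inter> U. \<phi> x \<in> G}" by blast
    ultimately show ?thesis by simp
  qed
  then show ?thesis
    using c(1) by (auto simp: openin_mtopology[OF assms(1)])
qed

lemma openin_chart_image:
  assumes "is_atlas M" "(U, \<phi>) \<in> maximal_atlas M" "openin (mtopology M) W"
  shows "openin (Euclidean_space (dimn M)) (\<phi> ` (U \<inter> W))"
proof -
  note c = maximal_atlasD[OF assms(2)]
  have "openin (Euclidean_space (dimn M)) (\<phi> ` (U \<inter> V \<inter> W))" if "(V, \<psi>) \<in> charts M" for V \<psi>
  proof -
    have V: "(V, \<psi>) \<in> maximal_atlas M" using charts_subset_maximal_atlas[OF assms(1)] that by blast
    have "openin (Euclidean_space (dimn M)) (\<psi> ` (V \<inter> W))"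
      using assms(3) that by (auto simp: openin_mtopology[OF assms(1)])
    from openin_transition_preimage[OF c(5)[OF that] c(2) maximal_atlasD(2)[OF V] this]
    have "openin (Euclidean_space (dimn M)) (\<phi> ` {x \<in> U \<inter> V. \<psi> x \<in> \<psi> ` (V \<inter> W)})" .
    moreover have "{x \<in> U \<inter> V. \<psi> x \<in> \<psi> ` (V \<inter> W)} = U \<inter> V \<inter> W"
      using maximal_atlasD(3)[OF V] by (auto simp: inj_on_def)
    ultimately show ?thesis by simp
  qed
  then have "openin (Euclidean_space (dimn M)) (\<Union>c\<in>charts M. \<phi> ` (U \<inter> fst c \<inter> W))"
    by (intro openin_Union) auto
  moreover have "(\<Union>c\<in>charts M. \<phi> ` (U \<inter> fst c \<inter> W)) = \<phi> ` (U \<inter> W)"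
    using c(1) assms(1) unfolding is_atlas_def by blast
  ultimately show ?thesis by simp
qed

lemma openin_maximal_chart:
  assumes "is_atlas M" "(U, \<phi>) \<in> maximal_atlas M"
  shows "openin (mtopology M) U"
proof -
  have "{x \<in> U. \<phi> x \<in> \<phi> ` U} = U" by auto
  then show ?thesis
    using openin_chart_vimage[OF assms maximal_atlasD(4)[OF assms(2)]] by simp
qed

lemma topspace_mtopology:
  assumes "is_atlas M"
  shows "topspace (mtopology M) = points M"
proof -
  have "openin (mtopology M) (\<Union>c\<in>charts M. fst c)"
  proof (rule openin_Union, clarsimp)
    fix U \<phi> assume "(U, \<phi>) \<in> charts M"
    then show "openin (mtopology M) U"
      using openin_maximal_chart[OF assms] charts_subset_maximal_atlas[OF assms] by blast
  qed
  then have "openin (mtopology M) (points M)"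
    using assms by (simp add: is_atlas_def)
  moreover have "topspace (mtopology M) \<subseteq> points M"
    using openin_topspace[of "mtopology M"] unfolding openin_mtopology[OF assms] by blast
  ultimately show ?thesis
    by (meson openin_subset subset_antisym)
qed

lemma smooth_on_change_chart:
  assumes t: "smooth_transition n (U, \<phi>) (V, \<psi>)" and U: "is_chart n (U, \<phi>)" and V: "is_chart n (V, \<psi>)"
    and X: "X \<subseteq> U \<inter> V" "openin (Euclidean_space n) (\<phi> ` X)" "openin (Euclidean_space n) (\<psi> ` X)"
    and f: "smooth_on n (\<psi> ` X) (f \<circ> inv_into V \<psi>)"
  shows "smooth_on n (\<phi> ` X) (f \<circ> inv_into U \<phi>)"
proof -
  let ?F = "\<lambda>y. \<psi> (inv_into U \<phi> y)"
  have inj: "inj_on \<phi> U" "inj_on \<psi> V" using U V by (auto simp: is_chart_def)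
  have inv: "inv_into U \<phi> (\<phi> x) = x" "inv_into V \<psi> (\<psi> x) = x" if "x \<in> X" for x
    using that X(1) inj by (auto intro: inv_into_f_f)
  have "smooth_on n (\<phi> ` X) (\<lambda>y. (f \<circ> inv_into V \<psi>) (?F y))"
  proof (rule smooth_on_compose[OF X(2,3) _ _ f])
    show "?F y \<in> \<psi> ` X" if "y \<in> \<phi> ` X" for y
      using that inv by auto
    show "smooth_on n (\<phi> ` X) (\<lambda>x. \<psi> (inv_into U \<phi> x) j)" if "j < n" for j
      using smooth_on_subset[OF smooth_transitionD(2)[OF t that]] X(1) by blast
  qed
  then show ?thesis
    by (rule smooth_on_cong[OF _ X(2)]) (use inv in auto)
qed

text \<open>Smoothness is defined through the given charts. Inside one chart domain a single member
  of the maximal atlas decides, which is needed for slice charts, since these are taken from the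
  maximal atlas.\<close>

lemma smooth_fun_on_iff_chart:
  assumes M: "is_atlas M" and c: "(U, \<phi>) \<in> maximal_atlas M" and W: "W \<subseteq> U" "openin (mtopology M) W"
  shows "smooth_fun_on M W f \<longleftrightarrow> smooth_on (dimn M) (\<phi> ` W) (f \<circ> inv_into U \<phi>)"
proof
  note cD = maximal_atlasD[OF c]
  have op: "openin (Euclidean_space (dimn M)) (\<phi> ` W)"
    using openin_chart_image[OF M c W(2)] W(1) by (simp add: inf_absorb2)
  {
    assume f: "smooth_fun_on M W f"
    show "smooth_on (dimn M) (\<phi> ` W) (f \<circ> inv_into U \<phi>)"
    proof (rule smooth_on_local[OF op], clarify)
      fix x assume x: "x \<in> W"
      then obtain V \<psi> where V: "(V, \<psi>) \<in> charts M" "(V, \<psi>) \<in> maximal_atlas M" "x \<in> V"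
        using is_atlas_obtain_chart[OF M, of x] W cD(1) by blast
      have WV: "openin (mtopology M) (W \<inter> V)"
        using W(2) openin_maximal_chart[OF M V(2)] by blast
      have op1: "openin (Euclidean_space (dimn M)) (\<phi> ` (W \<inter> V))"
        using openin_chart_image[OF M c WV] W(1) by (metis Int_absorb1 inf.coboundedI1)
      have op2: "openin (Euclidean_space (dimn M)) (\<psi> ` (W \<inter> V))"
        using openin_chart_image[OF M V(2) WV] by (metis inf.absorb2 inf_le2)
      have "smooth_on (dimn M) (\<psi> ` (V \<inter> W)) (f \<circ> inv_into V \<psi>)"
        using f V(1) by (auto simp: smooth_fun_on_def)
      then have "smooth_on (dimn M) (\<phi> ` (W \<inter> V)) (f \<circ> inv_into U \<phi>)"
        using W(1) by (intro smooth_on_change_chart[OF cD(5)[OF V(1)] cD(2) maximal_atlasD(2)[OF V(2)] _ op1 op2])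
          (auto simp: Int_commute)
      then show "\<exists>T. openin (Euclidean_space (dimn M)) T \<and> \<phi> x \<in> T \<and> T \<subseteq> \<phi> ` W \<and> smooth_on (dimn M) T (f \<circ> inv_into U \<phi>)"
        using op1 x V(3) by blast
    qed
  next
    assume f: "smooth_on (dimn M) (\<phi> ` W) (f \<circ> inv_into U \<phi>)"
    show "smooth_fun_on M W f"
      unfolding smooth_fun_on_def
    proof clarify
      fix V \<psi> assume V: "(V, \<psi>) \<in> charts M"
      then have V': "(V, \<psi>) \<in> maximal_atlas M" using charts_subset_maximal_atlas[OF M] by blast
      have WV: "openin (mtopology M) (V \<inter> W)"
        using W(2) openin_maximal_chart[OF M V'] by blast
      have op1: "openin (Euclidean_space (dimn M)) (\<phi> ` (V \<inter> W))"
        using openin_chart_image[OF M c WV] W(1) by (metis Int_absorb1 inf.coboundedI2)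
      have op2: "openin (Euclidean_space (dimn M)) (\<psi> ` (V \<inter> W))"
        using openin_chart_image[OF M V' WV] by (metis inf.absorb2 inf_le1)
      show "smooth_on (dimn M) (\<psi> ` (V \<inter> W)) (f \<circ> inv_into V \<psi>)"
        by (rule smooth_on_change_chart[OF cD(6)[OF V] maximal_atlasD(2)[OF V'] cD(2) _ op2 op1])
          (use W(1) in blast, rule smooth_on_subset[OF f], blast)
    qed
  }
qed

text \<open>Smoothness of a germ. Closure and gluing stated at single points, with
  \<open>eventually\<close> in the neighbourhood filter, avoid carrying common domains
  around.\<close>

definition smooth_at :: "'m manifold \<Rightarrow> 'm \<Rightarrow> ('m \<Rightarrow> real) \<Rightarrow> bool" where
  "smooth_at M p f \<longleftrightarrow> (\<exists>W. openin (mtopology M) W \<and> p \<in> W \<and> smooth_fun_on M W f)"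

abbreviation nbhds :: "'m manifold \<Rightarrow> 'm \<Rightarrow> 'm filter" where
  "nbhds M p \<equiv> nhdsin (mtopology M) p"

lemma eventually_nbhds:
  assumes "is_atlas M" "p \<in> points M"
  shows "eventually P (nbhds M p) \<longleftrightarrow> (\<exists>W. openin (mtopology M) W \<and> p \<in> W \<and> (\<forall>x\<in>W. P x))"
  using assms by (auto simp: eventually_nhdsin topspace_mtopology)

lemma eventually_nbhds_open:
  "openin (mtopology M) W \<Longrightarrow> p \<in> W \<Longrightarrow> eventually (\<lambda>x. x \<in> W) (nbhds M p)"
  by (auto simp: eventually_nhdsin)

lemma eventually_nbhds_points:
  assumes "is_atlas M"
  shows "eventually (\<lambda>x. x \<in> points M) (nbhds M p)"
  using eventually_nhdsin[of "\<lambda>x. x \<in> points M" "mtopology M" p] openin_topspace[of "mtopology M"]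
  by (auto simp: topspace_mtopology[OF assms])

lemma eventually_nbhds_self:
  "is_atlas M \<Longrightarrow> p \<in> points M \<Longrightarrow> eventually P (nbhds M p) \<Longrightarrow> P p"
  by (auto simp: eventually_nbhds)

lemma smooth_fun_on_subset:
  assumes "smooth_fun_on M W f" "W' \<subseteq> W"
  shows "smooth_fun_on M W' f"
  unfolding smooth_fun_on_def
proof clarify
  fix U \<phi> assume "(U, \<phi>) \<in> charts M"
  then have "smooth_on (dimn M) (\<phi> ` (U \<inter> W)) (f \<circ> inv_into U \<phi>)"
    using assms(1) by (auto simp: smooth_fun_on_def)
  then show "smooth_on (dimn M) (\<phi> ` (U \<inter> W')) (f \<circ> inv_into U \<phi>)"
    by (rule smooth_on_subset) (use assms(2) in blast)
qed

lemma smooth_at_iff_chart: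
  assumes "is_atlas M" "(U, \<phi>) \<in> maximal_atlas M" "p \<in> U"
  shows "smooth_at M p f \<longleftrightarrow>
    (\<exists>T. openin (Euclidean_space (dimn M)) T \<and> \<phi> p \<in> T \<and> T \<subseteq> \<phi> ` U \<and> smooth_on (dimn M) T (f \<circ> inv_into U \<phi>))"
proof
  assume "smooth_at M p f"
  then obtain W where W: "openin (mtopology M) W" "p \<in> W" "smooth_fun_on M W f"
    by (auto simp: smooth_at_def)
  have op: "openin (mtopology M) (U \<inter> W)"
    using W(1) openin_maximal_chart[OF assms(1,2)] by blast
  have "smooth_on (dimn M) (\<phi> ` (U \<inter> W)) (f \<circ> inv_into U \<phi>)"
    using smooth_fun_on_iff_chart[OF assms(1,2) _ op] smooth_fun_on_subset[OF W(3)] by blast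
  then show "\<exists>T. openin (Euclidean_space (dimn M)) T \<and> \<phi> p \<in> T \<and> T \<subseteq> \<phi> ` U \<and> smooth_on (dimn M) T (f \<circ> inv_into U \<phi>)"
    using openin_chart_image[OF assms(1,2) W(1)] assms(3) W(2) by blast
next
  assume "\<exists>T. openin (Euclidean_space (dimn M)) T \<and> \<phi> p \<in> T \<and> T \<subseteq> \<phi> ` U \<and> smooth_on (dimn M) T (f \<circ> inv_into U \<phi>)"
  then obtain T where T: "openin (Euclidean_space (dimn M)) T" "\<phi> p \<in> T" "T \<subseteq> \<phi> ` U"
    "smooth_on (dimn M) T (f \<circ> inv_into U \<phi>)" by blast
  have op: "openin (mtopology M) {x \<in> U. \<phi> x \<in> T}"
    using openin_chart_vimage[OF assms(1,2) T(1)] .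
  have "\<phi> ` {x \<in> U. \<phi> x \<in> T} = T" using T(3) by blast
  then have "smooth_fun_on M {x \<in> U. \<phi> x \<in> T} f"
    using smooth_fun_on_iff_chart[OF assms(1,2) _ op] T(4) by auto
  then show "smooth_at M p f"
    unfolding smooth_at_def using op assms(3) T(2) by blast
qed

lemma smooth_fun_on_iff_smooth_at:
  assumes M: "is_atlas M" and W: "openin (mtopology M) W"
  shows "smooth_fun_on M W f \<longleftrightarrow> (\<forall>p\<in>W. smooth_at M p f)"
proof
  assume "smooth_fun_on M W f"
  then show "\<forall>p\<in>W. smooth_at M p f" using W by (auto simp: smooth_at_def)
next
  assume *: "\<forall>p\<in>W. smooth_at M p f"
  show "smooth_fun_on M W f"
    unfolding smooth_fun_on_def
  proof clarify
    fix U \<phi> assume "(U, \<phi>) \<in> charts M"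
    then have c: "(U, \<phi>) \<in> maximal_atlas M" using charts_subset_maximal_atlas[OF M] by blast
    note op = openin_chart_image[OF M c W]
    show "smooth_on (dimn M) (\<phi> ` (U \<inter> W)) (f \<circ> inv_into U \<phi>)"
    proof (rule smooth_on_local[OF op], clarify)
      fix x assume x: "x \<in> U" "x \<in> W"
      then obtain T where T: "openin (Euclidean_space (dimn M)) T" "\<phi> x \<in> T" "T \<subseteq> \<phi> ` U"
        "smooth_on (dimn M) T (f \<circ> inv_into U \<phi>)"
        using * smooth_at_iff_chart[OF M c x(1)] by blast
      have "openin (Euclidean_space (dimn M)) (T \<inter> \<phi> ` (U \<inter> W))"
        using T(1) op by blast
      moreover have "smooth_on (dimn M) (T \<inter> \<phi> ` (U \<inter> W)) (f \<circ> inv_into U \<phi>)"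
        using smooth_on_subset[OF T(4)] by blast
      ultimately show "\<exists>T. openin (Euclidean_space (dimn M)) T \<and> \<phi> x \<in> T \<and> T \<subseteq> \<phi> ` (U \<inter> W) \<and>
          smooth_on (dimn M) T (f \<circ> inv_into U \<phi>)"
        using x T(2) by (intro exI[of _ "T \<inter> \<phi> ` (U \<inter> W)"]) auto
    qed
  qed
qed

lemma smooth_fun_iff_smooth_at:
  "is_atlas M \<Longrightarrow> smooth_fun M f \<longleftrightarrow> (\<forall>p\<in>points M. smooth_at M p f)"
  using smooth_fun_on_iff_smooth_at[of M "points M" f] openin_topspace[of "mtopology M"]
  by (simp add: topspace_mtopology)

lemma smooth_at_point: "is_atlas M \<Longrightarrow> smooth_at M p f \<Longrightarrow> p \<in> points M"
  unfolding smooth_at_def by (metis openin_subset subsetD topspace_mtopology)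

lemma smooth_at_eventually:
  assumes "smooth_at M p f" "is_atlas M"
  shows "eventually (\<lambda>x. smooth_at M x f) (nbhds M p)"
  using assms by (auto simp: smooth_at_def eventually_nhdsin)

text \<open>All closure properties of smooth germs are transferred from \<open>Ck_on\<close> through one chart.\<close>

lemma smooth_at_transfer:
  assumes M: "is_atlas M" and fs: "\<And>i. i \<in> I \<Longrightarrow> smooth_at M p (f i)" and I: "finite I" and p: "p \<in> points M"
    and step: "\<And>T U \<phi>. openin (Euclidean_space (dimn M)) T \<Longrightarrow>
        (\<And>i. i \<in> I \<Longrightarrow> smooth_on (dimn M) T (f i \<circ> inv_into U \<phi>)) \<Longrightarrow> smooth_on (dimn M) T (g \<circ> inv_into U \<phi>)"
  shows "smooth_at M p g"
proof -
  obtain U \<phi> where c: "(U, \<phi>) \<in> maximal_atlas M" "p \<in> U"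
    using is_atlas_obtain_chart[OF M p] by metis
  have "\<exists>T. openin (Euclidean_space (dimn M)) T \<and> \<phi> p \<in> T \<and> T \<subseteq> \<phi> ` U \<and> smooth_on (dimn M) T (f i \<circ> inv_into U \<phi>)"
    if "i \<in> I" for i
    using fs[OF that] smooth_at_iff_chart[OF M c] by blast
  then obtain T where T: "\<And>i. i \<in> I \<Longrightarrow> openin (Euclidean_space (dimn M)) (T i) \<and> \<phi> p \<in> T i \<and> T i \<subseteq> \<phi> ` U \<and>
      smooth_on (dimn M) (T i) (f i \<circ> inv_into U \<phi>)"
    by metis
  \<comment> \<open>The chart image is included so that the empty family, which serves for
    constants, also yields an open set inside the chart.\<close>
  define T' where "T' = \<phi> ` U \<inter> (\<Inter>i\<in>I. T i)"
  have op: "openin (Euclidean_space (dimn M)) T'"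
  proof (cases "I = {}")
    case True
    then show ?thesis using maximal_atlasD(4)[OF c(1)] by (simp add: T'_def)
  next
    case False
    then have "openin (Euclidean_space (dimn M)) (\<Inter>i\<in>I. T i)"
      using T I by (intro openin_Inter) auto
    then show ?thesis using maximal_atlasD(4)[OF c(1)] by (auto simp: T'_def)
  qed
  have "smooth_on (dimn M) T' (g \<circ> inv_into U \<phi>)"
  proof (rule step[OF op])
    show "smooth_on (dimn M) T' (f i \<circ> inv_into U \<phi>)" if "i \<in> I" for i
      using smooth_on_subset[of _ "T i" _ T'] T[OF that] that by (auto simp: T'_def)
  qed
  then show ?thesis
    unfolding smooth_at_iff_chart[OF M c] using op T c(2)
    by (intro exI[of _ T']) (auto simp: T'_def)
qed

lemma smooth_at_const:
  assumes "is_atlas M" "p \<in> points M"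
  shows "smooth_at M p (\<lambda>x. c)"
  by (rule smooth_at_transfer[OF assms(1) _ _ assms(2), where I="{}"])
    (auto simp: smooth_on_def o_def Ck_on_const)

lemma smooth_at_add:
  assumes "is_atlas M" "smooth_at M p f" "smooth_at M p g"
  shows "smooth_at M p (\<lambda>x. f x + g x)"
proof (rule smooth_at_transfer[OF assms(1) _ _ smooth_at_point[OF assms(1,2)], where I="{f, g}" and f="\<lambda>x. x"])
  fix T U \<phi> assume T: "openin (Euclidean_space (dimn M)) T"
    and *: "\<And>i. i \<in> {f, g} \<Longrightarrow> smooth_on (dimn M) T (i \<circ> inv_into U \<phi>)"
  show "smooth_on (dimn M) T ((\<lambda>x. f x + g x) \<circ> inv_into U \<phi>)"
    using *[of f] *[of g] Ck_on_add[OF T] by (simp add: smooth_on_def o_def)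
qed (use assms in auto)

lemma smooth_at_mult:
  assumes "is_atlas M" "smooth_at M p f" "smooth_at M p g"
  shows "smooth_at M p (\<lambda>x. f x * g x)"
proof (rule smooth_at_transfer[OF assms(1) _ _ smooth_at_point[OF assms(1,2)], where I="{f, g}" and f="\<lambda>x. x"])
  fix T U \<phi> assume T: "openin (Euclidean_space (dimn M)) T"
    and *: "\<And>i. i \<in> {f, g} \<Longrightarrow> smooth_on (dimn M) T (i \<circ> inv_into U \<phi>)"
  show "smooth_on (dimn M) T ((\<lambda>x. f x * g x) \<circ> inv_into U \<phi>)"
    using *[of f] *[of g] Ck_on_mult[OF T] by (simp add: smooth_on_def o_def)
qed (use assms in auto)

lemma smooth_at_flat:
  assumes "is_atlas M" "smooth_at M p f"
  shows "smooth_at M p (\<lambda>x. flat m (f x))"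
proof (rule smooth_at_transfer[OF assms(1) _ _ smooth_at_point[OF assms(1,2)], where I="{f}" and f="\<lambda>x. x"])
  fix T U \<phi> assume T: "openin (Euclidean_space (dimn M)) T"
    and *: "\<And>i. i \<in> {f} \<Longrightarrow> smooth_on (dimn M) T (i \<circ> inv_into U \<phi>)"
  show "smooth_on (dimn M) T ((\<lambda>x. flat m (f x)) \<circ> inv_into U \<phi>)"
    using *[of f] Ck_on_flat[OF T] by (simp add: smooth_on_def o_def)
qed (use assms in auto)

lemma smooth_at_cong:
  assumes M: "is_atlas M" and f: "smooth_at M p f" and eq: "eventually (\<lambda>x. f x = g x) (nbhds M p)"
  shows "smooth_at M p g"
proof -
  obtain U \<phi> where c: "(U, \<phi>) \<in> maximal_atlas M" "p \<in> U"
    using is_atlas_obtain_chart[OF M smooth_at_point[OF M f]] by metis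
  obtain T where T: "openin (Euclidean_space (dimn M)) T" "\<phi> p \<in> T" "T \<subseteq> \<phi> ` U"
    "smooth_on (dimn M) T (f \<circ> inv_into U \<phi>)"
    using f smooth_at_iff_chart[OF M c] by blast
  obtain W where W: "openin (mtopology M) W" "p \<in> W" "\<forall>x\<in>W. f x = g x"
    using eq smooth_at_point[OF M f] by (auto simp: eventually_nbhds[OF M])
  let ?T = "T \<inter> \<phi> ` (U \<inter> W)"
  have op: "openin (Euclidean_space (dimn M)) ?T"
    using T(1) openin_chart_image[OF M c(1) W(1)] by blast
  have "smooth_on (dimn M) ?T (g \<circ> inv_into U \<phi>)"
  proof (rule smooth_on_cong[OF smooth_on_subset[OF T(4)] op])
    show "(f \<circ> inv_into U \<phi>) x = (g \<circ> inv_into U \<phi>) x" if "x \<in> ?T" for x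
      using that W(3) maximal_atlasD(3)[OF c(1)] by (auto simp: inv_into_f_f)
  qed auto
  then show ?thesis
    unfolding smooth_at_iff_chart[OF M c] using op T(2) W(2) c(2) by (intro exI[of _ ?T]) auto
qed

lemma smooth_at_continuous:
  assumes M: "is_atlas M" and f: "smooth_at M p f" and G: "open G" "f p \<in> G"
  shows "eventually (\<lambda>x. f x \<in> G) (nbhds M p)"
proof -
  obtain U \<phi> where c: "(U, \<phi>) \<in> maximal_atlas M" "p \<in> U"
    using is_atlas_obtain_chart[OF M smooth_at_point[OF M f]] by metis
  obtain T where T: "openin (Euclidean_space (dimn M)) T" "\<phi> p \<in> T" "T \<subseteq> \<phi> ` U"
    "smooth_on (dimn M) T (f \<circ> inv_into U \<phi>)"
    using f smooth_at_iff_chart[OF M c] by blast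
  have "openin (top_of_set T) (T \<inter> (f \<circ> inv_into U \<phi>) -` G)"
    using continuous_openin_preimage_gen[OF smooth_on_imp_continuous_on[OF T(4,1)] G(1)] .
  then have "openin (Euclidean_space (dimn M)) (T \<inter> (f \<circ> inv_into U \<phi>) -` G)"
    using openin_trans T(1) unfolding Euclidean_space_eq by blast
  from openin_chart_vimage[OF M c(1) this] show ?thesis
    unfolding eventually_nbhds[OF M smooth_at_point[OF M f]]
    using c T(2) G(2) maximal_atlasD(3)[OF c(1)]
    by (intro exI[of _ "{x \<in> U. \<phi> x \<in> T \<inter> (f \<circ> inv_into U \<phi>) -` G}"]) (auto simp: inv_into_f_f)
qed

text \<open>Falls outside the transfer scheme: the domain must first be shrunk, by continuity, to a
  neighbourhood where \<open>f\<close> has no zero.\<close>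

lemma smooth_at_inverse:
  assumes M: "is_atlas M" and f: "smooth_at M p f" and nz: "f p \<noteq> 0"
  shows "smooth_at M p (\<lambda>x. inverse (f x))"
proof -
  obtain U \<phi> where c: "(U, \<phi>) \<in> maximal_atlas M" "p \<in> U"
    using is_atlas_obtain_chart[OF M smooth_at_point[OF M f]] by metis
  have "eventually (\<lambda>x. f x \<in> - {0}) (nbhds M p)"
    by (rule smooth_at_continuous[OF M f]) (use nz in auto)
  then obtain W where W: "openin (mtopology M) W" "p \<in> W" "\<forall>x\<in>W. f x \<noteq> 0"
    using smooth_at_point[OF M f] by (auto simp: eventually_nbhds[OF M])
  obtain T where T: "openin (Euclidean_space (dimn M)) T" "\<phi> p \<in> T" "T \<subseteq> \<phi> ` U"
    "smooth_on (dimn M) T (f \<circ> inv_into U \<phi>)"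
    using f smooth_at_iff_chart[OF M c] by blast
  let ?T = "T \<inter> \<phi> ` (U \<inter> W)"
  have op: "openin (Euclidean_space (dimn M)) ?T"
    using T(1) openin_chart_image[OF M c(1) W(1)] by blast
  have "smooth_on (dimn M) ?T (f \<circ> inv_into U \<phi>)"
    using smooth_on_subset[OF T(4)] by blast
  moreover have "(f \<circ> inv_into U \<phi>) x \<noteq> 0" if "x \<in> ?T" for x
    using that W(3) maximal_atlasD(3)[OF c(1)] by (auto simp: inv_into_f_f)
  ultimately have "smooth_on (dimn M) ?T ((\<lambda>x. inverse (f x)) \<circ> inv_into U \<phi>)"
    using Ck_on_inverse[OF op, of _ "f \<circ> inv_into U \<phi>"] by (simp add: smooth_on_def o_def)
  then show ?thesis
    unfolding smooth_at_iff_chart[OF M c] using op T(2) W(2) c(2) by (intro exI[of _ ?T]) auto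
qed

lemma smooth_at_sum:
  assumes M: "is_atlas M" "p \<in> points M" and f: "\<And>i. i \<in> I \<Longrightarrow> smooth_at M p (f i)"
  shows "smooth_at M p (\<lambda>x. \<Sum>i\<in>I. f i x)"
  using f
proof (induction I rule: infinite_finite_induct)
  case (insert i I)
  then show ?case
    using smooth_at_add[OF M(1), of p "f i" "\<lambda>x. \<Sum>i\<in>I. f i x"] by simp
qed (simp_all add: smooth_at_const[OF M])

lemma smooth_at_prod:
  assumes M: "is_atlas M" "p \<in> points M" and f: "\<And>i. i \<in> I \<Longrightarrow> smooth_at M p (f i)"
  shows "smooth_at M p (\<lambda>x. \<Prod>i\<in>I. f i x)"
  using f
proof (induction I rule: infinite_finite_induct)
  case (insert i I)
  then show ?case
    using smooth_at_mult[OF M(1), of p "f i" "\<lambda>x. \<Prod>i\<in>I. f i x"] by simp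
qed (simp_all add: smooth_at_const[OF M])

lemma smooth_at_uminus:
  assumes "is_atlas M" "smooth_at M p f"
  shows "smooth_at M p (\<lambda>x. - f x)"
  using smooth_at_mult[OF assms(1) smooth_at_const[OF assms(1) smooth_at_point[OF assms], of "-1"] assms(2)] by simp

lemma smooth_at_diff:
  assumes "is_atlas M" "smooth_at M p f" "smooth_at M p g"
  shows "smooth_at M p (\<lambda>x. f x - g x)"
  using smooth_at_add[OF assms(1,2) smooth_at_uminus[OF assms(1,3)]] by simp

lemma smooth_at_divide:
  assumes "is_atlas M" "smooth_at M p f" "smooth_at M p g" "g p \<noteq> 0"
  shows "smooth_at M p (\<lambda>x. f x / g x)"
  using smooth_at_mult[OF assms(1,2) smooth_at_inverse[OF assms(1,3,4)]] by (simp add: divide_inverse)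

lemma smooth_at_coordinate:
  assumes "is_atlas M" "(U, \<phi>) \<in> maximal_atlas M" "p \<in> U"
  shows "smooth_at M p (\<lambda>x. \<phi> x i)"
proof -
  note op = maximal_atlasD(4)[OF assms(2)]
  have "smooth_on (dimn M) (\<phi> ` U) ((\<lambda>x. \<phi> x i) \<circ> inv_into U \<phi>)"
  proof (rule smooth_on_cong[OF _ op])
    show "smooth_on (dimn M) (\<phi> ` U) (\<lambda>y. y i)"
      using Ck_on_coord[OF op] by (simp add: smooth_on_def)
  qed (auto simp: f_inv_into_f)
  then show ?thesis
    unfolding smooth_at_iff_chart[OF assms] using op assms(3) by (intro exI[of _ "\<phi> ` U"]) auto
qed

section \<open>Bump functions and partitions of unity\<close>

text \<open>A closed cube is compact as a product of intervals. In a Hausdorff manifold its preimage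
  is then closed, which is what permits extending a bump function by 0 outside the chart.\<close>

lemma compactin_chart_cube:
  assumes M: "is_atlas M" and c: "(U, \<phi>) \<in> maximal_atlas M"
    and Cb: "Cb = {z \<in> ES (dimn M). \<forall>i<dimn M. \<bar>z i - a i\<bar> \<le> e}" "Cb \<subseteq> \<phi> ` U"
  shows "compactin (mtopology M) {x \<in> U. \<phi> x \<in> Cb}"
proof -
  have "Cb = PiE UNIV (\<lambda>i. if i < dimn M then {a i - e..a i + e} else {0})"
  proof (rule set_eqI)
    fix z
    have "z \<in> PiE UNIV (\<lambda>i. if i < dimn M then {a i - e..a i + e} else {0}) \<longleftrightarrow>
        (\<forall>i. (i < dimn M \<longrightarrow> \<bar>z i - a i\<bar> \<le> e) \<and> (\<not> i < dimn M \<longrightarrow> z i = 0))"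
      by (simp add: PiE_iff abs_le_iff algebra_simps) blast
    then show "z \<in> Cb \<longleftrightarrow> z \<in> PiE UNIV (\<lambda>i. if i < dimn M then {a i - e..a i + e} else {0})"
      by (auto simp: Cb(1) not_less)
  qed
  moreover have "compactin (powertop_real UNIV) (PiE UNIV (\<lambda>i. if i < dimn M then {a i - e..a i + e} else {0::real}))"
    by (simp add: compactin_PiE)
  ultimately have "compactin (top_of_set Cb) Cb"
    by (simp add: euclidean_product_topology compactin_subtopology)
  moreover have "continuous_map (top_of_set Cb) (mtopology M) (inv_into U \<phi>)"
    unfolding continuous_map_def
  proof (intro conjI allI impI)
    show "inv_into U \<phi> \<in> topspace (top_of_set Cb) \<rightarrow> topspace (mtopology M)"
      using Cb(2) maximal_atlasD(1)[OF c] by (auto simp: topspace_mtopology[OF M] intro: inv_into_into)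
  next
    fix W assume W: "openin (mtopology M) W"
    obtain G where G: "open G" "\<phi> ` (U \<inter> W) = ES (dimn M) \<inter> G"
      using openin_chart_image[OF M c W] by (auto simp: Euclidean_space_eq openin_open)
    have "{x \<in> topspace (top_of_set Cb). inv_into U \<phi> x \<in> W} = Cb \<inter> \<phi> ` (U \<inter> W)"
      using Cb(2) maximal_atlasD(3)[OF c] by (auto simp: inv_into_f_f)
    also have "\<dots> = Cb \<inter> G"
      using G(2) Cb(1) by auto
    finally show "openin (top_of_set Cb) {x \<in> topspace (top_of_set Cb). inv_into U \<phi> x \<in> W}"
      using G(1) by (auto simp: openin_open)
  qed
  ultimately have "compactin (mtopology M) (inv_into U \<phi> ` Cb)"
    by (rule image_compactin)
  moreover have "inv_into U \<phi> ` Cb = {x \<in> U. \<phi> x \<in> Cb}"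
  proof (intro set_eqI iffI)
    fix x assume "x \<in> {x \<in> U. \<phi> x \<in> Cb}"
    then show "x \<in> inv_into U \<phi> ` Cb"
      using inv_into_f_f[OF maximal_atlasD(3)[OF c], of x] by (metis (mono_tags, lifting) imageI mem_Collect_eq)
  qed (use Cb(2) in \<open>auto simp: f_inv_into_f inv_into_into subset_iff\<close>)
  ultimately show ?thesis by simp
qed

lemma flat_nonneg: "flat m t \<ge> 0"
  by (simp add: flat_def)

lemma flat_pos_iff: "flat m t > 0 \<longleftrightarrow> t > 0"
  by (simp add: flat_def)

lemma flat_zero: "t \<le> 0 \<Longrightarrow> flat m t = 0"
  by (simp add: flat_def)

lemma bump_function_exists:
  assumes "smooth_manifold M" "openin (mtopology M) W" "p \<in> W"
  obtains \<rho> D where "smooth_fun M \<rho>" "\<And>x. 0 \<le> \<rho> x" "eventually (\<lambda>x. \<rho> x = 1) (nbhds M p)"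
    "closedin (mtopology M) D" "D \<subseteq> W" "\<And>x. x \<notin> D \<Longrightarrow> \<rho> x = 0"
proof -
  have M: "is_atlas M" "Hausdorff_space (mtopology M)"
    using assms(1) by (auto simp: smooth_manifold_def)
  have p: "p \<in> points M"
    using assms(2,3) by (metis M(1) openin_subset subsetD topspace_mtopology)
  obtain U \<phi> where c: "(U, \<phi>) \<in> maximal_atlas M" "p \<in> U"
    using is_atlas_obtain_chart[OF M(1) p] by metis
  let ?n = "dimn M"
  obtain e where e: "e > 0" "\<And>z. z \<in> ES ?n \<Longrightarrow> (\<forall>i<?n. \<bar>z i - \<phi> p i\<bar> < e) \<Longrightarrow> z \<in> \<phi> ` (U \<inter> W)"
    using openin_Euclidean_space_box[OF openin_chart_image[OF M(1) c(1) assms(2)], of "\<phi> p"] c(2) assms(3) by blast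
  define Cb where "Cb = {z \<in> ES ?n. \<forall>i<?n. \<bar>z i - \<phi> p i\<bar> \<le> e / 2}"
  have CbW: "Cb \<subseteq> \<phi> ` (U \<inter> W)"
  proof
    fix z assume "z \<in> Cb"
    then show "z \<in> \<phi> ` (U \<inter> W)"
      using e(1) unfolding Cb_def by (intro e(2)) fastforce+
  qed
  define D where "D = {x \<in> U. \<phi> x \<in> Cb}"
  have clD: "closedin (mtopology M) D"
    unfolding D_def
    by (rule compactin_imp_closedin[OF M(2) compactin_chart_cube[OF M(1) c(1) Cb_def]]) (use CbW in blast)
  have DW: "D \<subseteq> W"
    using CbW maximal_atlasD(3)[OF c(1)] by (auto simp: D_def inj_on_def dest!: subsetD)
  \<comment> \<open>Each factor is positive exactly where
    \<open>\<bar>\<phi> x i - \<phi> p i\<bar> < e / 2\<close>, so the product is positive on the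
    open cube and 0 elsewhere in the chart. Halving \<open>e\<close> keeps the closed cube inside
    the image of \<open>W\<close>.\<close>
  define b where "b x = (if x \<in> U then \<Prod>i<?n. flat 0 ((e / 2)\<^sup>2 - (\<phi> x i - \<phi> p i)\<^sup>2) else 0)" for x
  have b0: "b x = 0" if "x \<notin> D" for x
  proof (cases "x \<in> U")
    case True
    then have "\<phi> x \<in> ES ?n"
      using openin_Euclidean_space_ES[OF maximal_atlasD(4)[OF c(1)]] by blast
    then have "\<not> (\<forall>i<?n. \<bar>\<phi> x i - \<phi> p i\<bar> \<le> e / 2)"
      using that True by (simp add: D_def Cb_def)
    then obtain i where i: "i < ?n" "\<bar>\<phi> x i - \<phi> p i\<bar> > e / 2"
      using not_le by blast
    then have "(e / 2)\<^sup>2 \<le> (\<phi> x i - \<phi> p i)\<^sup>2"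
      using e(1) by (intro abs_le_square_iff[THEN iffD1]) auto
    then have "flat 0 ((e / 2)\<^sup>2 - (\<phi> x i - \<phi> p i)\<^sup>2) = 0"
      by (intro flat_zero) simp
    then show ?thesis
      using True i(1) by (auto simp: b_def)
  qed (simp add: b_def)
  have bnn: "b x \<ge> 0" for x
    by (simp add: b_def prod_nonneg flat_nonneg)
  have bp: "b p > 0"
    using c(2) e(1) by (auto simp: b_def flat_pos_iff intro!: prod_pos)
  have bs: "smooth_at M x b" if x: "x \<in> points M" for x
  proof (cases "x \<in> U")
    case True
    have "smooth_at M x (\<lambda>x. \<Prod>i<?n. flat 0 ((e / 2)\<^sup>2 - (\<phi> x i - \<phi> p i)\<^sup>2))"
      unfolding power2_eq_square
      by (intro smooth_at_prod[OF M(1) x] smooth_at_flat[OF M(1)] smooth_at_diff[OF M(1)] smooth_at_mult[OF M(1)]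
          smooth_at_const[OF M(1) x] smooth_at_coordinate[OF M(1) c(1) True])
    then show ?thesis
    proof (rule smooth_at_cong[OF M(1)])
      show "\<forall>\<^sub>F x in nbhds M x. (\<Prod>i<?n. flat 0 ((e / 2)\<^sup>2 - (\<phi> x i - \<phi> p i)\<^sup>2)) = b x"
        using eventually_nbhds_open[OF openin_maximal_chart[OF M(1) c(1)] True]
        by eventually_elim (simp add: b_def)
    qed
  next
    case False
    \<comment> \<open>Outside the chart \<open>b\<close> is 0 nearby because \<open>D\<close>, a
      compact set in a Hausdorff space, is closed; openness of the chart domain alone would not give
      this.\<close>
    have "openin (mtopology M) (points M - D)"
      using clD by (simp add: closedin_def topspace_mtopology[OF M(1)])
    moreover have "x \<in> points M - D" using False x by (simp add: D_def)
    ultimately have "\<forall>\<^sub>F x in nbhds M x. 0 = b x"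
      by (rule eventually_mono[OF eventually_nbhds_open]) (use b0 in auto)
    then show ?thesis
      by (rule smooth_at_cong[OF M(1) smooth_at_const[OF M(1) x]])
  qed
  \<comment> \<open>The scale makes \<open>t p = 2\<close>, hence \<open>t > 1\<close> near
    \<open>p\<close>. Then \<open>\<rho>\<close> is the standard smooth step, 0 for
    \<open>t \<le> 0\<close> and 1 for \<open>t \<ge> 1\<close>; one of \<open>t\<close> and
    \<open>1 - t\<close> is always positive, so the denominator never vanishes.\<close>
  define t where "t x = 2 / b p * b x" for x
  define \<rho> where "\<rho> x = flat 0 (t x) / (flat 0 (t x) + flat 0 (1 - t x))" for x
  have den: "flat 0 (t x) + flat 0 (1 - t x) > 0" for x
    using flat_pos_iff[of 0 "t x"] flat_pos_iff[of 0 "1 - t x"] flat_nonneg[of 0 "t x"] flat_nonneg[of 0 "1 - t x"]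
    by (cases "t x > 0") linarith+
  show ?thesis
  proof
    show "smooth_fun M \<rho>"
      unfolding smooth_fun_iff_smooth_at[OF M(1)]
    proof
      fix x assume x: "x \<in> points M"
      have ts: "smooth_at M x t"
        unfolding t_def by (intro smooth_at_mult[OF M(1)] smooth_at_const[OF M(1) x] bs x)
      have ts1: "smooth_at M x (\<lambda>x. 1 - t x)"
        by (intro smooth_at_diff[OF M(1)] smooth_at_const[OF M(1) x] ts)
      show "smooth_at M x \<rho>"
        unfolding \<rho>_def
      proof (rule smooth_at_divide[OF M(1) smooth_at_flat[OF M(1) ts] smooth_at_add[OF M(1) smooth_at_flat[OF M(1) ts] smooth_at_flat[OF M(1) ts1]]])
        show "flat 0 (t x) + flat 0 (1 - t x) \<noteq> 0" using den[of x] by simp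
      qed
    qed
    show "0 \<le> \<rho> x" for x
      using den[of x] flat_nonneg[of 0 "t x"] by (simp add: \<rho>_def)
    have "eventually (\<lambda>x. b x \<in> {b p / 2<..}) (nbhds M p)"
      by (rule smooth_at_continuous[OF M(1) bs[OF p]]) (use bp in auto)
    then show "eventually (\<lambda>x. \<rho> x = 1) (nbhds M p)"
    proof eventually_elim
      case (elim x)
      then have "1 < t x" using bp by (simp add: t_def field_simps)
      then have "flat 0 (1 - t x) = 0" "flat 0 (t x) > 0"
        using flat_pos_iff[of 0 "t x"] by (auto intro: flat_zero)
      then show ?case by (simp add: \<rho>_def)
    qed
    show "\<rho> x = 0" if "x \<notin> D" for x
      using b0[OF that] by (simp add: \<rho>_def t_def flat_zero)
  qed (use clD DW in auto)
qed

text \<open>No compactness is needed for local finiteness: where \<open>\<rho> (c i) > \<delta>\<close>, the \<open>i\<close>-th factor of \<open>\<eta> n\<close>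
  vanishes as soon as \<open>n > i\<close> and \<open>n \<delta> > 1\<close>.\<close>

lemma partition_of_unity:
  assumes "smooth_manifold M" "points M \<noteq> {}"
    and W: "\<And>p. p \<in> points M \<Longrightarrow> openin (mtopology M) (W p) \<and> p \<in> W p"
  obtains \<psi> c D where
    "\<And>n::nat. c n \<in> points M" "\<And>n. smooth_fun M (\<psi> n)" "\<And>n. closedin (mtopology M) (D n)" "\<And>n. D n \<subseteq> W (c n)"
    "\<And>n x. x \<notin> D n \<Longrightarrow> \<psi> n x = 0"
    "\<And>p. p \<in> points M \<Longrightarrow> \<exists>N. eventually (\<lambda>x. (\<forall>n\<ge>N. \<psi> n x = 0) \<and> (\<Sum>n<N. \<psi> n x) = 1) (nbhds M p)"
proof -
  have M: "is_atlas M" "second_countable (mtopology M)"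
    using assms(1) by (auto simp: smooth_manifold_def)
  note topM = topspace_mtopology[OF M(1)]
  have "\<exists>\<rho> D. smooth_fun M \<rho> \<and> (\<forall>x. 0 \<le> \<rho> x) \<and> eventually (\<lambda>x. \<rho> x = 1) (nbhds M p) \<and>
      closedin (mtopology M) D \<and> D \<subseteq> W p \<and> (\<forall>x. x \<notin> D \<longrightarrow> \<rho> x = 0)" if "p \<in> points M" for p
    using bump_function_exists[OF assms(1), of "W p" p] W[OF that] by metis
  then obtain \<rho> D where r: "\<And>p. p \<in> points M \<Longrightarrow> smooth_fun M (\<rho> p) \<and> (\<forall>x. 0 \<le> \<rho> p x) \<and>
      eventually (\<lambda>x. \<rho> p x = 1) (nbhds M p) \<and> closedin (mtopology M) (D p) \<and> D p \<subseteq> W p \<and> (\<forall>x. x \<notin> D p \<longrightarrow> \<rho> p x = 0)"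
    by metis
  have rs: "smooth_at M x (\<rho> p)" if "p \<in> points M" "x \<in> points M" for p x
    using r[OF that(1)] that(2) smooth_fun_iff_smooth_at[OF M(1)] by blast
  define O' where "O' p = {x \<in> points M. \<rho> p x > 0}" for p
  have opO: "openin (mtopology M) (O' p)" if p: "p \<in> points M" for p
  proof (subst openin_subopen, safe)
    fix x assume x: "x \<in> O' p"
    then have xp: "x \<in> points M" by (simp add: O'_def)
    have "eventually (\<lambda>y. \<rho> p y \<in> {0<..}) (nbhds M x)"
      by (rule smooth_at_continuous[OF M(1) rs[OF p xp]]) (use x in \<open>auto simp: O'_def\<close>)
    then have "eventually (\<lambda>y. y \<in> O' p) (nbhds M x)"
      using eventually_nbhds_points[OF M(1)] by eventually_elim (simp add: O'_def)
    then show "\<exists>T. openin (mtopology M) T \<and> x \<in> T \<and> T \<subseteq> O' p"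
      unfolding eventually_nbhds[OF M(1) xp] by blast
  qed
  have pO: "p \<in> O' p" if "p \<in> points M" for p
    using eventually_nbhds_self[OF M(1) that, of "\<lambda>x. \<rho> p x = 1"] r[OF that] that by (simp add: O'_def)
  have "Lindelof_space (mtopology M)"
    by (rule second_countable_imp_Lindelof_space[OF M(2)])
  then obtain V where V: "countable V" "V \<subseteq> O' ` points M" "\<Union>V = points M"
  proof -
    assume L: "Lindelof_space (mtopology M)"
    have "\<forall>U\<in>O' ` points M. openin (mtopology M) U" using opO by blast
    moreover have "\<Union>(O' ` points M) = points M" using pO by (auto simp: O'_def)
    ultimately show thesis
      using L[unfolded Lindelof_space_def topM, rule_format, of "O' ` points M"] that by meson
  qed
  obtain P where P: "P \<subseteq> points M" "countable P" "V = O' ` P"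
    using V(1,2) by (metis countable_subset_image)
  have "P \<noteq> {}" using V(3) P(3) assms(2) by auto
  \<comment> \<open>A finite \<open>P\<close> is enumerated with repetitions. These are harmless,
    since positivity below rests on the least suitable index.\<close>
  define c where "c = from_nat_into P"
  have cP: "c n \<in> points M" for n
    using from_nat_into[OF \<open>P \<noteq> {}\<close>, of n] P(1) by (auto simp: c_def)
  have cov: "\<exists>n. \<rho> (c n) x > 0" if "x \<in> points M" for x
  proof -
    from that V(3) P(3) obtain p where "p \<in> P" "x \<in> O' p" by auto
    moreover obtain n where "c n = p"
      using from_nat_into_surj[OF P(2) \<open>p \<in> P\<close>] by (auto simp: c_def)
    ultimately show ?thesis by (auto simp: O'_def)
  qed
  have rn: "\<rho> (c n) x \<ge> 0" for n x
    using r[OF cP] by blast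
  define \<eta> where "\<eta> n x = \<rho> (c n) x * (\<Prod>i<n. flat 0 (1 - real n * \<rho> (c i) x))" for n x
  have chi_nn: "\<eta> n x \<ge> 0" for n x
    by (simp add: \<eta>_def rn prod_nonneg flat_nonneg)
  have chis: "smooth_at M x (\<eta> n)" if x: "x \<in> points M" for n x
    unfolding \<eta>_def
    by (intro smooth_at_mult[OF M(1)] rs[OF cP x] smooth_at_prod[OF M(1) x] smooth_at_flat[OF M(1)]
          smooth_at_diff[OF M(1)] smooth_at_const[OF M(1) x])
  have lf: "\<exists>N. eventually (\<lambda>x. \<forall>n\<ge>N. \<eta> n x = 0) (nbhds M p)" if p: "p \<in> points M" for p
  proof -
    obtain i where i: "\<rho> (c i) p > 0" using cov[OF p] by blast
    define \<delta> where "\<delta> = \<rho> (c i) p / 2"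
    have d: "\<delta> > 0" using i by (simp add: \<delta>_def)
    obtain N0 :: nat where N0: "1 / \<delta> < real N0" using reals_Archimedean2 by blast
    have ev: "eventually (\<lambda>x. \<rho> (c i) x \<in> {\<delta><..}) (nbhds M p)"
      by (rule smooth_at_continuous[OF M(1) rs[OF cP p]]) (use d in \<open>auto simp: \<delta>_def\<close>)
    have "eventually (\<lambda>x. \<forall>n\<ge>max N0 (Suc i). \<eta> n x = 0) (nbhds M p)"
      using ev
    proof eventually_elim
      case (elim x)
      show ?case
      proof (intro allI impI)
        fix n assume n: "max N0 (Suc i) \<le> n"
        have "1 < real N0 * \<delta>" using N0 d by (simp add: field_simps)
        also have "\<dots> \<le> real n * \<rho> (c i) x"
          using n elim d by (intro mult_mono) auto
        finally have "flat 0 (1 - real n * \<rho> (c i) x) = 0"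
          by (intro flat_zero) simp
        moreover have "i < n" using n by simp
        ultimately have "(\<Prod>i<n. flat 0 (1 - real n * \<rho> (c i) x)) = 0"
          by (intro prod_zero) auto
        then show "\<eta> n x = 0" by (simp add: \<eta>_def)
      qed
    qed
    then show ?thesis by blast
  qed
  have pos: "\<exists>n. \<eta> n x > 0" if x: "x \<in> points M" for x
  proof -
    \<comment> \<open>At the first index with \<open>\<rho> (c n) x > 0\<close> all earlier bumps
      vanish at \<open>x\<close>, so every factor of the product equals \<open>flat 0 1\<close>,
      which is positive.\<close>
    define n where "n = (LEAST n. \<rho> (c n) x > 0)"
    have n: "\<rho> (c n) x > 0" unfolding n_def using cov[OF x] by (rule LeastI_ex)
    have "\<rho> (c i) x = 0" if "i < n" for i
      using not_less_Least[of i "\<lambda>n. \<rho> (c n) x > 0"] that rn[of i x] unfolding n_def by force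
    then have "\<eta> n x > 0"
      using n by (auto simp: \<eta>_def flat_pos_iff intro!: mult_pos_pos prod_pos)
    then show ?thesis by blast
  qed
  define s where "s x = (\<Sum>n | \<eta> n x \<noteq> 0. \<eta> n x)" for x
  have s_eq: "s x = (\<Sum>n<N. \<eta> n x)" if "\<forall>n\<ge>N. \<eta> n x = 0" for N x
    unfolding s_def by (rule sum.mono_neutral_left) (use that not_le in auto)
  have s_pos: "s x > 0" if x: "x \<in> points M" for x
  proof -
    obtain N where N: "\<forall>n\<ge>N. \<eta> n x = 0"
      using lf[OF x] eventually_nbhds_self[OF M(1) x] by blast
    obtain n where n: "\<eta> n x > 0" using pos[OF x] by blast
    then have "n < N" using N by (metis not_le less_irrefl)
    then show ?thesis
      unfolding s_eq[OF N] using n chi_nn by (intro sum_pos2[of _ n]) auto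
  qed
  have ss: "smooth_at M x s" if x: "x \<in> points M" for x
  proof -
    obtain N where N: "eventually (\<lambda>x. \<forall>n\<ge>N. \<eta> n x = 0) (nbhds M x)"
      using lf[OF x] by blast
    have "smooth_at M x (\<lambda>x. \<Sum>n<N. \<eta> n x)"
      by (rule smooth_at_sum[OF M(1) x chis[OF x]])
    then show ?thesis
      by (rule smooth_at_cong[OF M(1)]) (use N s_eq in \<open>auto elim!: eventually_mono\<close>)
  qed
  show ?thesis
  proof
    show "c n \<in> points M" for n by (rule cP)
    show "smooth_fun M (\<lambda>x. \<eta> n x / s x)" for n
      unfolding smooth_fun_iff_smooth_at[OF M(1)]
      using smooth_at_divide[OF M(1) chis ss] s_pos by fastforce
    show "closedin (mtopology M) (D (c n))" "D (c n) \<subseteq> W (c n)" for n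
      using r[OF cP] by auto
    show "\<eta> n x / s x = 0" if "x \<notin> D (c n)" for n x
      using r[OF cP] that by (simp add: \<eta>_def)
    show "\<exists>N. eventually (\<lambda>x. (\<forall>n\<ge>N. \<eta> n x / s x = 0) \<and> (\<Sum>n<N. \<eta> n x / s x) = 1) (nbhds M p)"
      if p: "p \<in> points M" for p
    proof -
      obtain N where N: "eventually (\<lambda>x. \<forall>n\<ge>N. \<eta> n x = 0) (nbhds M p)"
        using lf[OF p] by blast
      have "eventually (\<lambda>x. (\<forall>n\<ge>N. \<eta> n x / s x = 0) \<and> (\<Sum>n<N. \<eta> n x / s x) = 1) (nbhds M p)"
        using N eventually_nbhds_points[OF M(1)]
      proof eventually_elim
        case (elim x)
        then show ?case
          using s_pos[of x] s_eq[of N x] by (simp flip: sum_divide_distrib)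
      qed
      then show ?thesis by blast
    qed
  qed
qed

text \<open>Test functions are total, and \<open>\<tau> = 1 - \<rho>\<close> is 1 off the manifold, so \<open>\<tau> h = h\<close> holds everywhere
  for \<open>h = f - g\<close>, while \<open>\<tau>\<close> and \<open>h\<close> vanish at \<open>p\<close>.\<close>

lemma tangent_local:
  assumes M: "smooth_manifold M" and p: "p \<in> points M" and v: "v \<in> tangent M p"
    and f: "smooth_fun M f" and g: "smooth_fun M g"
    and eq: "eventually (\<lambda>x. f x = g x) (nbhds M p)"
  shows "v f = v g"
proof -
  have A: "is_atlas M" using M by (simp add: smooth_manifold_def)
  obtain W where W: "openin (mtopology M) W" "p \<in> W" "\<forall>x\<in>W. f x = g x"
    using eq by (auto simp: eventually_nbhds[OF A p])
  obtain \<rho> D where r: "smooth_fun M \<rho>" "eventually (\<lambda>x. \<rho> x = 1) (nbhds M p)" "D \<subseteq> W" "\<And>x. x \<notin> D \<Longrightarrow> \<rho> x = 0"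
    using bump_function_exists[OF M W(1,2)] by metis
  have rp: "\<rho> p = 1" using eventually_nbhds_self[OF A p r(2)] .
  define h where "h x = 1 * f x + (-1) * g x" for x
  define \<tau> where "\<tau> x = 1 + (-1) * \<rho> x" for x
  have sh: "smooth_fun M h" "smooth_fun M \<tau>"
    using f g r(1) unfolding h_def \<tau>_def smooth_fun_iff_smooth_at[OF A]
    by (safe; intro smooth_at_add[OF A] smooth_at_mult[OF A] smooth_at_const[OF A]; blast)+
  have lin: "v h = 1 * v f + (-1) * v g"
    using v f g unfolding tangent_def h_def by blast
  have "(\<lambda>x. \<tau> x * h x) = h"
    using W(3) r(3,4) by (fastforce simp: \<tau>_def h_def fun_eq_iff)
  moreover have "v (\<lambda>x. \<tau> x * h x) = \<tau> p * v h + h p * v \<tau>"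
    using v sh unfolding tangent_def by blast
  moreover have "\<tau> p = 0" "h p = 0"
    using rp W(2,3) by (auto simp: \<tau>_def h_def)
  ultimately have "v h = 0" by simp
  then show ?thesis using lin by simp
qed

section \<open>Embedded submanifolds\<close>

text \<open>The linear retraction of the model space onto a slice; it carries functions and open
  sets from the submanifold into an ambient chart.\<close>

definition coord_proj :: "nat \<Rightarrow> (nat \<Rightarrow> real) \<Rightarrow> nat \<Rightarrow> real" where
  "coord_proj k y = (\<lambda>i. if i < k then y i else 0)"

lemma coord_proj_ES: "coord_proj k y \<in> ES k"
  by (simp add: coord_proj_def)

lemma coord_proj_id: "y \<in> ES k \<Longrightarrow> coord_proj k y = y"
  by (auto simp: coord_proj_def fun_eq_iff)

lemma openin_coord_proj_vimage:
  assumes "openin (Euclidean_space k) G" "openin (Euclidean_space n) T"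
  shows "openin (Euclidean_space n) {y \<in> T. coord_proj k y \<in> G}"
proof -
  obtain G' where G': "open G'" "G = ES k \<inter> G'"
    using assms(1) by (auto simp: Euclidean_space_eq openin_open)
  have cont: "continuous_on T (coord_proj k)"
    by (rule continuous_on_into_ES[of _ _ k])
      (auto simp: coord_proj_def intro: continuous_on_subset[OF continuous_on_product_coordinates])
  have "{y \<in> T. coord_proj k y \<in> G} = T \<inter> coord_proj k -` G'"
    using coord_proj_ES[of k] G'(2) by auto
  moreover have "openin (top_of_set T) (T \<inter> coord_proj k -` G')"
    using continuous_openin_preimage_gen[OF cont G'(1)] .
  ultimately show ?thesis
    using openin_trans[OF _ assms(2)[unfolded Euclidean_space_eq]]
    by (simp add: Euclidean_space_eq)
qed

lemma openin_Euclidean_space_restrict: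
  assumes "openin (Euclidean_space n) T" "k \<le> n"
  shows "openin (Euclidean_space k) (T \<inter> ES k)"
proof -
  obtain T' where T': "open T'" "T = ES n \<inter> T'"
    using assms(1) by (auto simp: Euclidean_space_eq openin_open)
  have "T \<inter> ES k = ES k \<inter> T'"
    using T'(2) assms(2) by auto
  then show ?thesis
    using T'(1) by (auto simp: Euclidean_space_eq openin_open)
qed

locale embedded =
  fixes M :: "'m manifold" and C :: "'m set" and k :: nat and S :: "'m manifold"
  assumes M: "smooth_manifold M" and emb: "embedded_submanifold M C k"
    and S_def: "S = submanifold_of M C k"
begin

lemma atlas_M: "is_atlas M"
  using M by (simp add: smooth_manifold_def)

lemma points_S [simp]: "points S = C"
  and dimn_S [simp]: "dimn S = k"
  and charts_S: "charts S = (\<lambda>(U, \<phi>). (U \<inter> C, \<phi>)) ` slice_charts M C k"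
  by (simp_all add: S_def submanifold_of_def)

lemma C_subset: "C \<subseteq> points M" and k_le: "k \<le> dimn M"
  using emb by (auto simp: embedded_submanifold_def)

lemma slice_chart_exists:
  assumes "p \<in> C"
  obtains U \<phi> where "(U, \<phi>) \<in> slice_charts M C k" "p \<in> U"
  using emb assms by (auto simp: embedded_submanifold_def)

lemma slice_chart_maximal: "(U, \<phi>) \<in> slice_charts M C k \<Longrightarrow> (U, \<phi>) \<in> maximal_atlas M"
  by (simp add: slice_charts_def)

lemma slice_chart_image:
  assumes "(U, \<phi>) \<in> slice_charts M C k" "W \<subseteq> U"
  shows "\<phi> ` (W \<inter> C) = \<phi> ` W \<inter> ES k"
proof -
  have *: "\<phi> ` (U \<inter> C) = \<phi> ` U \<inter> ES k"
    using assms(1) by (simp add: slice_charts_def topspace_Euclidean_space)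
  have inj: "inj_on \<phi> U"
    using maximal_atlasD(3)[OF slice_chart_maximal[OF assms(1)]] .
  show ?thesis
  proof (intro set_eqI iffI)
    fix y assume "y \<in> \<phi> ` (W \<inter> C)"
    then show "y \<in> \<phi> ` W \<inter> ES k" using * assms(2) by blast
  next
    fix y assume "y \<in> \<phi> ` W \<inter> ES k"
    then obtain x where x: "x \<in> W" "y = \<phi> x" "\<phi> x \<in> ES k" by blast
    then have "\<phi> x \<in> \<phi> ` (U \<inter> C)" using * assms(2) by blast
    then obtain x' where x': "x' \<in> U" "x' \<in> C" "\<phi> x = \<phi> x'" by blast
    then have "x = x'" using inj x(1) assms(2) by (meson inj_onD subsetD)
    then show "y \<in> \<phi> ` (W \<inter> C)" using x x' by blast
  qed
qed

lemma slice_inv_into: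
  assumes "(U, \<phi>) \<in> slice_charts M C k" "y \<in> \<phi> ` (U \<inter> C)"
  shows "inv_into (U \<inter> C) \<phi> y = inv_into U \<phi> y"
proof -
  obtain x where x: "x \<in> U \<inter> C" "y = \<phi> x" using assms(2) by blast
  have "inj_on \<phi> U"
    using maximal_atlasD(3)[OF slice_chart_maximal[OF assms(1)]] .
  then show ?thesis
    using x by (metis IntE inf_le1 inj_on_subset inv_into_f_f)
qed

lemma slice_chart_transition:
  assumes "(U, \<phi>) \<in> slice_charts M C k" "(V, \<psi>) \<in> slice_charts M C k"
  shows "smooth_transition k (U \<inter> C, \<phi>) (V \<inter> C, \<psi>)"
proof -
  note c = slice_chart_maximal[OF assms(1)] and d = slice_chart_maximal[OF assms(2)]
  have eq: "\<phi> ` ((U \<inter> C) \<inter> (V \<inter> C)) = \<phi> ` (U \<inter> V) \<inter> ES k"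
    using slice_chart_image[OF assms(1), of "U \<inter> V"] by (simp add: Int_ac)
  have opV: "openin (mtopology M) (U \<inter> V)"
    using openin_maximal_chart[OF atlas_M c] openin_maximal_chart[OF atlas_M d] by blast
  have op: "openin (Euclidean_space k) (\<phi> ` (U \<inter> V) \<inter> ES k)"
    using openin_Euclidean_space_restrict[OF openin_chart_image[OF atlas_M c opV] k_le] by (simp add: Int_ac)
  have "smooth_on k (\<phi> ` (U \<inter> V) \<inter> ES k) (\<lambda>x. \<psi> (inv_into (U \<inter> C) \<phi> x) i)" for i
  proof -
    \<comment> \<open>Members of the maximal atlas are compared only with the given charts. Two of
      them are compatible with each other because chart coordinates are smooth functions on
      \<open>M\<close>.\<close>
    have "smooth_fun_on M (U \<inter> V) (\<lambda>x. \<psi> x i)"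
      using smooth_fun_on_iff_smooth_at[OF atlas_M opV] smooth_at_coordinate[OF atlas_M d] by blast
    then have "smooth_on (dimn M) (\<phi> ` (U \<inter> V)) ((\<lambda>x. \<psi> x i) \<circ> inv_into U \<phi>)"
      using smooth_fun_on_iff_chart[OF atlas_M c _ opV] by blast
    then have "smooth_on k (\<phi> ` (U \<inter> V) \<inter> ES k) ((\<lambda>x. \<psi> x i) \<circ> inv_into U \<phi>)"
      using smooth_on_restrict k_le by blast
    then show ?thesis
    proof (rule smooth_on_cong[OF _ op])
      fix x assume "x \<in> \<phi> ` (U \<inter> V) \<inter> ES k"
      then have "x \<in> \<phi> ` (U \<inter> C)" unfolding eq[symmetric] by blast
      then show "((\<lambda>x. \<psi> x i) \<circ> inv_into U \<phi>) x = \<psi> (inv_into (U \<inter> C) \<phi> x) i"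
        using slice_inv_into[OF assms(1)] by simp
    qed
  qed
  then show ?thesis
    using op unfolding smooth_transition_def by (simp add: eq)
qed

lemma atlas_S: "is_atlas S"
proof -
  have "is_chart k (U \<inter> C, \<phi>)" if "(U, \<phi>) \<in> slice_charts M C k" for U \<phi>
  proof -
    note c = maximal_atlasD[OF slice_chart_maximal[OF that]]
    have "openin (Euclidean_space k) (\<phi> ` (U \<inter> C))"
      using slice_chart_image[OF that, of U] openin_Euclidean_space_restrict[OF c(4) k_le] by simp
    then show ?thesis
      using c(3) by (simp add: is_chart_def inj_on_subset)
  qed
  moreover have "\<Union>(fst ` charts S) = C"
  proof (intro set_eqI iffI)
    fix x assume "x \<in> C"
    then obtain U \<phi> where s: "(U, \<phi>) \<in> slice_charts M C k" "x \<in> U" by (rule slice_chart_exists)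
    then have "(U \<inter> C, \<phi>) \<in> charts S"
      unfolding charts_S by (intro image_eqI[of _ _ "(U, \<phi>)"]) simp_all
    then show "x \<in> \<Union>(fst ` charts S)"
      using s(2) \<open>x \<in> C\<close> by (metis IntI UN_I fst_conv)
  qed (auto simp: charts_S)
  moreover have "\<exists>U \<phi>. (U, \<phi>) \<in> slice_charts M C k \<and> c = (U \<inter> C, \<phi>)" if "c \<in> charts S" for c
    using that by (auto simp: charts_S)
  ultimately show ?thesis
    unfolding is_atlas_def points_S dimn_S by (metis slice_chart_transition)
qed

lemma slice_chart_maximal_S:
  "(U, \<phi>) \<in> slice_charts M C k \<Longrightarrow> (U \<inter> C, \<phi>) \<in> maximal_atlas S"
  by (rule subsetD[OF charts_subset_maximal_atlas[OF atlas_S]])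
    (simp add: charts_S, rule image_eqI[of _ _ "(U, \<phi>)"], simp_all)

lemma openin_S_of_M:
  assumes "openin (mtopology M) G"
  shows "openin (mtopology S) (G \<inter> C)"
  unfolding openin_mtopology[OF atlas_S]
proof (intro conjI; clarsimp simp: charts_S)
  fix U \<phi> assume s: "(U, \<phi>) \<in> slice_charts M C k"
  have "\<phi> ` (U \<inter> C \<inter> (G \<inter> C)) = \<phi> ` (U \<inter> G) \<inter> ES k"
    using slice_chart_image[OF s, of "U \<inter> G"] by (simp add: Int_ac)
  then show "openin (Euclidean_space k) (\<phi> ` (U \<inter> C \<inter> (G \<inter> C)))"
    using openin_Euclidean_space_restrict[OF openin_chart_image[OF atlas_M slice_chart_maximal[OF s] assms] k_le]
    by simp
qed

text \<open>Serves two ends: Hausdorffness and second countability pass to \<open>C\<close>, and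
  statements near a point of \<open>C\<close> may be made in \<open>M\<close>.\<close>

lemma mtopology_S: "mtopology S = subtopology (mtopology M) C"
proof -
  have "\<exists>G. openin (mtopology M) G \<and> W = G \<inter> C" if W: "openin (mtopology S) W" for W
  proof -
    \<comment> \<open>Inside one slice chart, \<open>H\<close> thickens \<open>W\<close> to the
      points whose projection to the slice lies in the image of \<open>W\<close>. The union of these
      open sets meets \<open>C\<close> exactly in \<open>W\<close>.\<close>
    define H where "H U \<phi> = {x \<in> U. \<phi> x \<in> {y \<in> \<phi> ` U. coord_proj k y \<in> \<phi> ` (U \<inter> C \<inter> W)}}"
      for U and \<phi> :: "'m \<Rightarrow> nat \<Rightarrow> real"
    have opH: "openin (mtopology M) (H U \<phi>)" if s: "(U, \<phi>) \<in> slice_charts M C k" for U \<phi>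
      unfolding H_def
      using openin_chart_vimage[OF atlas_M slice_chart_maximal[OF s] openin_coord_proj_vimage]
        openin_chart_image[OF atlas_S slice_chart_maximal_S[OF s] W]
        maximal_atlasD(4)[OF slice_chart_maximal[OF s]] by simp
    have HC: "x \<in> W \<longleftrightarrow> x \<in> H U \<phi>" if s: "(U, \<phi>) \<in> slice_charts M C k" "x \<in> U" "x \<in> C" for U \<phi> x
    proof -
      have "\<phi> x \<in> ES k" using slice_chart_image[OF s(1), of U] s by blast
      moreover have "\<phi> x \<in> \<phi> ` (U \<inter> C \<inter> W) \<longleftrightarrow> x \<in> W"
        using maximal_atlasD(3)[OF slice_chart_maximal[OF s(1)]] s by (auto simp: inj_on_def)
      ultimately show ?thesis
        using s by (simp add: H_def coord_proj_id)
    qed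
    have WC: "W \<subseteq> C" using W unfolding openin_mtopology[OF atlas_S] by simp
    have "openin (mtopology M) (\<Union>c\<in>slice_charts M C k. H (fst c) (snd c))"
      using opH by (intro openin_Union) auto
    moreover have "W = (\<Union>c\<in>slice_charts M C k. H (fst c) (snd c)) \<inter> C"
    proof (intro set_eqI iffI)
      fix x assume x: "x \<in> W"
      then have "x \<in> C" using WC by blast
      then obtain U \<phi> where "(U, \<phi>) \<in> slice_charts M C k" "x \<in> U" by (rule slice_chart_exists)
      with x \<open>x \<in> C\<close> show "x \<in> (\<Union>c\<in>slice_charts M C k. H (fst c) (snd c)) \<inter> C"
        using HC[of U \<phi> x] by force
    next
      fix x assume "x \<in> (\<Union>c\<in>slice_charts M C k. H (fst c) (snd c)) \<inter> C"
      then obtain U \<phi> where "(U, \<phi>) \<in> slice_charts M C k" "x \<in> H U \<phi>" "x \<in> C" by auto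
      moreover from this have "x \<in> U" by (simp add: H_def)
      ultimately show "x \<in> W" using HC by blast
    qed
    ultimately show ?thesis by blast
  qed
  then show ?thesis
    using openin_S_of_M by (auto simp: topology_eq openin_subtopology)
qed

lemma smooth_manifold_S: "smooth_manifold S"
  using M atlas_S
  by (simp add: smooth_manifold_def mtopology_S Hausdorff_space_subtopology second_countable_subtopology)

lemma eventually_nbhds_S:
  assumes "p \<in> C"
  shows "eventually P (nbhds S p) \<longleftrightarrow> eventually (\<lambda>x. x \<in> C \<longrightarrow> P x) (nbhds M p)"
proof -
  have p: "p \<in> points M" "p \<in> points S" using assms C_subset by auto
  show ?thesis
  proof
    assume "eventually P (nbhds S p)"
    then obtain W where W: "openin (mtopology S) W" "p \<in> W" "\<forall>x\<in>W. P x"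
      using eventually_nbhds[OF atlas_S p(2)] by blast
    then obtain G where "openin (mtopology M) G" "W = G \<inter> C"
      by (auto simp: mtopology_S openin_subtopology)
    with W have "openin (mtopology M) G" "p \<in> G \<inter> C" "\<forall>x\<in>G \<inter> C. P x"
      by auto
    then show "eventually (\<lambda>x. x \<in> C \<longrightarrow> P x) (nbhds M p)"
      unfolding eventually_nbhds[OF atlas_M p(1)] by (intro exI[of _ G]) auto
  next
    assume "eventually (\<lambda>x. x \<in> C \<longrightarrow> P x) (nbhds M p)"
    then obtain G where "openin (mtopology M) G" "p \<in> G" "\<forall>x\<in>G. x \<in> C \<longrightarrow> P x"
      unfolding eventually_nbhds[OF atlas_M p(1)] by auto
    then show "eventually P (nbhds S p)"
      unfolding eventually_nbhds[OF atlas_S p(2)] using assms openin_S_of_M[of G]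
      by (intro exI[of _ "G \<inter> C"]) auto
  qed
qed

lemma smooth_at_S_of_M:
  assumes "smooth_at M p f" "p \<in> C"
  shows "smooth_at S p f"
proof -
  obtain U \<phi> where s: "(U, \<phi>) \<in> slice_charts M C k" "p \<in> U"
    using slice_chart_exists[OF assms(2)] .
  obtain T where T: "openin (Euclidean_space (dimn M)) T" "\<phi> p \<in> T" "T \<subseteq> \<phi> ` U"
      "smooth_on (dimn M) T (f \<circ> inv_into U \<phi>)"
    using assms(1) smooth_at_iff_chart[OF atlas_M slice_chart_maximal[OF s(1)] s(2)] by blast
  have img: "\<phi> ` (U \<inter> C) = \<phi> ` U \<inter> ES k" using slice_chart_image[OF s(1), of U] by simp
  have op: "openin (Euclidean_space k) (T \<inter> ES k)"
    using openin_Euclidean_space_restrict[OF T(1) k_le] .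
  have "smooth_on k (T \<inter> ES k) (f \<circ> inv_into U \<phi>)"
    using smooth_on_restrict[OF T(4) k_le] by blast
  then have "smooth_on k (T \<inter> ES k) (f \<circ> inv_into (U \<inter> C) \<phi>)"
  proof (rule smooth_on_cong[OF _ op])
    fix x assume "x \<in> T \<inter> ES k"
    then have "x \<in> \<phi> ` (U \<inter> C)" using T(3) img by blast
    then show "(f \<circ> inv_into U \<phi>) x = (f \<circ> inv_into (U \<inter> C) \<phi>) x"
      using slice_inv_into[OF s(1)] by simp
  qed
  moreover have "\<phi> p \<in> T \<inter> ES k" "T \<inter> ES k \<subseteq> \<phi> ` (U \<inter> C)" "p \<in> U \<inter> C"
    using T(2,3) img s(2) assms(2) by blast+
  ultimately show ?thesis
    using smooth_at_iff_chart[OF atlas_S slice_chart_maximal_S[OF s(1)], of p f] op by auto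
qed

text \<open>In a slice chart the function is extended constantly along the fibres of
  \<open>coord_proj\<close>. Only the germ is extended, since \<open>C\<close> need not be closed in
  \<open>M\<close>.\<close>

lemma smooth_at_extension:
  assumes "smooth_at S p f"
  obtains f' where "smooth_at M p f'" "eventually (\<lambda>x. x \<in> C \<longrightarrow> f' x = f x) (nbhds M p)"
proof -
  have p: "p \<in> C" using smooth_at_point[OF atlas_S assms] by simp
  obtain U \<phi> where s: "(U, \<phi>) \<in> slice_charts M C k" "p \<in> U"
    using slice_chart_exists[OF p] .
  note c = slice_chart_maximal[OF s(1)]
  have img: "\<phi> ` (U \<inter> C) = \<phi> ` U \<inter> ES k" using slice_chart_image[OF s(1), of U] by simp
  obtain T where T: "openin (Euclidean_space k) T" "\<phi> p \<in> T" "T \<subseteq> \<phi> ` (U \<inter> C)"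
      "smooth_on k T (f \<circ> inv_into (U \<inter> C) \<phi>)"
    using assms smooth_at_iff_chart[OF atlas_S slice_chart_maximal_S[OF s(1)], of p f] s(2) p by auto
  define f' where "f' x = f (inv_into (U \<inter> C) \<phi> (coord_proj k (\<phi> x)))" for x
  define T' where "T' = {y \<in> \<phi> ` U. coord_proj k y \<in> T}"
  have op: "openin (Euclidean_space (dimn M)) T'"
    unfolding T'_def using openin_coord_proj_vimage[OF T(1) maximal_atlasD(4)[OF c]] .
  have "smooth_on (dimn M) T' (\<lambda>y. (f \<circ> inv_into (U \<inter> C) \<phi>) (coord_proj k y))"
  proof (rule smooth_on_compose[OF op T(1) _ _ T(4)])
    show "smooth_on (dimn M) T' (\<lambda>x. coord_proj k x j)" if "j < k" for j
      using that Ck_on_coord[OF op] by (simp add: coord_proj_def smooth_on_def)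
  qed (simp add: T'_def)
  then have "smooth_on (dimn M) T' (f' \<circ> inv_into U \<phi>)"
    by (rule smooth_on_cong[OF _ op]) (auto simp: f'_def T'_def f_inv_into_f)
  moreover have "\<phi> p \<in> ES k" using img s(2) p by blast
  then have pT': "\<phi> p \<in> T'"
    using T(2) s(2) by (simp add: T'_def coord_proj_id)
  ultimately have "smooth_at M p f'"
    unfolding smooth_at_iff_chart[OF atlas_M c s(2)] using op by (intro exI[of _ T']) (auto simp: T'_def)
  moreover have "eventually (\<lambda>x. x \<in> C \<longrightarrow> f' x = f x) (nbhds M p)"
  proof -
    have "f' x = f x" if "x \<in> U" "x \<in> C" for x
    proof -
      have "\<phi> x \<in> ES k" using img that by blast
      then show ?thesis
        using that maximal_atlasD(3)[OF c] inv_into_f_f[of \<phi> "U \<inter> C" x]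
        by (simp add: f'_def coord_proj_id inj_on_Int)
    qed
    then show ?thesis
      using eventually_nbhds_open[OF openin_maximal_chart[OF atlas_M c] s(2)] by (auto elim!: eventually_mono)
  qed
  ultimately show ?thesis using that by blast
qed

end

section \<open>Vector bundles\<close>

text \<open>Independence of indexed families, so that the Gram-Schmidt process can drop indices and
  alter members without separate bookkeeping for injectivity.\<close>

definition lin_indep_family :: "'i set \<Rightarrow> ('i \<Rightarrow> 'v::real_vector) \<Rightarrow> bool" where
  "lin_indep_family I b \<longleftrightarrow> (\<forall>c. (\<Sum>i\<in>I. c i *\<^sub>R b i) = 0 \<longrightarrow> (\<forall>i\<in>I. c i = 0))"

lemma lin_indep_family_iff:
  assumes "finite I"
  shows "lin_indep_family I b \<longleftrightarrow> inj_on b I \<and> independent (b ` I)"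
proof
  assume L: "lin_indep_family I b"
  have inj: "inj_on b I"
  proof (rule inj_onI, rule ccontr)
    fix i j assume ij: "i \<in> I" "j \<in> I" "b i = b j" "i \<noteq> j"
    define c where "c l = (if l = i then 1 else if l = j then -1 else 0 :: real)" for l
    have "(\<Sum>l\<in>I. c l *\<^sub>R b l) = (\<Sum>l\<in>{i, j}. c l *\<^sub>R b l)"
      by (rule sum.mono_neutral_right) (use ij assms in \<open>auto simp: c_def\<close>)
    also have "\<dots> = 0" using ij by (simp add: c_def)
    finally have "c i = 0" using L ij(1) unfolding lin_indep_family_def by blast
    then show False by (simp add: c_def)
  qed
  moreover have "independent (b ` I)"
  proof (rule independent_if_scalars_zero)
    fix f x assume f: "(\<Sum>x\<in>b ` I. f x *\<^sub>R x) = 0" and x: "x \<in> b ` I"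
    have "(\<Sum>i\<in>I. f (b i) *\<^sub>R b i) = 0"
      using f by (simp add: sum.reindex[OF inj])
    then have "\<forall>i\<in>I. f (b i) = 0"
      using L[unfolded lin_indep_family_def, rule_format, of "\<lambda>i. f (b i)"] by blast
    then show "f x = 0" using x by blast
  qed (use assms in simp)
  ultimately show "inj_on b I \<and> independent (b ` I)" ..
next
  assume L: "inj_on b I \<and> independent (b ` I)"
  show "lin_indep_family I b"
    unfolding lin_indep_family_def
  proof (intro allI impI ballI)
    fix c i assume c: "(\<Sum>i\<in>I. c i *\<^sub>R b i) = 0" and i: "i \<in> I"
    have "(\<Sum>x\<in>b ` I. c (inv_into I b x) *\<^sub>R x) = 0"
      using c L by (simp add: sum.reindex inv_into_f_f cong: sum.cong)
    then have "c (inv_into I b (b i)) = 0"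
      using independentD[of "b ` I" "b ` I" "\<lambda>x. c (inv_into I b x)" "b i"] L i assms by simp
    then show "c i = 0" using L i by simp
  qed
qed

lemma span_image_finite:
  assumes "finite I"
  shows "span (b ` I) = range (\<lambda>c. \<Sum>i\<in>I. c i *\<^sub>R b i)"
proof
  let ?L = "\<lambda>c. \<Sum>i\<in>I. c i *\<^sub>R b i"
  show "span (b ` I) \<subseteq> range ?L"
  proof (rule span_minimal)
    show "b ` I \<subseteq> range ?L"
    proof clarify
      fix i assume i: "i \<in> I"
      have "b i = ?L (\<lambda>j. if j = i then 1 else 0)"
        using i assms by (simp add: if_distrib[of "\<lambda>c. c *\<^sub>R _"] cong: if_cong)
      then show "b i \<in> range ?L" by (rule range_eqI[of _ ?L])
    qed
    show "subspace (range ?L)"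
    proof (rule subspaceI)
      have "0 = ?L (\<lambda>i. 0)" by simp
      then show "0 \<in> range ?L" by (rule range_eqI[of _ ?L])
    next
      fix x y assume "x \<in> range ?L" "y \<in> range ?L"
      then obtain c d where "x = ?L c" "y = ?L d" by blast
      then have "x + y = ?L (\<lambda>i. c i + d i)"
        by (simp add: scaleR_add_left sum.distrib)
      then show "x + y \<in> range ?L" by (rule range_eqI[of _ ?L])
    next
      fix a x assume "x \<in> range ?L"
      then obtain c where "x = ?L c" by blast
      then have "a *\<^sub>R x = ?L (\<lambda>i. a * c i)"
        by (simp add: scaleR_sum_right)
      then show "a *\<^sub>R x \<in> range ?L" by (rule range_eqI[of _ ?L])
    qed
  qed
next
  show "range (\<lambda>c. \<Sum>i\<in>I. c i *\<^sub>R b i) \<subseteq> span (b ` I)"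
    by (intro image_subsetI span_sum span_scale span_base imageI)
qed

lemma is_basis_lin_indep: "is_basis r b V \<Longrightarrow> lin_indep_family {..<r} b"
  by (simp add: is_basis_def lin_indep_family_iff)

lemma is_basis_obtain:
  assumes "is_basis r b V" "v \<in> V"
  obtains c where "v = (\<Sum>i<r. c i *\<^sub>R b i)"
  using assms span_image_finite[of "{..<r}" b] by (auto simp: is_basis_def)

lemma is_basis_comb: "is_basis r b V \<Longrightarrow> (\<Sum>i<r. c i *\<^sub>R b i) \<in> V"
  using span_image_finite[of "{..<r}" b] by (auto simp: is_basis_def)

lemma is_basis_unique:
  assumes "is_basis r b V" "(\<Sum>i<r. c i *\<^sub>R b i) = (\<Sum>i<r. d i *\<^sub>R b i)" "i < r"
  shows "c i = d i"
proof -
  have "(\<Sum>i<r. (c i - d i) *\<^sub>R b i) = 0"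
    using assms(2) by (simp add: scaleR_diff_left sum_subtractf)
  then show ?thesis
    using is_basis_lin_indep[OF assms(1), unfolded lin_indep_family_def, rule_format, of "\<lambda>i. c i - d i"] assms(3)
    by simp
qed

lemma is_basis_subspace: "is_basis r b V \<Longrightarrow> subspace V"
  by (auto simp: is_basis_def subspace_span)

lemma linear_on_space_sum:
  assumes "linear_on_space V f" "subspace V" "finite I" "\<And>i. i \<in> I \<Longrightarrow> v i \<in> V"
  shows "f (\<Sum>i\<in>I. c i *\<^sub>R v i) = (\<Sum>i\<in>I. c i *\<^sub>R f (v i))"
  using assms(3,4)
proof (induction I rule: finite_induct)
  case empty
  have "f (0 *\<^sub>R 0 + 0 *\<^sub>R 0) = 0 *\<^sub>R f 0 + 0 *\<^sub>R f 0"
    using assms(1) subspace_0[OF assms(2)] unfolding linear_on_space_def by blast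
  then show ?case by simp
next
  case (insert i I)
  have "(\<Sum>i\<in>I. c i *\<^sub>R v i) \<in> V"
    using insert by (intro subspace_sum[OF assms(2)] subspace_scale[OF assms(2)]) auto
  then have "f (c i *\<^sub>R v i + 1 *\<^sub>R (\<Sum>i\<in>I. c i *\<^sub>R v i)) = c i *\<^sub>R f (v i) + 1 *\<^sub>R f (\<Sum>i\<in>I. c i *\<^sub>R v i)"
    using assms(1) insert.prems unfolding linear_on_space_def by blast
  then show ?case using insert by simp
qed

section \<open>Germs of sections\<close>

definition section_at :: "'m manifold \<Rightarrow> ('m, 'v::real_vector, 'z) vbundle_scheme \<Rightarrow> 'm \<Rightarrow> ('m \<Rightarrow> 'v) \<Rightarrow> bool" where
  "section_at N F p s \<longleftrightarrow> (\<exists>W. openin (mtopology N) W \<and> p \<in> W \<and> smooth_section_on N F W s)"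

locale vbundle_over =
  fixes N :: "'m manifold" and F :: "('m, 'v::real_vector, 'z) vbundle_scheme"
  assumes N: "smooth_manifold N" and F: "vector_bundle N F"
begin

abbreviation r where "r \<equiv> fibre_dim F"

lemma atlas_N: "is_atlas N"
  using N by (simp add: smooth_manifold_def)

lemma frame_open: "(U, b) \<in> frames F \<Longrightarrow> openin (mtopology N) U"
  and frame_basis: "(U, b) \<in> frames F \<Longrightarrow> p \<in> U \<Longrightarrow> is_basis r (\<lambda>i. b i p) (fibre F p)"
  using F by (auto simp: vector_bundle_def)

lemma frame_exists:
  assumes "p \<in> points N"
  obtains U b where "(U, b) \<in> frames F" "p \<in> U"
proof -
  have "p \<in> \<Union>(fst ` frames F)" using F assms by (auto simp: vector_bundle_def)
  then show ?thesis using that by auto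
qed

lemma frame_change:
  assumes "(U, b) \<in> frames F" "(V, c) \<in> frames F"
  obtains g where "\<And>i j. i < r \<Longrightarrow> j < r \<Longrightarrow> smooth_fun_on N (U \<inter> V) (g i j)"
    "\<And>p j. p \<in> U \<inter> V \<Longrightarrow> j < r \<Longrightarrow> c j p = (\<Sum>i<r. g i j p *\<^sub>R b i p)"
proof -
  have *: "\<forall>(U, b)\<in>frames F. \<forall>(V, c)\<in>frames F. \<exists>g.
        (\<forall>i<r. \<forall>j<r. smooth_fun_on N (U \<inter> V) (g i j)) \<and>
        (\<forall>p\<in>U \<inter> V. \<forall>j<r. c j p = (\<Sum>i<r. g i j p *\<^sub>R b i p))"
    using F unfolding vector_bundle_def by (elim conjE)
  from bspec[OF * assms(1)]
  have "\<forall>(V, c)\<in>frames F. \<exists>g.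
        (\<forall>i<r. \<forall>j<r. smooth_fun_on N (U \<inter> V) (g i j)) \<and>
        (\<forall>p\<in>U \<inter> V. \<forall>j<r. c j p = (\<Sum>i<r. g i j p *\<^sub>R b i p))" by simp
  from bspec[OF this assms(2)] obtain g where
    "\<forall>i<r. \<forall>j<r. smooth_fun_on N (U \<inter> V) (g i j)"
    "\<forall>p\<in>U \<inter> V. \<forall>j<r. c j p = (\<Sum>i<r. g i j p *\<^sub>R b i p)" by auto
  then show ?thesis by (intro that[of g]) blast+
qed

lemma fibre_subspace: "p \<in> points N \<Longrightarrow> subspace (fibre F p)"
  by (erule frame_exists) (rule is_basis_subspace[OF frame_basis])

lemma section_at_point: "section_at N F p s \<Longrightarrow> p \<in> points N"
  unfolding section_at_def by (metis atlas_N openin_subset subsetD topspace_mtopology)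

text \<open>A smooth section is defined by its coefficients in all frames. As frame changes are
  smooth, one frame decides, and closure properties can be read off from coefficient germs.\<close>

lemma section_at_iff_frame:
  assumes b: "(U, b) \<in> frames F" "p \<in> U"
  shows "section_at N F p s \<longleftrightarrow> (\<exists>a. (\<forall>i<r. smooth_at N p (a i)) \<and>
     eventually (\<lambda>x. s x = (\<Sum>i<r. a i x *\<^sub>R b i x)) (nbhds N p))"
proof
  assume "section_at N F p s"
  then obtain W where W: "openin (mtopology N) W" "p \<in> W" "smooth_section_on N F W s"
    by (auto simp: section_at_def)
  then obtain a where a: "\<forall>i<r. smooth_fun_on N (U \<inter> W) (a i)" "\<forall>p\<in>U \<inter> W. s p = (\<Sum>i<r. a i p *\<^sub>R b i p)"
  proof -
    have "\<forall>(U, b)\<in>frames F. \<exists>a. (\<forall>i<r. smooth_fun_on N (U \<inter> W) (a i)) \<and>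
        (\<forall>p\<in>U \<inter> W. s p = (\<Sum>i<r. a i p *\<^sub>R b i p))"
      using W(3) unfolding smooth_section_on_def by simp
    from bspec[OF this b(1)] show thesis using that by auto
  qed
  have op: "openin (mtopology N) (U \<inter> W)" using W(1) frame_open[OF b(1)] by blast
  have "\<forall>i<r. smooth_at N p (a i)"
    using a(1) op b(2) W(2) unfolding smooth_at_def by blast
  moreover have "eventually (\<lambda>x. s x = (\<Sum>i<r. a i x *\<^sub>R b i x)) (nbhds N p)"
    using eventually_nbhds_open[OF op, of p] b(2) W(2) a(2) by (auto elim!: eventually_mono)
  ultimately show "\<exists>a. (\<forall>i<r. smooth_at N p (a i)) \<and>
     eventually (\<lambda>x. s x = (\<Sum>i<r. a i x *\<^sub>R b i x)) (nbhds N p)" by blast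
next
  assume "\<exists>a. (\<forall>i<r. smooth_at N p (a i)) \<and>
     eventually (\<lambda>x. s x = (\<Sum>i<r. a i x *\<^sub>R b i x)) (nbhds N p)"
  then obtain a where a: "\<forall>i<r. smooth_at N p (a i)" "eventually (\<lambda>x. s x = (\<Sum>i<r. a i x *\<^sub>R b i x)) (nbhds N p)"
    by blast
  have p: "p \<in> points N" using frame_open[OF b(1)] b(2) by (metis atlas_N openin_subset subsetD topspace_mtopology)
  have "eventually (\<lambda>x. \<forall>i\<in>{..<r}. smooth_at N x (a i)) (nbhds N p)"
    by (intro eventually_ball_finite ballI smooth_at_eventually[OF _ atlas_N]) (use a(1) in auto)
  then have "eventually (\<lambda>x. x \<in> U \<and> (\<forall>i<r. smooth_at N x (a i)) \<and> s x = (\<Sum>i<r. a i x *\<^sub>R b i x)) (nbhds N p)"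
    using a(2) eventually_nbhds_open[OF frame_open[OF b(1)] b(2)] by eventually_elim auto
  then obtain W where W: "openin (mtopology N) W" "p \<in> W"
    "\<And>x. x \<in> W \<Longrightarrow> x \<in> U \<and> (\<forall>i<r. smooth_at N x (a i)) \<and> s x = (\<Sum>i<r. a i x *\<^sub>R b i x)"
    unfolding eventually_nbhds[OF atlas_N p] by blast
  have "smooth_section_on N F W s"
    unfolding smooth_section_on_def
  proof (intro conjI ballI)
    show "s x \<in> fibre F x" if "x \<in> W" for x
      using W(3)[OF that] is_basis_comb[OF frame_basis[OF b(1)]] by auto
  next
    fix f assume f: "f \<in> frames F"
    obtain V c where fV: "f = (V, c)" by (cases f)
    obtain g where g: "\<And>i j. i < r \<Longrightarrow> j < r \<Longrightarrow> smooth_fun_on N (V \<inter> U) (g i j)"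
      "\<And>p j. p \<in> V \<inter> U \<Longrightarrow> j < r \<Longrightarrow> b j p = (\<Sum>i<r. g i j p *\<^sub>R c i p)"
      using frame_change[of V c U b] f b(1) fV by auto
    define h where "h i x = (\<Sum>j<r. a j x * g i j x)" for i x
    have opVU: "openin (mtopology N) (V \<inter> U)" and opVW: "openin (mtopology N) (V \<inter> W)"
      using W(1) frame_open[of V c] frame_open[OF b(1)] f fV by auto
    have "smooth_fun_on N (V \<inter> W) (h i)" if i: "i < r" for i
      unfolding smooth_fun_on_iff_smooth_at[OF atlas_N opVW]
    proof
      fix x assume x: "x \<in> V \<inter> W"
      then have xU: "x \<in> V \<inter> U" using W(3) by auto
      have xN: "x \<in> points N" using opVU xU by (metis atlas_N openin_subset subsetD topspace_mtopology)
      have "smooth_at N x (\<lambda>x. a j x * g i j x)" if "j < r" for j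
        using W(3)[of x] x that g(1)[OF i that] smooth_fun_on_iff_smooth_at[OF atlas_N opVU] xU
        by (intro smooth_at_mult[OF atlas_N]) auto
      then show "smooth_at N x (h i)"
        unfolding h_def by (intro smooth_at_sum[OF atlas_N xN]) auto
    qed
    moreover have "s x = (\<Sum>i<r. h i x *\<^sub>R c i x)" if x: "x \<in> V \<inter> W" for x
    proof -
      have xU: "x \<in> V \<inter> U" using W(3) x by auto
      have "s x = (\<Sum>j<r. a j x *\<^sub>R b j x)" using W(3) x by auto
      also have "\<dots> = (\<Sum>j<r. a j x *\<^sub>R (\<Sum>i<r. g i j x *\<^sub>R c i x))"
        using g(2)[OF xU] by simp
      also have "\<dots> = (\<Sum>j<r. \<Sum>i<r. (a j x * g i j x) *\<^sub>R c i x)"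
        by (simp add: scaleR_sum_right)
      also have "\<dots> = (\<Sum>i<r. \<Sum>j<r. (a j x * g i j x) *\<^sub>R c i x)"
        by (rule sum.swap)
      finally show ?thesis by (simp add: h_def scaleR_sum_left)
    qed
    ultimately show "case f of (U, b) \<Rightarrow> \<exists>a. (\<forall>i<r. smooth_fun_on N (U \<inter> W) (a i)) \<and>
        (\<forall>p\<in>U \<inter> W. s p = (\<Sum>i<r. a i p *\<^sub>R b i p))"
      using fV by auto
  qed
  then show "section_at N F p s"
    unfolding section_at_def using W(1,2) by blast
qed

lemma section_at_add:
  assumes "section_at N F p s" "section_at N F p t"
  shows "section_at N F p (\<lambda>x. s x + t x)"
proof -
  obtain U b where b: "(U, b) \<in> frames F" "p \<in> U"
    by (rule frame_exists[OF section_at_point[OF assms(1)]])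
  obtain a a' where a: "\<forall>i<r. smooth_at N p (a i)" "eventually (\<lambda>x. s x = (\<Sum>i<r. a i x *\<^sub>R b i x)) (nbhds N p)"
    and a': "\<forall>i<r. smooth_at N p (a' i)" "eventually (\<lambda>x. t x = (\<Sum>i<r. a' i x *\<^sub>R b i x)) (nbhds N p)"
    using assms[unfolded section_at_iff_frame[OF b]] by (elim exE conjE)
  have "eventually (\<lambda>x. s x + t x = (\<Sum>i<r. (a i x + a' i x) *\<^sub>R b i x)) (nbhds N p)"
    using a(2) a'(2) by eventually_elim (simp add: scaleR_add_left sum.distrib)
  then show ?thesis
    unfolding section_at_iff_frame[OF b] using smooth_at_add[OF atlas_N] a(1) a'(1)
    by (intro exI[of _ "\<lambda>i x. a i x + a' i x"]) auto
qed

lemma section_at_scale: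
  assumes "smooth_at N p f" "section_at N F p s"
  shows "section_at N F p (\<lambda>x. f x *\<^sub>R s x)"
proof -
  obtain U b where b: "(U, b) \<in> frames F" "p \<in> U"
    by (rule frame_exists[OF section_at_point[OF assms(2)]])
  obtain a where a: "\<forall>i<r. smooth_at N p (a i)" "eventually (\<lambda>x. s x = (\<Sum>i<r. a i x *\<^sub>R b i x)) (nbhds N p)"
    using assms(2)[unfolded section_at_iff_frame[OF b]] by (elim exE conjE)
  have "eventually (\<lambda>x. f x *\<^sub>R s x = (\<Sum>i<r. (f x * a i x) *\<^sub>R b i x)) (nbhds N p)"
    using a(2) by eventually_elim (simp add: scaleR_sum_right)
  then show ?thesis
    unfolding section_at_iff_frame[OF b] using smooth_at_mult[OF atlas_N assms(1)] a(1)
    by (intro exI[of _ "\<lambda>i x. f x * a i x"]) auto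
qed

lemma section_at_cong:
  assumes "section_at N F p s" "eventually (\<lambda>x. s x = t x) (nbhds N p)"
  shows "section_at N F p t"
proof -
  obtain U b where b: "(U, b) \<in> frames F" "p \<in> U"
    by (rule frame_exists[OF section_at_point[OF assms(1)]])
  obtain a where a: "\<forall>i<r. smooth_at N p (a i)" "eventually (\<lambda>x. s x = (\<Sum>i<r. a i x *\<^sub>R b i x)) (nbhds N p)"
    using assms(1)[unfolded section_at_iff_frame[OF b]] by (elim exE conjE)
  have "eventually (\<lambda>x. t x = (\<Sum>i<r. a i x *\<^sub>R b i x)) (nbhds N p)"
    using a(2) assms(2) by eventually_elim simp
  then show ?thesis
    unfolding section_at_iff_frame[OF b] using a(1) by blast
qed

lemma section_at_zero:
  assumes "p \<in> points N"
  shows "section_at N F p (\<lambda>x. 0)"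
proof -
  obtain U b where b: "(U, b) \<in> frames F" "p \<in> U"
    by (rule frame_exists[OF assms])
  show ?thesis
    unfolding section_at_iff_frame[OF b] using smooth_at_const[OF atlas_N assms, of 0]
    by (intro exI[of _ "\<lambda>i x. 0"]) auto
qed

lemma section_at_frame:
  assumes b: "(U, b) \<in> frames F" "p \<in> U" and i: "i < r"
  shows "section_at N F p (b i)"
proof -
  have p: "p \<in> points N" using frame_open[OF b(1)] b(2) by (metis atlas_N openin_subset subsetD topspace_mtopology)
  have "b i x = (\<Sum>j<r. (if j = i then 1 else 0) *\<^sub>R b j x)" for x
    using i by (simp add: if_distrib[of "\<lambda>c. c *\<^sub>R _"] cong: if_cong)
  then show ?thesis
    unfolding section_at_iff_frame[OF b] using smooth_at_const[OF atlas_N p]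
    by (intro exI[of _ "\<lambda>j x. if j = i then 1 else 0"]) auto
qed

lemma section_at_sum:
  assumes "p \<in> points N" "\<And>i. i \<in> I \<Longrightarrow> section_at N F p (s i)"
  shows "section_at N F p (\<lambda>x. \<Sum>i\<in>I. s i x)"
  using assms(2)
proof (induction I rule: infinite_finite_induct)
  case (insert i I)
  then show ?case
    using section_at_add[of p "s i" "\<lambda>x. \<Sum>i\<in>I. s i x"] by simp
qed (simp_all add: section_at_zero[OF assms(1)])

text \<open>Coefficients found near different points agree by uniqueness of coordinates, so they
  glue to smooth coefficient functions on the whole frame domain.\<close>

lemma sections_iff:
  "s \<in> sections N F \<longleftrightarrow> (\<forall>p\<in>points N. section_at N F p s) \<and> (\<forall>p. p \<notin> points N \<longrightarrow> s p = 0)"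
proof
  assume s: "s \<in> sections N F"
  have "openin (mtopology N) (points N)"
    by (metis atlas_N openin_topspace topspace_mtopology)
  then show "(\<forall>p\<in>points N. section_at N F p s) \<and> (\<forall>p. p \<notin> points N \<longrightarrow> s p = 0)"
    using s unfolding sections_def section_at_def by blast
next
  assume s: "(\<forall>p\<in>points N. section_at N F p s) \<and> (\<forall>p. p \<notin> points N \<longrightarrow> s p = 0)"
  have fib: "s p \<in> fibre F p" if "p \<in> points N" for p
  proof -
    have "section_at N F p s" using s that by blast
    then show ?thesis
      unfolding section_at_def smooth_section_on_def by blast
  qed
  have "\<exists>a. (\<forall>i<r. smooth_fun_on N (U \<inter> points N) (a i)) \<and> (\<forall>p\<in>U \<inter> points N. s p = (\<Sum>i<r. a i p *\<^sub>R b i p))"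
    if b: "(U, b) \<in> frames F" for U b
  proof -
    have UN: "U \<inter> points N = U"
      using openin_subset[OF frame_open[OF b]] topspace_mtopology[OF atlas_N] by auto
    have "\<exists>c. s p = (\<Sum>i<r. c i *\<^sub>R b i p)" if "p \<in> U" for p
      using is_basis_obtain[OF frame_basis[OF b that] fib] that UN by blast
    then obtain c where c: "\<And>p. p \<in> U \<Longrightarrow> s p = (\<Sum>i<r. c p i *\<^sub>R b i p)" by metis
    have "smooth_fun_on N U (\<lambda>p. c p i)" if i: "i < r" for i
      unfolding smooth_fun_on_iff_smooth_at[OF atlas_N frame_open[OF b]]
    proof
      fix p assume p: "p \<in> U"
      then have "section_at N F p s" using s UN by blast
      then obtain a where a: "\<forall>i<r. smooth_at N p (a i)" "eventually (\<lambda>x. s x = (\<Sum>i<r. a i x *\<^sub>R b i x)) (nbhds N p)"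
        unfolding section_at_iff_frame[OF b p] by (elim exE conjE)
      have "eventually (\<lambda>x. a i x = c x i) (nbhds N p)"
        using a(2) eventually_nbhds_open[OF frame_open[OF b] p]
      proof eventually_elim
        case (elim x)
        then show ?case
          using c[of x] by (intro is_basis_unique[OF frame_basis[OF b elim(2)] _ i]) simp
      qed
      then show "smooth_at N p (\<lambda>p. c p i)"
        by (rule smooth_at_cong[OF atlas_N a(1)[rule_format, OF i]])
    qed
    then show ?thesis
      unfolding UN using c by (intro exI[of _ "\<lambda>i p. c p i"]) blast
  qed
  then have "smooth_section_on N F (points N) s"
    unfolding smooth_section_on_def by (intro conjI ballI fib) (simp_all add: split_beta)
  then show "s \<in> sections N F"
    using s by (simp add: sections_def)
qed

lemma sections_fibre: "s \<in> sections N F \<Longrightarrow> p \<in> points N \<Longrightarrow> s p \<in> fibre F p"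
  by (simp add: sections_def smooth_section_on_def)

lemma section_at_fibre: "section_at N F p s \<Longrightarrow> s p \<in> fibre F p"
  unfolding section_at_def smooth_section_on_def by blast

text \<open>Extension by 0 is smooth because the cutoff is supported in a closed set inside
  \<open>W\<close>: a point outside \<open>W\<close> has a neighbourhood that misses
  \<open>D\<close>.\<close>

lemma cutoff_section:
  assumes W: "openin (mtopology N) W" "\<And>x. x \<in> W \<Longrightarrow> section_at N F x s"
    and D: "closedin (mtopology N) D" "D \<subseteq> W" "\<And>x. x \<notin> D \<Longrightarrow> \<rho> x = 0" and rho: "smooth_fun N \<rho>"
  shows "(\<lambda>x. if x \<in> W then \<rho> x *\<^sub>R s x else 0) \<in> sections N F"
  unfolding sections_iff
proof (intro conjI ballI allI impI)
  fix p assume p: "p \<in> points N"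
  show "section_at N F p (\<lambda>x. if x \<in> W then \<rho> x *\<^sub>R s x else 0)"
  proof (cases "p \<in> W")
    case True
    have "section_at N F p (\<lambda>x. \<rho> x *\<^sub>R s x)"
      using rho p smooth_fun_iff_smooth_at[OF atlas_N] W(2)[OF True] by (intro section_at_scale) auto
    then show ?thesis
      by (rule section_at_cong) (use eventually_nbhds_open[OF W(1) True] in \<open>auto elim!: eventually_mono\<close>)
  next
    case False
    have "openin (mtopology N) (points N - D)"
      using D(1) by (simp add: closedin_def topspace_mtopology[OF atlas_N])
    moreover have "p \<in> points N - D" using False D(2) p by blast
    ultimately have "eventually (\<lambda>x. x \<in> points N - D) (nbhds N p)"
      by (rule eventually_nbhds_open)
    then have "eventually (\<lambda>x. 0 = (if x \<in> W then \<rho> x *\<^sub>R s x else 0)) (nbhds N p)"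
      by eventually_elim (use D(3) in auto)
    then show ?thesis
      by (rule section_at_cong[OF section_at_zero[OF p]])
  qed
next
  fix p assume "p \<notin> points N"
  then show "(if p \<in> W then \<rho> p *\<^sub>R s p else 0) = 0"
    using openin_subset[OF W(1)] topspace_mtopology[OF atlas_N] by auto
qed

text \<open>The Courant bracket acts on global sections only, so local constructions have to be
  replaced by global sections with the same germ.\<close>

lemma section_at_globalize:
  assumes "section_at N F p s"
  obtains x where "x \<in> sections N F" "eventually (\<lambda>y. x y = s y) (nbhds N p)"
proof -
  obtain W where W: "openin (mtopology N) W" "p \<in> W" "smooth_section_on N F W s"
    using assms by (auto simp: section_at_def)
  have at: "section_at N F x s" if "x \<in> W" for x
    unfolding section_at_def using W(1,3) that by blast
  show ?thesis
  proof (rule bump_function_exists[OF N W(1,2)])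
    fix \<rho> D
    assume r: "smooth_fun N \<rho>" "eventually (\<lambda>x. \<rho> x = 1) (nbhds N p)"
      "closedin (mtopology N) D" "D \<subseteq> W" "\<And>x. x \<notin> D \<Longrightarrow> \<rho> x = 0"
    show thesis
    proof (rule that)
    show "(\<lambda>x. if x \<in> W then \<rho> x *\<^sub>R s x else 0) \<in> sections N F"
      by (rule cutoff_section[OF W(1) at r(3,4,5,1)])
    show "eventually (\<lambda>y. (if y \<in> W then \<rho> y *\<^sub>R s y else 0) = s y) (nbhds N p)"
      using r(2) eventually_nbhds_open[OF W(1,2)] by eventually_elim simp
    qed
  qed
qed

end

section \<open>Linear algebra in the fibres\<close>

lemma linear_on_space_diff:
  assumes "linear_on_space V f" "u \<in> V" "v \<in> V"
  shows "f (u - v) = f u - f v"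
  using assms(1)[unfolded linear_on_space_def, rule_format, OF assms(2,3), of 1 "-1"] by simp

lemma linear_on_space_add:
  assumes "linear_on_space V f" "u \<in> V" "v \<in> V"
  shows "f (u + v) = f u + f v"
  using assms(1)[unfolded linear_on_space_def, rule_format, OF assms(2,3), of 1 1] by simp

lemma linear_on_space_scale:
  assumes "linear_on_space V f" "u \<in> V"
  shows "f (a *\<^sub>R u) = a *\<^sub>R f u"
  using assms(1)[unfolded linear_on_space_def, rule_format, OF assms(2,2), of a 0] by simp

lemma linear_on_space_comb:
  assumes "linear_on_space V f" "subspace V" "x \<in> V" "y \<in> V" "z \<in> V"
  shows "f (x + a *\<^sub>R y + b *\<^sub>R z) = f x + a *\<^sub>R f y + b *\<^sub>R f z"
proof -
  have "f (1 *\<^sub>R (x + a *\<^sub>R y) + b *\<^sub>R z) = 1 *\<^sub>R f (x + a *\<^sub>R y) + b *\<^sub>R f z"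
    using assms(1)[unfolded linear_on_space_def, rule_format, of "x + a *\<^sub>R y" z 1 b]
      subspace_add[OF assms(2,3) subspace_scale[OF assms(2,4)]] assms(5) by blast
  moreover have "f (1 *\<^sub>R x + a *\<^sub>R y) = 1 *\<^sub>R f x + a *\<^sub>R f y"
    using assms(1)[unfolded linear_on_space_def, rule_format, OF assms(3,4)] .
  ultimately show ?thesis by simp
qed

lemma linear_on_space_comb_diff:
  assumes "linear_on_space V f" "subspace V" "x \<in> V" "y \<in> V" "z \<in> V"
  shows "f (x - a *\<^sub>R y + b *\<^sub>R z) = f x - a *\<^sub>R f y + b *\<^sub>R f z"
  using linear_on_space_comb[OF assms, of "- a" b] by simp

lemma linear_on_space_zero:
  assumes "linear_on_space V f" "subspace V"
  shows "f 0 = 0"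
  using linear_on_space_scale[OF assms(1) subspace_0[OF assms(2)], of 0] by simp

lemma linear_on_space_uminus:
  assumes "linear_on_space V f" "u \<in> V"
  shows "f (- u) = - f u"
  using linear_on_space_scale[OF assms, of "-1"] by simp

lemma subspace_kernel_on:
  assumes "linear_on_space V f" "subspace V"
  shows "subspace {v \<in> V. f v = 0}"
  using assms linear_on_space_zero[OF assms] linear_on_space_add[OF assms(1)] linear_on_space_scale[OF assms(1)]
  by (auto simp: subspace_def)

text \<open>The ambient type may be infinite-dimensional, so dimension is counted by exchange: a
  vector of \<open>V\<close> outside the span would give \<open>r + 1\<close> independent vectors in
  the span of \<open>r\<close>.\<close>

lemma lin_indep_spanning:
  fixes r :: nat
  assumes V: "V = span (b ` {..<r})" and c: "lin_indep_family {..<r} c" "\<And>i. i < r \<Longrightarrow> c i \<in> V"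
  shows "span (c ` {..<r}) = V"
proof
  have c': "inj_on c {..<r}" "independent (c ` {..<r})"
    using c(1) by (auto simp: lin_indep_family_iff)
  show "span (c ` {..<r}) \<subseteq> V"
    unfolding V by (rule span_minimal) (use c(2) V in auto)
  show "V \<subseteq> span (c ` {..<r})"
  proof
    fix v assume v: "v \<in> V"
    show "v \<in> span (c ` {..<r})"
    proof (rule ccontr)
      assume n: "v \<notin> span (c ` {..<r})"
      then have "independent (insert v (c ` {..<r}))"
        using c'(2) by (simp add: independent_insert)
      moreover have "insert v (c ` {..<r}) \<subseteq> span (b ` {..<r})"
        using v c(2) V by auto
      ultimately have "card (insert v (c ` {..<r})) \<le> card (b ` {..<r})"
        using independent_span_bound[of "b ` {..<r}"] by blast
      moreover have "v \<notin> c ` {..<r}" using n span_base[of v "c ` {..<r}"] by metis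
      ultimately have "Suc r \<le> card (b ` {..<r})"
        using card_image[OF c'(1)] by simp
      then show False
        using card_image_le[of "{..<r}" b] by simp
    qed
  qed
qed

text \<open>Used where the radical, whose dimension is constant, fills the whole span.\<close>

lemma subspace_eq_of_dim:
  assumes "subspace A" "A \<subseteq> span (k ` I)" "finite I" "dim A = card I"
  shows "A = span (k ` I)"
proof (rule ccontr)
  assume "A \<noteq> span (k ` I)"
  then obtain v where v: "v \<in> span (k ` I)" "v \<notin> A" using assms(2) by blast
  obtain X where X: "X \<subseteq> A" "independent X" "A \<subseteq> span X" "card X = dim A"
    using basis_exists by blast
  have "span X \<subseteq> A" using X(1) assms(1) by (simp add: span_minimal)
  then have "v \<notin> span X" using v(2) by blast
  then have "independent (insert v X)" "v \<notin> X"
    using X(2) by (auto simp: independent_insert span_base)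
  moreover have "insert v X \<subseteq> span (k ` I)" using v X(1) assms(2) by blast
  ultimately have "finite (insert v X)" "card (insert v X) \<le> card (k ` I)"
    using independent_span_bound[of "k ` I" "insert v X"] assms(3) by auto
  then show False
    using \<open>v \<notin> X\<close> X(4) assms(4) card_image_le[OF assms(3), of k] by simp
qed

lemma dim_span_lin_indep:
  assumes "finite I" "lin_indep_family I k"
  shows "dim (span (k ` I)) = card I"
  using assms dim_span_eq_card_independent[of "k ` I"] card_image[of k I]
  by (simp add: lin_indep_family_iff)

text \<open>The form may have any signature, so a subspace and its orthogonal need not be
  complementary; the tools here are representation of functionals and double orthogonals.\<close>

locale nondegenerate_form =
  fixes V :: "'v::real_vector set" and g :: "'v \<Rightarrow> 'v \<Rightarrow> real" and r :: nat and b :: "nat \<Rightarrow> 'v"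
  assumes basis: "is_basis r b V"
    and lin: "\<And>v. v \<in> V \<Longrightarrow> linear_on_space V (g v)"
    and sym: "\<And>v w. v \<in> V \<Longrightarrow> w \<in> V \<Longrightarrow> g v w = g w v"
    and nondeg: "\<And>v. v \<in> V \<Longrightarrow> (\<And>w. w \<in> V \<Longrightarrow> g v w = 0) \<Longrightarrow> v = 0"
begin

lemma subspace_V: "subspace V"
  by (rule is_basis_subspace[OF basis])

lemma basis_in: "i < r \<Longrightarrow> b i \<in> V"
  using basis span_base[of "b i" "b ` {..<r}"] by (auto simp: is_basis_def)

lemma lin_left: "w \<in> V \<Longrightarrow> linear_on_space V (\<lambda>v. g v w)"
  using lin[of w] sym subspace_V
  unfolding linear_on_space_def by (metis subspace_add subspace_scale)

lemma riesz_representation: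
  assumes xi: "linear_on_space V \<xi>"
  shows "\<exists>!w. w \<in> V \<and> (\<forall>v\<in>V. g w v = \<xi> v)"
proof (rule ex_ex1I)
  \<comment> \<open>The rows of the Gram matrix, written as vectors of \<open>V\<close>.
    Nondegeneracy makes them independent, hence spanning; this is invertibility of the matrix and
    yields existence for every functional.\<close>
  define c where "c i = (\<Sum>j<r. g (b i) (b j) *\<^sub>R b j)" for i
  have comb: "(\<Sum>i<r. x i *\<^sub>R c i) = (\<Sum>j<r. g (\<Sum>i<r. x i *\<^sub>R b i) (b j) *\<^sub>R b j)" for x
  proof -
    have "(\<Sum>i<r. x i *\<^sub>R c i) = (\<Sum>i<r. \<Sum>j<r. (x i * g (b i) (b j)) *\<^sub>R b j)"
      by (simp add: c_def scaleR_sum_right)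
    also have "\<dots> = (\<Sum>j<r. \<Sum>i<r. (x i * g (b i) (b j)) *\<^sub>R b j)" by (rule sum.swap)
    also have "\<dots> = (\<Sum>j<r. g (\<Sum>i<r. x i *\<^sub>R b i) (b j) *\<^sub>R b j)"
    proof (rule sum.cong[OF refl])
      fix j assume "j \<in> {..<r}"
      then have "g (\<Sum>i<r. x i *\<^sub>R b i) (b j) = (\<Sum>i<r. x i *\<^sub>R g (b i) (b j))"
        using basis_in by (intro linear_on_space_sum[OF lin_left subspace_V]) auto
      then show "(\<Sum>i<r. (x i * g (b i) (b j)) *\<^sub>R b j) = g (\<Sum>i<r. x i *\<^sub>R b i) (b j) *\<^sub>R b j"
        by (simp add: scaleR_sum_left)
    qed
    finally show ?thesis .
  qed
  have ext: "\<forall>v\<in>V. g w v = \<eta> v" if w: "w \<in> V" and eta: "linear_on_space V \<eta>" and eq: "\<And>j. j < r \<Longrightarrow> g w (b j) = \<eta> (b j)" for w \<eta>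
  proof
    fix v assume "v \<in> V"
    then obtain x where x: "v = (\<Sum>i<r. x i *\<^sub>R b i)" by (rule is_basis_obtain[OF basis])
    have "g w v = (\<Sum>i<r. x i *\<^sub>R g w (b i))"
      unfolding x using basis_in by (intro linear_on_space_sum[OF lin[OF w] subspace_V]) auto
    also have "\<dots> = (\<Sum>i<r. x i *\<^sub>R \<eta> (b i))" using eq by simp
    also have "\<dots> = \<eta> v"
      unfolding x using basis_in by (intro linear_on_space_sum[OF eta subspace_V, symmetric]) auto
    finally show "g w v = \<eta> v" .
  qed
  have zero: "linear_on_space V (\<lambda>v. 0 :: real)" by (simp add: linear_on_space_def)
  have "lin_indep_family {..<r} c"
    unfolding lin_indep_family_def
  proof (intro allI impI)
    fix x assume "(\<Sum>i<r. x i *\<^sub>R c i) = 0"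
    then have *: "(\<Sum>j<r. g (\<Sum>i<r. x i *\<^sub>R b i) (b j) *\<^sub>R b j) = (\<Sum>j<r. 0 *\<^sub>R b j)"
      unfolding comb by simp
    have "g (\<Sum>i<r. x i *\<^sub>R b i) (b j) = 0" if "j < r" for j
      using is_basis_unique[OF basis * that] .
    then have "\<forall>v\<in>V. g (\<Sum>i<r. x i *\<^sub>R b i) v = 0"
      by (intro ext[OF is_basis_comb[OF basis] zero])
    then have "(\<Sum>i<r. x i *\<^sub>R b i) = 0"
      using nondeg is_basis_comb[OF basis] by blast
    then show "\<forall>i\<in>{..<r}. x i = 0"
      using is_basis_lin_indep[OF basis] unfolding lin_indep_family_def by blast
  qed
  moreover have "V = span (b ` {..<r})" using basis by (simp add: is_basis_def)
  moreover have "c i \<in> V" for i unfolding c_def by (rule is_basis_comb[OF basis])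
  ultimately have "span (c ` {..<r}) = V" by (intro lin_indep_spanning)
  moreover have "(\<Sum>j<r. \<xi> (b j) *\<^sub>R b j) \<in> V" by (rule is_basis_comb[OF basis])
  ultimately obtain x where x: "(\<Sum>j<r. \<xi> (b j) *\<^sub>R b j) = (\<Sum>i<r. x i *\<^sub>R c i)"
    using span_image_finite[of "{..<r}" c] by auto
  then have eq: "(\<Sum>j<r. g (\<Sum>i<r. x i *\<^sub>R b i) (b j) *\<^sub>R b j) = (\<Sum>j<r. \<xi> (b j) *\<^sub>R b j)"
    unfolding comb by simp
  have "\<forall>v\<in>V. g (\<Sum>i<r. x i *\<^sub>R b i) v = \<xi> v"
    by (rule ext[OF is_basis_comb[OF basis] xi is_basis_unique[OF basis eq]])
  then show "\<exists>w. w \<in> V \<and> (\<forall>v\<in>V. g w v = \<xi> v)"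
    using is_basis_comb[OF basis] by blast
next
  fix w w' assume *: "w \<in> V \<and> (\<forall>v\<in>V. g w v = \<xi> v)" "w' \<in> V \<and> (\<forall>v\<in>V. g w' v = \<xi> v)"
  have "w - w' = 0"
  proof (rule nondeg)
    show "w - w' \<in> V" using * subspace_V by (simp add: subspace_diff)
    show "g (w - w') v = 0" if "v \<in> V" for v
      using linear_on_space_diff[OF lin_left[OF that], of w w'] * that by simp
  qed
  then show "w = w'" by simp
qed

text \<open>If \<open>v\<close> were outside \<open>W\<close>, a functional vanishing on
  \<open>W\<close> with value 1 at \<open>v\<close> would be represented by a vector orthogonal to
  \<open>W\<close> but not to \<open>v\<close>.\<close>

lemma orthogonal_orthogonal:
  assumes W: "subspace W" "W \<subseteq> V" and v: "v \<in> V"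
    and perp: "\<And>u. u \<in> V \<Longrightarrow> (\<And>w. w \<in> W \<Longrightarrow> g u w = 0) \<Longrightarrow> g u v = 0"
  shows "v \<in> W"
proof (rule ccontr)
  assume "v \<notin> W"
  obtain X where X: "X \<subseteq> W" "independent X" "W \<subseteq> span X" "card X = dim W"
    using basis_exists by blast
  have sX: "span X = W" using X W(1) by (simp add: span_minimal subset_antisym)
  then have "independent (insert v X)" "v \<notin> X"
    using X(1,2) \<open>v \<notin> W\<close> by (auto simp: independent_insert)
  then obtain \<xi> where xi: "linear \<xi>" "\<forall>x\<in>insert v X. \<xi> x = (if x = v then 1 else 0 :: real)"
    using linear_independent_extend[of "insert v X" "\<lambda>x. if x = v then 1 else 0 :: real"] by blast
  have "linear_on_space V \<xi>"
    using linear_add[OF xi(1)] linear_cmul[OF xi(1)] by (simp add: linear_on_space_def)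
  then obtain u where u: "u \<in> V" "\<forall>v\<in>V. g u v = \<xi> v"
    using riesz_representation by blast
  have xi0: "\<xi> w = 0" if "w \<in> W" for w
  proof (rule linear_eq_0_on_span[OF xi(1)])
    show "\<xi> x = 0" if "x \<in> X" for x
      using xi(2) \<open>v \<notin> X\<close> that by (metis insertI2)
    show "w \<in> span X" using that sX by simp
  qed
  then have "g u v = 0"
  proof (intro perp[OF u(1)])
    show "g u w = 0" if "w \<in> W" for w
      using xi0[OF that] u(2) W(2) that by auto
  qed
  then show False using u(2) v xi(2) by simp
qed

text \<open>The orthogonal of \<open>J K \<inter> K\<^sup>\<bottom> \<subseteq> K\<close> is \<open>J K\<^sup>\<bottom> + K\<close>.\<close>

lemma orthogonal_subset_sum:
  assumes J: "linear_on_space V J" "J ` V \<subseteq> V" "\<And>v w. v \<in> V \<Longrightarrow> w \<in> V \<Longrightarrow> g (J v) (J w) = g v w"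
      "\<And>v. v \<in> V \<Longrightarrow> J (J v) = - v"
    and K: "subspace K" "K \<subseteq> V"
    and P_def: "P = {v \<in> V. \<forall>w\<in>K. g v w = 0}" and JK: "J ` K \<inter> P \<subseteq> K"
    and e: "e \<in> P"
  shows "\<exists>k\<in>K. e + k \<in> J ` P"
proof -
  have subP: "subspace P"
  proof -
    have "P = V \<inter> (\<Inter>w\<in>K. {v \<in> V. g v w = 0})" by (auto simp: P_def)
    then show ?thesis
      using subspace_kernel_on[OF lin_left subspace_V] K(2)
      by (auto intro!: subspace_inter[OF subspace_V] subspace_Int)
  qed
  have PV: "P \<subseteq> V" by (auto simp: P_def)
  have JV: "J v \<in> V" if "v \<in> V" for v using J(2) that by blast
  have subJP: "subspace (J ` P)"
  proof (rule subspaceI)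
    show "0 \<in> J ` P"
      using linear_on_space_zero[OF J(1) subspace_V] subspace_0[OF subP] by (metis imageI)
    show "x + y \<in> J ` P" if xy: "x \<in> J ` P" "y \<in> J ` P" for x y
    proof -
      obtain u v where "x = J u" "y = J v" "u \<in> P" "v \<in> P" using xy by blast
      then show ?thesis
        using linear_on_space_add[OF J(1), of u v] PV subspace_add[OF subP, of u v] by (metis imageI subsetD)
    qed
    show "a *\<^sub>R x \<in> J ` P" if x: "x \<in> J ` P" for a x
    proof -
      obtain u where "x = J u" "u \<in> P" using x by blast
      then show ?thesis
        using linear_on_space_scale[OF J(1), of u a] PV subspace_scale[OF subP, of u a] by (metis imageI subsetD)
    qed
  qed
  define W where "W = {x + y | x y. x \<in> J ` P \<and> y \<in> K}"
  have "e \<in> W"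
  proof (rule orthogonal_orthogonal)
    show "subspace W" unfolding W_def by (rule subspace_sums[OF subJP K(1)])
    show "W \<subseteq> V"
    proof
      fix z assume "z \<in> W"
      then obtain x y where "z = J x + y" "x \<in> P" "y \<in> K" by (auto simp: W_def)
      then show "z \<in> V"
        using K(2) PV JV[of x] subspace_add[OF subspace_V, of "J x" y] by blast
    qed
    show "e \<in> V" using e PV by blast
    fix u assume u: "u \<in> V" and perp: "\<And>w. w \<in> W \<Longrightarrow> g u w = 0"
    have uP: "u \<in> P"
    proof -
      have "g u w = 0" if "w \<in> K" for w
      proof (rule perp)
        have "0 + w \<in> W" unfolding W_def using subspace_0[OF subJP] that by blast
        then show "w \<in> W" by simp
      qed
      then show ?thesis using u by (simp add: P_def)
    qed
    \<comment> \<open>Moving \<open>J\<close> across the form turns orthogonality of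
      \<open>u\<close> to \<open>J P\<close> into orthogonality of \<open>J u\<close> to
      \<open>P\<close>, so \<open>J u\<close> lies in the double orthogonal of \<open>K\<close>.
      Then \<open>u = J (- J u)\<close> lies in \<open>J K \<inter> P\<close>, where the hypothesis
      \<open>JK\<close> applies.\<close>
    have "J u \<in> K"
    proof (rule orthogonal_orthogonal[OF K JV[OF u]])
      fix x assume x: "x \<in> V" "\<And>w. w \<in> K \<Longrightarrow> g x w = 0"
      then have "J x \<in> J ` P" by (simp add: P_def)
      then have "J x + 0 \<in> W" unfolding W_def using subspace_0[OF K(1)] by blast
      then have "g u (J x) = 0" using perp by simp
      moreover have "g (J u) (J (J x)) = g u (J x)" using J(3)[OF u JV[OF x(1)]] .
      ultimately have "g (J u) (- x) = 0" using J(4)[OF x(1)] by simp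
      then have "g (J u) x = 0"
        using linear_on_space_uminus[OF lin[OF JV[OF u]] x(1)] by simp
      then show "g x (J u) = 0" using sym[OF x(1) JV[OF u]] by simp
    qed
    then have "- J u \<in> K" by (rule subspace_neg[OF K(1)])
    moreover have "J (- J u) = u"
      using linear_on_space_uminus[OF J(1) JV[OF u]] J(4)[OF u] by simp
    ultimately have "u \<in> J ` K" by (metis imageI)
    then have "u \<in> K" using JK uP by blast
    then have "g e u = 0" using e by (simp add: P_def)
    then show "g u e = 0" using sym[OF u] e PV by auto
  qed
  then obtain x y where "e = x + y" "x \<in> J ` P" "y \<in> K" by (auto simp: W_def)
  then show ?thesis
    using subspace_neg[OF K(1)] by (intro bexI[of _ "- y"]) auto
qed

end

text \<open>One step of the symplectic Gram--Schmidt process: the complement of a hyperbolic plane has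
  the same radical.\<close>

lemma linear_on_space_swap_skew:
  assumes "subspace U" and lin: "linear_on_space U (\<omega> x)" and x: "x \<in> U"
    and skew: "\<And>v w. v \<in> U \<Longrightarrow> w \<in> U \<Longrightarrow> \<omega> v w = - (\<omega> w v :: real)"
  shows "linear_on_space U (\<lambda>v. \<omega> v x)"
  unfolding linear_on_space_def
proof (intro ballI allI)
  fix v w a b assume vw: "v \<in> U" "w \<in> U"
  have "\<omega> (a *\<^sub>R v + b *\<^sub>R w) x = - \<omega> x (a *\<^sub>R v + b *\<^sub>R w)"
    by (intro skew x subspace_add subspace_scale assms vw)
  also have "\<omega> x (a *\<^sub>R v + b *\<^sub>R w) = a *\<^sub>R \<omega> x v + b *\<^sub>R \<omega> x w"
    using lin[unfolded linear_on_space_def, rule_format, OF vw] .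
  also have "\<omega> x v = - \<omega> v x" by (rule skew[OF x vw(1)])
  also have "\<omega> x w = - \<omega> w x" by (rule skew[OF x vw(2)])
  finally show "\<omega> (a *\<^sub>R v + b *\<^sub>R w) x = a *\<^sub>R \<omega> v x + b *\<^sub>R \<omega> w x" by simp
qed

locale symplectic_step =
  fixes U :: "'v::real_vector set" and \<omega> :: "'v \<Rightarrow> 'v \<Rightarrow> real" and \<alpha> :: "'v \<Rightarrow> real"
    and I :: "'i set" and k :: "'i \<Rightarrow> 'v" and i j :: 'i
  assumes U: "subspace U" and lin: "\<And>v. v \<in> U \<Longrightarrow> linear_on_space U (\<omega> v)"
    and skew: "\<And>v w. v \<in> U \<Longrightarrow> w \<in> U \<Longrightarrow> \<omega> v w = - \<omega> w v"
    and alpha: "linear_on_space U \<alpha>"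
    and I: "finite I" "i \<in> I" "j \<in> I" and kU: "\<And>l. l \<in> I \<Longrightarrow> k l \<in> U"
    and nz: "\<omega> (k i) (k j) \<noteq> 0"
begin

abbreviation w where "w \<equiv> \<omega> (k i) (k j)"

text \<open>The \<open>\<omega>\<close>-orthogonal projection of \<open>k l\<close> along the
  hyperbolic plane of \<open>k i\<close> and \<open>k j\<close>. The opposite signs come from
  \<open>\<omega> (k j) (k i) = - w\<close>.\<close>

definition k' where "k' l = k l - (\<omega> (k l) (k j) / w) *\<^sub>R k i + (\<omega> (k l) (k i) / w) *\<^sub>R k j"

abbreviation I' where "I' \<equiv> I - {i, j}"
abbreviation V where "V \<equiv> span (k ` I)"
abbreviation V' where "V' \<equiv> span (k' ` I')"

lemma self: "v \<in> U \<Longrightarrow> \<omega> v v = 0"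
  using skew[of v v] by linarith

lemma ij: "i \<noteq> j"
  using nz self[OF kU[OF I(2)]] by auto

lemma left: "x \<in> U \<Longrightarrow> linear_on_space U (\<lambda>v. \<omega> v x)"
  by (rule linear_on_space_swap_skew[OF U lin _ skew])

lemma VU: "V \<subseteq> U"
  by (rule span_minimal[OF _ U]) (use kU in auto)

lemma k'U: "l \<in> I \<Longrightarrow> k' l \<in> U"
  unfolding k'_def using kU I(2,3) U by (intro subspace_add subspace_diff subspace_scale) auto

lemma k'V: "l \<in> I \<Longrightarrow> k' l \<in> V"
  unfolding k'_def using I(2,3) by (intro span_add span_diff span_scale span_base) auto

lemma V'V: "V' \<subseteq> V"
  by (rule span_minimal) (use k'V in auto)

lemma kiV: "k i \<in> V" and kjV: "k j \<in> V"
  using I(2,3) by (auto intro: span_base)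

lemma ki: "k i \<in> U" and kj: "k j \<in> U"
  using kU I by auto

lemma omega_k'_ki: "l \<in> I \<Longrightarrow> \<omega> (k' l) (k i) = 0"
proof -
  assume l: "l \<in> I"
  have "\<omega> (k' l) (k i) = \<omega> (k l) (k i) - (\<omega> (k l) (k j) / w) * \<omega> (k i) (k i) + (\<omega> (k l) (k i) / w) * \<omega> (k j) (k i)"
    unfolding k'_def using linear_on_space_comb_diff[OF left[OF ki] U kU[OF l] ki kj] by simp
  also have "\<dots> = 0" using self[OF ki] skew[OF kj ki] nz by simp
  finally show ?thesis .
qed

lemma omega_k'_kj: "l \<in> I \<Longrightarrow> \<omega> (k' l) (k j) = 0"
proof -
  assume l: "l \<in> I"
  have "\<omega> (k' l) (k j) = \<omega> (k l) (k j) - (\<omega> (k l) (k j) / w) * \<omega> (k i) (k j) + (\<omega> (k l) (k i) / w) * \<omega> (k j) (k j)"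
    unfolding k'_def using linear_on_space_comb_diff[OF left[OF kj] U kU[OF l] ki kj] by simp
  also have "\<dots> = 0" using self[OF kj] nz by simp
  finally show ?thesis .
qed

lemma omega_V'_plane:
  assumes "v \<in> V'"
  shows "\<omega> v (k i) = 0" "\<omega> v (k j) = 0"
proof -
  have "V' \<subseteq> {v \<in> U. \<omega> v (k i) = 0}"
    by (rule span_minimal[OF _ subspace_kernel_on[OF left[OF ki] U]]) (use k'U omega_k'_ki in auto)
  then show "\<omega> v (k i) = 0" using assms by blast
  have "V' \<subseteq> {v \<in> U. \<omega> v (k j) = 0}"
    by (rule span_minimal[OF _ subspace_kernel_on[OF left[OF kj] U]]) (use k'U omega_k'_kj in auto)
  then show "\<omega> v (k j) = 0" using assms by blast
qed

lemma decompose: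
  assumes "v \<in> V"
  obtains v' a b where "v' \<in> V'" "v = v' + a *\<^sub>R k i + b *\<^sub>R k j"
proof -
  have "k l \<in> span (insert (k i) (insert (k j) (k' ` I')))" if l: "l \<in> I" for l
  proof (cases "l = i \<or> l = j")
    case True
    then show ?thesis by (auto intro: span_base)
  next
    case False
    have "k l = k' l + (\<omega> (k l) (k j) / w) *\<^sub>R k i - (\<omega> (k l) (k i) / w) *\<^sub>R k j"
      by (simp add: k'_def)
    also have "\<dots> \<in> span (insert (k i) (insert (k j) (k' ` I')))"
      using False l by (intro span_add span_diff span_scale span_base) auto
    finally show ?thesis .
  qed
  then have "V \<subseteq> span (insert (k i) (insert (k j) (k' ` I')))"
    by (intro span_minimal) auto
  then obtain a b where "v - a *\<^sub>R k i - b *\<^sub>R k j \<in> V'"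
    using assms by (auto simp: span_insert)
  then show ?thesis using that[of "v - a *\<^sub>R k i - b *\<^sub>R k j" a b] by simp
qed

lemma omega_decomposed:
  assumes "v' \<in> V'" "x \<in> U"
  shows "\<omega> (v' + a *\<^sub>R k i + b *\<^sub>R k j) x = \<omega> v' x + a * \<omega> (k i) x + b * \<omega> (k j) x"
proof -
  have v: "v' \<in> U" using assms(1) V'V VU by blast
  show ?thesis
    using linear_on_space_comb[OF left[OF assms(2)] U v ki kj] by simp
qed

lemma omega_V'_right:
  assumes "v \<in> V'"
  shows "\<omega> (k i) v = 0" "\<omega> (k j) v = 0"
proof -
  have v: "v \<in> U" using assms V'V VU by blast
  show "\<omega> (k i) v = 0" "\<omega> (k j) v = 0"
    using omega_V'_plane[OF assms] skew[OF ki v] skew[OF kj v] by simp_all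
qed

text \<open>Pairing a radical vector with \<open>k j\<close> and \<open>k i\<close> reads off its
  plane coefficients, which must vanish; conversely members of \<open>V'\<close> annihilate the
  plane anyway. Hence constant rank is inherited by the smaller family.\<close>

lemma radical_eq: "{v \<in> V'. \<forall>u\<in>V'. \<omega> v u = 0} = {v \<in> V. \<forall>u\<in>V. \<omega> v u = 0}"
proof (intro set_eqI iffI)
  fix v assume v: "v \<in> {v \<in> V'. \<forall>u\<in>V'. \<omega> v u = 0}"
  have "\<omega> v u = 0" if u: "u \<in> V" for u
  proof -
    obtain u' a b where u': "u' \<in> V'" "u = u' + a *\<^sub>R k i + b *\<^sub>R k j" using decompose[OF u] .
    have vU: "v \<in> U" using v V'V VU by blast
    have "\<omega> u v = \<omega> u' v"
      unfolding u'(2) using omega_decomposed[OF u'(1) vU, of a b] omega_V'_right[of v] v by simp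
    moreover have "\<omega> u' v = - \<omega> v u'" using skew u'(1) V'V VU vU by blast
    ultimately have "\<omega> u v = 0" using v u'(1) by simp
    moreover have "\<omega> v u = - \<omega> u v" using skew[OF vU] u VU by blast
    ultimately show ?thesis by simp
  qed
  then show "v \<in> {v \<in> V. \<forall>u\<in>V. \<omega> v u = 0}" using v V'V by blast
next
  fix v assume v: "v \<in> {v \<in> V. \<forall>u\<in>V. \<omega> v u = 0}"
  then obtain v' a b where v': "v' \<in> V'" "v = v' + a *\<^sub>R k i + b *\<^sub>R k j" using decompose by blast
  have "\<omega> v (k j) = a * w"
    unfolding v'(2) using omega_decomposed[OF v'(1) kj, of a b] omega_V'_plane[OF v'(1)] self[OF kj] by simp
  then have a: "a = 0" using v kjV nz by simp
  have "\<omega> v (k i) = - b * w"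
    unfolding v'(2) using omega_decomposed[OF v'(1) ki, of a b] omega_V'_plane[OF v'(1)] self[OF ki] skew[OF kj ki] by simp
  then have "b = 0" using v kiV nz by simp
  then have "v \<in> V'" using v' a by simp
  then show "v \<in> {v \<in> V'. \<forall>u\<in>V'. \<omega> v u = 0}" using v V'V by blast
qed

lemma solvable:
  assumes "\<exists>v\<in>V. \<forall>u\<in>V. \<omega> v u = \<alpha> u"
  shows "\<exists>v\<in>V'. \<forall>u\<in>V'. \<omega> v u = \<alpha> u"
proof -
  obtain v where v: "v \<in> V" "\<forall>u\<in>V. \<omega> v u = \<alpha> u" using assms by blast
  obtain v' a b where v': "v' \<in> V'" "v = v' + a *\<^sub>R k i + b *\<^sub>R k j" using decompose[OF v(1)] .
  have "\<omega> v' u = \<alpha> u" if u: "u \<in> V'" for u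
  proof -
    have "u \<in> V" "u \<in> U" using u V'V VU by blast+
    then show ?thesis
      using omega_decomposed[OF v'(1), of u a b] omega_V'_right[OF u] v(2) v'(2) by simp
  qed
  then show ?thesis using v'(1) by blast
qed

text \<open>The two coefficients are forced: \<open>V'\<close> is orthogonal to the plane, so
  pairing \<open>y\<close> with \<open>k j\<close> and \<open>k i\<close> determines them one at a
  time, and they do not disturb the equation on \<open>V'\<close>.\<close>

lemma solution:
  assumes x: "x \<in> V'" "\<forall>u\<in>V'. \<omega> x u = \<alpha> u" and y: "y = x + (\<alpha> (k j) / w) *\<^sub>R k i + (- \<alpha> (k i) / w) *\<^sub>R k j"
  shows "y \<in> V" "\<forall>u\<in>V. \<omega> y u = \<alpha> u"
proof -
  show "y \<in> V"
    unfolding y using x(1) V'V kiV kjV by (intro span_add span_scale) auto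
  show "\<forall>u\<in>V. \<omega> y u = \<alpha> u"
  proof
    fix u assume u: "u \<in> V"
    then obtain u' a b where u': "u' \<in> V'" "u = u' + a *\<^sub>R k i + b *\<^sub>R k j" using decompose by blast
    have u'U: "u' \<in> U" using u'(1) V'V VU by blast
    have yU: "y \<in> U" using \<open>y \<in> V\<close> VU by blast
    have 1: "\<omega> y u' = \<alpha> u'"
      unfolding y using omega_decomposed[OF x(1) u'U, of "\<alpha> (k j) / w" "- \<alpha> (k i) / w"] omega_V'_right[OF u'(1)] x(2) u'(1)
      by simp
    have 2: "\<omega> y (k i) = \<alpha> (k i)"
      unfolding y using omega_decomposed[OF x(1) ki, of "\<alpha> (k j) / w" "- \<alpha> (k i) / w"] omega_V'_plane[OF x(1)] self[OF ki]
        skew[OF kj ki] nz by simp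
    have 3: "\<omega> y (k j) = \<alpha> (k j)"
      unfolding y using omega_decomposed[OF x(1) kj, of "\<alpha> (k j) / w" "- \<alpha> (k i) / w"] omega_V'_plane[OF x(1)] self[OF kj] nz
      by simp
    have "\<omega> y u = \<omega> y u' + a * \<omega> y (k i) + b * \<omega> y (k j)"
      unfolding u'(2) using linear_on_space_comb[OF lin[OF yU] U u'U ki kj] by simp
    also have "\<dots> = \<alpha> u"
      unfolding u'(2) 1 2 3 using linear_on_space_comb[OF alpha U u'U ki kj] by simp
    finally show "\<omega> y u = \<alpha> u" .
  qed
qed

lemma lin_indep_k':
  assumes "lin_indep_family I k"
  shows "lin_indep_family I' k'"
  unfolding lin_indep_family_def
proof (intro allI impI)
  fix c assume c: "(\<Sum>l\<in>I'. c l *\<^sub>R k' l) = 0"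
  \<comment> \<open>\<open>A\<close> and \<open>B\<close> collect what a relation among the
    \<open>k' l\<close> contributes to \<open>k i\<close> and \<open>k j\<close>, turning it into a
    relation among the original vectors.\<close>
  define A where "A = - (\<Sum>l\<in>I'. c l * (\<omega> (k l) (k j) / w))"
  define B where "B = (\<Sum>l\<in>I'. c l * (\<omega> (k l) (k i) / w))"
  define c' where "c' l = (if l = i then A else if l = j then B else c l)" for l
  have Ieq: "I = insert i (insert j I')" using I by blast
  have "(\<Sum>l\<in>I. c' l *\<^sub>R k l) = A *\<^sub>R k i + (B *\<^sub>R k j + (\<Sum>l\<in>I'. c' l *\<^sub>R k l))"
    by (subst Ieq) (use I ij in \<open>simp add: c'_def\<close>)
  also have "(\<Sum>l\<in>I'. c' l *\<^sub>R k l) = (\<Sum>l\<in>I'. c l *\<^sub>R k l)"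
    by (rule sum.cong) (auto simp: c'_def)
  also have "A *\<^sub>R k i + (B *\<^sub>R k j + (\<Sum>l\<in>I'. c l *\<^sub>R k l)) = (\<Sum>l\<in>I'. c l *\<^sub>R k' l)"
    by (simp add: k'_def A_def B_def scaleR_add_right scaleR_diff_right sum.distrib sum_subtractf scaleR_sum_left)
  finally have "(\<Sum>l\<in>I. c' l *\<^sub>R k l) = 0" using c by simp
  then have "\<forall>l\<in>I. c' l = 0" using assms unfolding lin_indep_family_def by blast
  then show "\<forall>l\<in>I'. c l = 0" by (auto simp: c'_def split: if_splits)
qed

end

section \<open>Skew linear systems of constant rank, solved smoothly\<close>

context vbundle_over
begin

text \<open>As the rank is constant, the reduction stops exactly when the form vanishes identically near \<open>p\<close>.\<close>

lemma smooth_linear_solution: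
  fixes k :: "'i \<Rightarrow> 'm \<Rightarrow> 'v"
  assumes p: "p \<in> points N" and I: "finite I"
    and k: "\<And>i. i \<in> I \<Longrightarrow> section_at N F p (k i)"
    and smooth: "\<And>i j. i \<in> I \<Longrightarrow> j \<in> I \<Longrightarrow> smooth_at N p (\<lambda>x. \<omega> x (k i x) (k j x))"
      "\<And>i. i \<in> I \<Longrightarrow> smooth_at N p (\<lambda>x. \<alpha> x (k i x))"
    and pointwise: "eventually (\<lambda>x. subspace (U x) \<and> (\<forall>v\<in>U x. linear_on_space (U x) (\<omega> x v)) \<and>
      (\<forall>v\<in>U x. \<forall>w\<in>U x. \<omega> x v w = - \<omega> x w v) \<and> linear_on_space (U x) (\<alpha> x) \<and>
      (\<forall>i\<in>I. k i x \<in> U x) \<and> lin_indep_family I (\<lambda>i. k i x) \<and>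
      dim {v \<in> span ((\<lambda>i. k i x) ` I). \<forall>w\<in>span ((\<lambda>i. k i x) ` I). \<omega> x v w = 0} = d \<and>
      (\<exists>v\<in>span ((\<lambda>i. k i x) ` I). \<forall>w\<in>span ((\<lambda>i. k i x) ` I). \<omega> x v w = \<alpha> x w)) (nbhds N p)"
  shows "\<exists>\<kappa>. section_at N F p \<kappa> \<and> eventually (\<lambda>x. \<kappa> x \<in> span ((\<lambda>i. k i x) ` I) \<and>
      (\<forall>w\<in>span ((\<lambda>i. k i x) ` I). \<omega> x (\<kappa> x) w = \<alpha> x w)) (nbhds N p)"
  using I k smooth pointwise
proof (induction "card I" arbitrary: I k rule: less_induct)
  case less
  note at_p = eventually_nbhds_self[OF atlas_N p less.prems(5)]
  show ?case
  proof (cases "\<forall>i\<in>I. \<forall>j\<in>I. \<omega> p (k i p) (k j p) = 0")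
    case True
    have rad_sub: "subspace {v \<in> span ((\<lambda>i. k i x) ` I). \<forall>w\<in>span ((\<lambda>i. k i x) ` I). \<omega> x v w = 0}"
      and sp: "span ((\<lambda>i. k i x) ` I) \<subseteq> U x"
      if x: "subspace (U x)" "\<forall>v\<in>U x. linear_on_space (U x) (\<omega> x v)" "\<forall>v\<in>U x. \<forall>w\<in>U x. \<omega> x v w = - \<omega> x w v"
        "\<forall>i\<in>I. k i x \<in> U x" for x
    proof -
      let ?V = "span ((\<lambda>i. k i x) ` I)"
      show sp: "?V \<subseteq> U x" by (rule span_minimal[OF _ x(1)]) (use x(4) in auto)
      have left: "linear_on_space (U x) (\<lambda>v. \<omega> x v w)" if "w \<in> U x" for w
        by (rule linear_on_space_swap_skew[OF x(1) x(2)[rule_format, OF that] that x(3)[rule_format]])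
      have "{v \<in> ?V. \<forall>w\<in>?V. \<omega> x v w = 0} = ?V \<inter> (\<Inter>w\<in>?V. {v \<in> U x. \<omega> x v w = 0})"
        using sp by auto
      then show "subspace {v \<in> ?V. \<forall>w\<in>?V. \<omega> x v w = 0}"
        using sp subspace_kernel_on[OF left x(1)]
        by (auto intro!: subspace_inter[OF subspace_span] subspace_Int)
    qed
    \<comment> \<open>At \<open>p\<close> the radical is the whole span, which fixes
      \<open>d\<close>; constant rank then makes the form vanish on the span at all nearby
      points.\<close>
    have "d = card I"
    proof -
      let ?V = "span ((\<lambda>i. k i p) ` I)"
      have leftp: "linear_on_space (U p) (\<lambda>v. \<omega> p v w)" if "w \<in> U p" for w
      proof (rule linear_on_space_swap_skew)
        show "subspace (U p)" "linear_on_space (U p) (\<omega> p w)" using at_p that by blast+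
        show "\<omega> p v w = - \<omega> p w v" if "v \<in> U p" "w \<in> U p" for v w using at_p that by blast
      qed (rule that)
      have 1: "\<forall>j\<in>I. \<omega> p v (k j p) = 0" if "v \<in> ?V" for v
      proof
        fix j assume j: "j \<in> I"
        have "?V \<subseteq> {v \<in> U p. \<omega> p v (k j p) = 0}"
        proof (rule span_minimal)
          show "(\<lambda>i. k i p) ` I \<subseteq> {v \<in> U p. \<omega> p v (k j p) = 0}" using True at_p j by blast
          show "subspace {v \<in> U p. \<omega> p v (k j p) = 0}"
            by (rule subspace_kernel_on[OF leftp]) (use at_p j in blast)+
        qed
        then show "\<omega> p v (k j p) = 0" using that by blast
      qed
      have spU: "?V \<subseteq> U p" using sp[of p] at_p by blast
      have 2: "\<omega> p v w = 0" if "v \<in> ?V" "w \<in> ?V" for v w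
      proof -
        have "?V \<subseteq> {w \<in> U p. \<omega> p v w = 0}"
        proof (rule span_minimal)
          show "(\<lambda>i. k i p) ` I \<subseteq> {w \<in> U p. \<omega> p v w = 0}" using 1[OF that(1)] at_p by blast
          show "subspace {w \<in> U p. \<omega> p v w = 0}"
            by (rule subspace_kernel_on) (use at_p that(1) spU in blast)+
        qed
        then show ?thesis using that by blast
      qed
      then have "{v \<in> ?V. \<forall>w\<in>?V. \<omega> p v w = 0} = ?V" by auto
      then show ?thesis
        using at_p dim_span_lin_indep[OF less.prems(1), of "\<lambda>i. k i p"] by simp
    qed
    \<comment> \<open>A solvable equation whose left side is identically zero has zero right side,
      so the zero section is a solution.\<close>
    have "eventually (\<lambda>x. 0 \<in> span ((\<lambda>i. k i x) ` I) \<and>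
        (\<forall>w\<in>span ((\<lambda>i. k i x) ` I). \<omega> x 0 w = \<alpha> x w)) (nbhds N p)"
      using less.prems(5)
    proof eventually_elim
      case (elim x)
      let ?V = "span ((\<lambda>i. k i x) ` I)"
      have "{v \<in> ?V. \<forall>w\<in>?V. \<omega> x v w = 0} = ?V"
      proof (rule subspace_eq_of_dim[OF _ _ less.prems(1)])
        show "subspace {v \<in> ?V. \<forall>w\<in>?V. \<omega> x v w = 0}" using elim by (intro rad_sub) blast+
        show "dim {v \<in> ?V. \<forall>w\<in>?V. \<omega> x v w = 0} = card I" using elim \<open>d = card I\<close> by blast
      qed blast
      then have z: "\<omega> x v w = 0" if "v \<in> ?V" "w \<in> ?V" for v w
        using that by blast
      obtain v where "v \<in> ?V" "\<forall>w\<in>?V. \<omega> x v w = \<alpha> x w" using elim by blast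
      then have "\<alpha> x w = 0" if "w \<in> ?V" for w using z that by force
      then show ?case using z span_0 by auto
    qed
    then show ?thesis using section_at_zero[OF p] by (intro exI[of _ "\<lambda>x. 0"]) auto
  next
    case False
    then obtain i j where ij: "i \<in> I" "j \<in> I" "\<omega> p (k i p) (k j p) \<noteq> 0" by blast
    \<comment> \<open>The pointwise reduction step, taken along a pair on which the form is nonzero
      at \<open>p\<close>. By continuity the same pair serves nearby, and the quotients are
      smooth.\<close>
    define kk where "kk l x = k l x - (\<omega> x (k l x) (k j x) / \<omega> x (k i x) (k j x)) *\<^sub>R k i x
        + (\<omega> x (k l x) (k i x) / \<omega> x (k i x) (k j x)) *\<^sub>R k j x" for l x
    define P where "P x \<longleftrightarrow> subspace (U x) \<and> (\<forall>v\<in>U x. linear_on_space (U x) (\<omega> x v)) \<and>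
      (\<forall>v\<in>U x. \<forall>w\<in>U x. \<omega> x v w = - \<omega> x w v) \<and> linear_on_space (U x) (\<alpha> x) \<and>
      (\<forall>i\<in>I. k i x \<in> U x) \<and> lin_indep_family I (\<lambda>i. k i x) \<and>
      dim {v \<in> span ((\<lambda>i. k i x) ` I). \<forall>w\<in>span ((\<lambda>i. k i x) ` I). \<omega> x v w = 0} = d \<and>
      (\<exists>v\<in>span ((\<lambda>i. k i x) ` I). \<forall>w\<in>span ((\<lambda>i. k i x) ` I). \<omega> x v w = \<alpha> x w)
      \<and> \<omega> x (k i x) (k j x) \<noteq> 0" for x
    have "eventually (\<lambda>x. \<omega> x (k i x) (k j x) \<in> - {0}) (nbhds N p)"
      by (rule smooth_at_continuous[OF atlas_N less.prems(3)[OF ij(1,2)]]) (use ij(3) in auto)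
    then have "eventually (\<lambda>x. \<omega> x (k i x) (k j x) \<noteq> 0) (nbhds N p)" by simp
    with less.prems(5) have evP: "eventually P (nbhds N p)"
      by eventually_elim (unfold P_def, elim conjE, intro conjI, assumption+)
    have step: "symplectic_step (U x) (\<omega> x) (\<alpha> x) I (\<lambda>i. k i x) i j" if "P x" for x
    proof -
      note P1 = that[unfolded P_def]
      note P2 = conjunct2[OF P1] note P3 = conjunct2[OF P2] note P4 = conjunct2[OF P3] note P5 = conjunct2[OF P4]
      note P9 = conjunct2[OF conjunct2[OF conjunct2[OF conjunct2[OF P5]]]]
      show ?thesis
        by (rule symplectic_step.intro[OF conjunct1[OF P1] conjunct1[OF P2, rule_format] conjunct1[OF P3, rule_format]
              conjunct1[OF P4] less.prems(1) ij(1,2) conjunct1[OF P5, rule_format] P9])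
    qed
    have k'x: "symplectic_step.k' (\<omega> x) (\<lambda>i. k i x) i j l = kk l x" if "P x" for x l
      using symplectic_step.k'_def[OF step[OF that]] by (simp add: kk_def)
    have k'img: "symplectic_step.k' (\<omega> x) (\<lambda>i. k i x) i j = (\<lambda>l. kk l x)" if "P x" for x
      using k'x[OF that] by blast
    let ?I = "I - {i, j}"
    have quot: "smooth_at N p (\<lambda>x. \<omega> x (k l x) (k m x) / \<omega> x (k i x) (k j x))" if "l \<in> I" "m \<in> I" for l m
      using smooth_at_divide[OF atlas_N less.prems(3)[OF that] less.prems(3)[OF ij(1,2)] ij(3)] .
    have sec': "section_at N F p (kk l)" if l: "l \<in> I" for l
    proof -
      have "section_at N F p (\<lambda>x. k l x + (- (\<omega> x (k l x) (k j x) / \<omega> x (k i x) (k j x))) *\<^sub>R k i x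
        + (\<omega> x (k l x) (k i x) / \<omega> x (k i x) (k j x)) *\<^sub>R k j x)"
        by (intro section_at_add section_at_scale smooth_at_uminus[OF atlas_N] quot l ij less.prems(2))
      then show ?thesis by (simp add: kk_def[abs_def])
    qed
    have expand: "eventually (\<lambda>x. \<omega> x (kk l x) (kk m x) = \<omega> x (k l x) (k m x)
         - (\<omega> x (k l x) (k j x) / \<omega> x (k i x) (k j x)) * \<omega> x (k i x) (k m x)
         + (\<omega> x (k l x) (k i x) / \<omega> x (k i x) (k j x)) * \<omega> x (k j x) (k m x)) (nbhds N p)"
      if lm: "l \<in> I" "m \<in> I" for l m
      using evP
    proof eventually_elim
      case (elim x)
      interpret symplectic_step "U x" "\<omega> x" "\<alpha> x" I "\<lambda>i. k i x" i j by (rule step[OF elim])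
      have k'eq: "kk l x = symplectic_step.k' (\<omega> x) (\<lambda>i. k i x) i j l" for l using k'x[OF elim] by simp
      have lU: "kk l x \<in> U x" unfolding k'eq using k'U lm by auto
      have z: "\<omega> x (kk l x) (k i x) = 0" "\<omega> x (kk l x) (k j x) = 0"
        unfolding k'eq using omega_k'_ki omega_k'_kj lm by auto
      \<comment> \<open>Only the first argument needs expanding: \<open>kk l x\<close> is already
        orthogonal to the plane, so the plane part of \<open>kk m x\<close> drops out.\<close>
      have "\<omega> x (kk l x) (kk m x) = \<omega> x (kk l x) (k m x)"
        unfolding kk_def[of m]
        using linear_on_space_comb_diff[OF lin[OF lU] U kU[OF lm(2)] ki kj] z by simp
      also have "\<dots> = \<omega> x (k l x) (k m x)
         - (\<omega> x (k l x) (k j x) / \<omega> x (k i x) (k j x)) * \<omega> x (k i x) (k m x)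
         + (\<omega> x (k l x) (k i x) / \<omega> x (k i x) (k j x)) * \<omega> x (k j x) (k m x)"
        unfolding kk_def[of l]
        using linear_on_space_comb_diff[OF left[OF kU[OF lm(2)]] U kU[OF lm(1)] ki kj] by simp
      finally show ?case .
    qed
    have smooth': "smooth_at N p (\<lambda>x. \<omega> x (kk l x) (kk m x))" if lm: "l \<in> I" "m \<in> I" for l m
    proof (rule smooth_at_cong[OF atlas_N])
      show "smooth_at N p (\<lambda>x. \<omega> x (k l x) (k m x)
         - (\<omega> x (k l x) (k j x) / \<omega> x (k i x) (k j x)) * \<omega> x (k i x) (k m x)
         + (\<omega> x (k l x) (k i x) / \<omega> x (k i x) (k j x)) * \<omega> x (k j x) (k m x))"
        by (intro smooth_at_add[OF atlas_N] smooth_at_diff[OF atlas_N] smooth_at_mult[OF atlas_N] quot less.prems(3) lm ij)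
      show "eventually (\<lambda>x. \<omega> x (k l x) (k m x)
         - (\<omega> x (k l x) (k j x) / \<omega> x (k i x) (k j x)) * \<omega> x (k i x) (k m x)
         + (\<omega> x (k l x) (k i x) / \<omega> x (k i x) (k j x)) * \<omega> x (k j x) (k m x) = \<omega> x (kk l x) (kk m x)) (nbhds N p)"
        using expand[OF lm] by eventually_elim simp
    qed
    have alpha': "smooth_at N p (\<lambda>x. \<alpha> x (kk l x))" if l: "l \<in> I" for l
    proof (rule smooth_at_cong[OF atlas_N])
      show "smooth_at N p (\<lambda>x. \<alpha> x (k l x) - (\<omega> x (k l x) (k j x) / \<omega> x (k i x) (k j x)) * \<alpha> x (k i x)
         + (\<omega> x (k l x) (k i x) / \<omega> x (k i x) (k j x)) * \<alpha> x (k j x))"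
        by (intro smooth_at_add[OF atlas_N] smooth_at_diff[OF atlas_N] smooth_at_mult[OF atlas_N] quot less.prems(4) l ij)
      show "eventually (\<lambda>x. \<alpha> x (k l x) - (\<omega> x (k l x) (k j x) / \<omega> x (k i x) (k j x)) * \<alpha> x (k i x)
         + (\<omega> x (k l x) (k i x) / \<omega> x (k i x) (k j x)) * \<alpha> x (k j x) = \<alpha> x (kk l x)) (nbhds N p)"
        using evP
      proof eventually_elim
        case (elim x)
        interpret symplectic_step "U x" "\<omega> x" "\<alpha> x" I "\<lambda>i. k i x" i j by (rule step[OF elim])
        show ?case
          unfolding kk_def[of l]
          using linear_on_space_comb_diff[OF alpha U kU[OF l] ki kj] by simp
      qed
    qed
    have "\<exists>\<kappa>. section_at N F p \<kappa> \<and> eventually (\<lambda>x. \<kappa> x \<in> span ((\<lambda>i. kk i x) ` ?I) \<and>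
      (\<forall>w\<in>span ((\<lambda>i. kk i x) ` ?I). \<omega> x (\<kappa> x) w = \<alpha> x w)) (nbhds N p)"
    proof (rule less.hyps)
      show "card ?I < card I" using less.prems(1) ij(1) by (intro psubset_card_mono) auto
      show "finite ?I" using less.prems(1) by simp
      show "eventually (\<lambda>x. subspace (U x) \<and> (\<forall>v\<in>U x. linear_on_space (U x) (\<omega> x v)) \<and>
      (\<forall>v\<in>U x. \<forall>w\<in>U x. \<omega> x v w = - \<omega> x w v) \<and> linear_on_space (U x) (\<alpha> x) \<and>
      (\<forall>i\<in>?I. kk i x \<in> U x) \<and> lin_indep_family ?I (\<lambda>i. kk i x) \<and>
      dim {v \<in> span ((\<lambda>i. kk i x) ` ?I). \<forall>w\<in>span ((\<lambda>i. kk i x) ` ?I). \<omega> x v w = 0} = d \<and>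
      (\<exists>v\<in>span ((\<lambda>i. kk i x) ` ?I). \<forall>w\<in>span ((\<lambda>i. kk i x) ` ?I). \<omega> x v w = \<alpha> x w)) (nbhds N p)"
        using evP
      proof eventually_elim
        case (elim x)
        note st = step[OF elim]
        note E = elim[unfolded P_def]
        have "\<forall>i\<in>?I. kk i x \<in> U x"
          using symplectic_step.k'U[OF st] unfolding k'img[OF elim] by blast
        moreover have "lin_indep_family ?I (\<lambda>i. kk i x)"
          using symplectic_step.lin_indep_k'[OF st] E unfolding k'img[OF elim] by blast
        moreover have "dim {v \<in> span ((\<lambda>i. kk i x) ` ?I). \<forall>w\<in>span ((\<lambda>i. kk i x) ` ?I). \<omega> x v w = 0} = d"
          using symplectic_step.radical_eq[OF st] E unfolding k'img[OF elim] by simp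
        moreover have "\<exists>v\<in>span ((\<lambda>i. kk i x) ` ?I). \<forall>w\<in>span ((\<lambda>i. kk i x) ` ?I). \<omega> x v w = \<alpha> x w"
          using symplectic_step.solvable[OF st] E unfolding k'img[OF elim] by blast
        ultimately show ?case using E by blast
      qed
    qed (use sec' smooth' alpha' in auto)
    then obtain \<kappa> where \<kappa>: "section_at N F p \<kappa>" "eventually (\<lambda>x. \<kappa> x \<in> span ((\<lambda>i. kk i x) ` ?I) \<and>
      (\<forall>w\<in>span ((\<lambda>i. kk i x) ` ?I). \<omega> x (\<kappa> x) w = \<alpha> x w)) (nbhds N p)" by blast
    \<comment> \<open>The solution on the complement, completed by its plane components as in
      \<open>symplectic_step.solution\<close>.\<close>
    define \<kappa>' where "\<kappa>' x = \<kappa> x + (\<alpha> x (k j x) / \<omega> x (k i x) (k j x)) *\<^sub>R k i x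
        + (- \<alpha> x (k i x) / \<omega> x (k i x) (k j x)) *\<^sub>R k j x" for x
    have "section_at N F p \<kappa>'"
      unfolding \<kappa>'_def
      by (intro section_at_add section_at_scale \<kappa>(1) less.prems(2) ij smooth_at_divide[OF atlas_N]
          smooth_at_uminus[OF atlas_N] less.prems(3,4))
    moreover have "eventually (\<lambda>x. \<kappa>' x \<in> span ((\<lambda>i. k i x) ` I) \<and>
      (\<forall>w\<in>span ((\<lambda>i. k i x) ` I). \<omega> x (\<kappa>' x) w = \<alpha> x w)) (nbhds N p)"
      using \<kappa>(2) evP
    proof eventually_elim
      case (elim x)
      note sol = symplectic_step.solution[OF step[OF elim(2)], unfolded k'img[OF elim(2)], of "\<kappa> x" "\<kappa>' x"]
      show ?case using sol elim(1) \<kappa>'_def[of x] by blast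
    qed
    ultimately show ?thesis by blast
  qed
qed

end

section \<open>Brackets of sections over the submanifold\<close>

context embedded
begin

lemma smooth_fun_on_S:
  assumes "openin (mtopology M) W" "smooth_fun_on M W f"
  shows "smooth_fun_on S (W \<inter> C) f"
  unfolding smooth_fun_on_iff_smooth_at[OF atlas_S openin_S_of_M[OF assms(1)]]
  using assms(2) smooth_at_S_of_M unfolding smooth_fun_on_iff_smooth_at[OF atlas_M assms(1)] by blast

lemma restrict_bundle_simps [simp]:
  "fibre (restrict_bundle F S) = fibre F" "fibre_dim (restrict_bundle F S) = fibre_dim F"
  "frames (restrict_bundle F S) = (\<lambda>(U, b). (U \<inter> C, b)) ` frames F"
  by (simp_all add: restrict_bundle_def)

lemma vector_bundle_restrict:
  fixes F :: "('m, 'v::real_vector, 'z) vbundle_scheme"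
  assumes F: "vector_bundle M F"
  shows "vector_bundle S (restrict_bundle F S)"
proof -
  interpret vbundle_over M F using M F by unfold_locales
  have "\<exists>g. (\<forall>i<r. \<forall>j<r. smooth_fun_on S ((U \<inter> C) \<inter> (V \<inter> C)) (g i j)) \<and>
        (\<forall>p\<in>(U \<inter> C) \<inter> (V \<inter> C). \<forall>j<r. c j p = (\<Sum>i<r. g i j p *\<^sub>R b i p))"
    if bc: "(U, b) \<in> frames F" "(V, c) \<in> frames F" for U b V c
  proof -
    obtain g where g: "\<And>i j. i < r \<Longrightarrow> j < r \<Longrightarrow> smooth_fun_on M (U \<inter> V) (g i j)"
      "\<And>p j. p \<in> U \<inter> V \<Longrightarrow> j < r \<Longrightarrow> c j p = (\<Sum>i<r. g i j p *\<^sub>R b i p)"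
      using frame_change[OF bc] by blast
    have "openin (mtopology M) (U \<inter> V)" using frame_open bc by blast
    from smooth_fun_on_S[OF this g(1)]
    have "smooth_fun_on S ((U \<inter> C) \<inter> (V \<inter> C)) (g i j)" if "i < r" "j < r" for i j
      using that by (simp add: Int_ac)
    then show ?thesis using g(2) by blast
  qed
  moreover have "\<Union>(fst ` frames (restrict_bundle F S)) = points S"
  proof -
    have "\<Union>(fst ` frames (restrict_bundle F S)) = \<Union>(fst ` frames F) \<inter> C"
      by (force simp: image_image split_beta)
    moreover have "\<Union>(fst ` frames F) = points M" using F by (simp add: vector_bundle_def)
    ultimately show ?thesis using C_subset by auto
  qed
  ultimately show ?thesis
    unfolding vector_bundle_def
    using openin_S_of_M[OF frame_open] frame_basis by auto
qed

lemma section_at_restrict: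
  fixes F :: "('m, 'v::real_vector, 'z) vbundle_scheme"
  assumes F: "vector_bundle M F" and s: "section_at M F p s" and p: "p \<in> C"
  shows "section_at S (restrict_bundle F S) p s"
proof -
  interpret vbundle_over M F using M F by unfold_locales
  interpret R: vbundle_over S "restrict_bundle F S"
    using smooth_manifold_S vector_bundle_restrict[OF F] by unfold_locales
  obtain U b where b: "(U, b) \<in> frames F" "p \<in> U"
    by (rule frame_exists[OF section_at_point[OF s]])
  have b': "(U \<inter> C, b) \<in> frames (restrict_bundle F S)" "p \<in> U \<inter> C"
    using b p by force+
  obtain a where a: "\<forall>i<r. smooth_at M p (a i)" "eventually (\<lambda>x. s x = (\<Sum>i<r. a i x *\<^sub>R b i x)) (nbhds M p)"
    using s[unfolded section_at_iff_frame[OF b]] by (elim exE conjE)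
  show ?thesis
    unfolding R.section_at_iff_frame[OF b'] eventually_nbhds_S[OF p]
    using a smooth_at_S_of_M[OF _ p] by (intro exI[of _ a]) (auto elim!: eventually_mono)
qed

text \<open>The coefficients in an ambient frame are extended one by one, and the resulting germ is
  then made global. This supplies the extensions over which brackets on \<open>C\<close> are
  evaluated.\<close>

lemma section_at_extension:
  fixes F :: "('m, 'v::real_vector, 'z) vbundle_scheme"
  assumes F: "vector_bundle M F" and s: "section_at S (restrict_bundle F S) p s"
  shows "\<exists>x\<in>sections M F. eventually (\<lambda>y. y \<in> C \<longrightarrow> x y = s y) (nbhds M p)"
proof -
  interpret vbundle_over M F using M F by unfold_locales
  interpret R: vbundle_over S "restrict_bundle F S"
    using smooth_manifold_S vector_bundle_restrict[OF F] by unfold_locales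
  have p: "p \<in> C" using R.section_at_point[OF s] by simp
  then have pM: "p \<in> points M" using C_subset by blast
  obtain U b where b: "(U, b) \<in> frames F" "p \<in> U" by (rule frame_exists[OF pM])
  have b': "(U \<inter> C, b) \<in> frames (restrict_bundle F S)" "p \<in> U \<inter> C"
    using b p by force+
  obtain a where a: "\<forall>i<r. smooth_at S p (a i)"
    "eventually (\<lambda>x. x \<in> C \<longrightarrow> s x = (\<Sum>i<r. a i x *\<^sub>R b i x)) (nbhds M p)"
    using s[unfolded R.section_at_iff_frame[OF b'] eventually_nbhds_S[OF p]] by auto
  have "\<exists>f. smooth_at M p f \<and> eventually (\<lambda>x. x \<in> C \<longrightarrow> f x = a i x) (nbhds M p)" if i: "i < r" for i
    using smooth_at_extension[OF a(1)[rule_format, OF i]] by metis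
  then obtain a' where a': "\<And>i. i < r \<Longrightarrow> smooth_at M p (a' i)"
    "\<And>i. i < r \<Longrightarrow> eventually (\<lambda>x. x \<in> C \<longrightarrow> a' i x = a i x) (nbhds M p)"
    by metis
  define t where "t x = (\<Sum>i<r. a' i x *\<^sub>R b i x)" for x
  have "section_at M F p t"
    unfolding t_def by (intro section_at_sum[OF pM] section_at_scale a' section_at_frame[OF b]) auto
  then obtain x where x: "x \<in> sections M F" "eventually (\<lambda>y. x y = t y) (nbhds M p)"
    by (rule section_at_globalize)
  have "eventually (\<lambda>x. \<forall>i\<in>{..<r}. x \<in> C \<longrightarrow> a' i x = a i x) (nbhds M p)"
    by (intro eventually_ball_finite ballI a'(2)) auto
  then have "eventually (\<lambda>y. y \<in> C \<longrightarrow> x y = s y) (nbhds M p)"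
    using x(2) a(2) by eventually_elim (auto simp: t_def)
  then show ?thesis using x(1) by blast
qed

end

section \<open>Smooth dependence of pairings and of images under endomorphisms\<close>

lemma pairing_smooth_at:
  fixes A :: "('m, 'v::real_vector) courant"
  assumes M: "smooth_manifold M" and A: "vector_bundle M A" and g: "smooth_metric M A"
    and s: "section_at M A p s" and t: "section_at M A p t"
  shows "smooth_at M p (\<lambda>x. pairing A x (s x) (t x))"
proof -
  interpret vbundle_over M A using M A by unfold_locales
  note p = section_at_point[OF s]
  obtain U b where b: "(U, b) \<in> frames A" "p \<in> U" by (rule frame_exists[OF p])
  obtain a where a: "\<forall>i<r. smooth_at M p (a i)" "eventually (\<lambda>x. s x = (\<Sum>i<r. a i x *\<^sub>R b i x)) (nbhds M p)"
    using s[unfolded section_at_iff_frame[OF b]] by (elim exE conjE)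
  obtain c where c: "\<forall>i<r. smooth_at M p (c i)" "eventually (\<lambda>x. t x = (\<Sum>i<r. c i x *\<^sub>R b i x)) (nbhds M p)"
    using t[unfolded section_at_iff_frame[OF b]] by (elim exE conjE)
  have gs: "smooth_at M p (\<lambda>x. pairing A x (b i x) (b j x))" if "i < r" "j < r" for i j
  proof -
    have "\<forall>(U, b)\<in>frames A. \<forall>i<r. \<forall>j<r. smooth_fun_on M U (\<lambda>p. pairing A p (b i p) (b j p))"
      by (rule conjunct2[OF g[unfolded smooth_metric_def]])
    from bspec[OF this b(1)] have "smooth_fun_on M U (\<lambda>x. pairing A x (b i x) (b j x))"
      using that by simp
    then show ?thesis using frame_open[OF b(1)] b(2) by (auto simp: smooth_at_def)
  qed
  have "smooth_at M p (\<lambda>x. \<Sum>j<r. c j x * (\<Sum>i<r. a i x * pairing A x (b j x) (b i x)))"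
    by (intro smooth_at_sum[OF atlas_N p] smooth_at_mult[OF atlas_N] gs a(1)[rule_format] c(1)[rule_format]) auto
  then show ?thesis
  proof (rule smooth_at_cong[OF atlas_N])
    show "eventually (\<lambda>x. (\<Sum>j<r. c j x * (\<Sum>i<r. a i x * pairing A x (b j x) (b i x))) = pairing A x (s x) (t x)) (nbhds M p)"
      using a(2) c(2) eventually_nbhds_open[OF frame_open[OF b(1)] b(2)]
    proof eventually_elim
      case (elim x)
      note bas = frame_basis[OF b(1) elim(3)]
      have x: "x \<in> points M" using openin_subset[OF frame_open[OF b(1)]] elim(3) topspace_mtopology[OF atlas_N] by auto
      note sub = fibre_subspace[OF x]
      have bf: "b i x \<in> fibre A x" if "i < r" for i
        using bas that span_base[of "b i x" "(\<lambda>i. b i x) ` {..<r}"] by (auto simp: is_basis_def)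
      have sf: "s x \<in> fibre A x" unfolding elim(1) by (rule is_basis_comb[OF bas])
      have lin: "linear_on_space (fibre A x) (pairing A x v)" if "v \<in> fibre A x" for v
        using g x that by (auto simp: smooth_metric_def)
      have sym: "pairing A x v w = pairing A x w v" if "v \<in> fibre A x" "w \<in> fibre A x" for v w
        using g x that unfolding smooth_metric_def by blast
      have "pairing A x (s x) (t x) = (\<Sum>j<r. c j x *\<^sub>R pairing A x (s x) (b j x))"
        unfolding elim(2) using bf by (intro linear_on_space_sum[OF lin[OF sf] sub]) auto
      also have "\<dots> = (\<Sum>j<r. c j x * (\<Sum>i<r. a i x * pairing A x (b j x) (b i x)))"
      proof (rule sum.cong[OF refl])
        fix j assume "j \<in> {..<r}"
        then have j: "j < r" by simp
        have "pairing A x (s x) (b j x) = pairing A x (b j x) (s x)" by (rule sym[OF sf bf[OF j]])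
        also have "\<dots> = (\<Sum>i<r. a i x *\<^sub>R pairing A x (b j x) (b i x))"
          unfolding elim(1) using bf by (intro linear_on_space_sum[OF lin[OF bf[OF j]] sub]) auto
        finally show "c j x *\<^sub>R pairing A x (s x) (b j x) = c j x * (\<Sum>i<r. a i x * pairing A x (b j x) (b i x))"
          by simp
      qed
      finally show ?case by simp
    qed
  qed
qed

lemma endomorphism_section_at:
  fixes A :: "('m, 'v::real_vector, 'z) vbundle_scheme"
  assumes M: "smooth_manifold M" and A: "vector_bundle M A" and J: "bundle_endomorphism M A J"
    and s: "section_at M A p s"
  shows "section_at M A p (\<lambda>x. J x (s x))"
proof -
  interpret vbundle_over M A using M A by unfold_locales
  note p = section_at_point[OF s]
  obtain U b where b: "(U, b) \<in> frames A" "p \<in> U" by (rule frame_exists[OF p])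
  obtain a where a: "\<forall>i<r. smooth_at M p (a i)" "eventually (\<lambda>x. s x = (\<Sum>i<r. a i x *\<^sub>R b i x)) (nbhds M p)"
    using s[unfolded section_at_iff_frame[OF b]] by (elim exE conjE)
  have *: "\<forall>(U, b)\<in>frames A. \<exists>g. (\<forall>i<r. \<forall>j<r. smooth_fun_on M U (g i j)) \<and>
        (\<forall>p\<in>U. \<forall>j<r. J p (b j p) = (\<Sum>i<r. g i j p *\<^sub>R b i p))"
    using J unfolding bundle_endomorphism_def by simp
  from bspec[OF * b(1)] obtain g where g: "\<forall>i<r. \<forall>j<r. smooth_fun_on M U (g i j)"
        "\<forall>p\<in>U. \<forall>j<r. J p (b j p) = (\<Sum>i<r. g i j p *\<^sub>R b i p)" by auto
  have gs: "smooth_at M p (g i j)" if "i < r" "j < r" for i j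
    using g(1) b(2) that frame_open[OF b(1)] unfolding smooth_at_def by blast
  have "section_at M A p (\<lambda>x. \<Sum>j<r. a j x *\<^sub>R (\<Sum>i<r. g i j x *\<^sub>R b i x))"
    by (intro section_at_sum[OF p] section_at_scale a(1)[rule_format] gs section_at_frame[OF b]) auto
  then show ?thesis
  proof (rule section_at_cong)
    show "eventually (\<lambda>x. (\<Sum>j<r. a j x *\<^sub>R (\<Sum>i<r. g i j x *\<^sub>R b i x)) = J x (s x)) (nbhds M p)"
      using a(2) eventually_nbhds_open[OF frame_open[OF b(1)] b(2)]
    proof eventually_elim
      case (elim x)
      note bas = frame_basis[OF b(1) elim(2)]
      have x: "x \<in> points M" using openin_subset[OF frame_open[OF b(1)]] elim(2) topspace_mtopology[OF atlas_N] by auto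
      have bf: "b i x \<in> fibre A x" if "i < r" for i
        using bas that span_base[of "b i x" "(\<lambda>i. b i x) ` {..<r}"] by (auto simp: is_basis_def)
      have lin: "linear_on_space (fibre A x) (J x)"
        using J x by (simp add: bundle_endomorphism_def)
      have "J x (s x) = (\<Sum>j<r. a j x *\<^sub>R J x (b j x))"
        unfolding elim(1) using bf by (intro linear_on_space_sum[OF lin fibre_subspace[OF x]]) auto
      then show ?case using g(2) elim(2) by simp
    qed
  qed
qed

lemma smooth_fun_linear_combination:
  assumes "is_atlas M" "smooth_fun M f" "smooth_fun M g"
  shows "smooth_fun M (\<lambda>x. a * f x + b * g x)"
  unfolding smooth_fun_iff_smooth_at[OF assms(1)]
proof
  fix p assume p: "p \<in> points M"
  show "smooth_at M p (\<lambda>x. a * f x + b * g x)"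
    using assms(2,3) p unfolding smooth_fun_iff_smooth_at[OF assms(1)]
    by (intro smooth_at_add[OF assms(1)] smooth_at_mult[OF assms(1)] smooth_at_const[OF assms(1) p]) blast+
qed

lemma vanishing_function_tangent:
  assumes "smooth_manifold M" "p \<in> points M" "v \<in> tangent M p" "smooth_fun M f"
    and "eventually (\<lambda>x. f x = 0) (nbhds M p)"
  shows "v f = 0"
proof -
  have A: "is_atlas M" using assms(1) by (simp add: smooth_manifold_def)
  have z: "smooth_fun M (\<lambda>x. 0)"
    using smooth_at_const[OF A] by (simp add: smooth_fun_iff_smooth_at[OF A])
  have "v f = v (\<lambda>x. 0)"
    by (rule tangent_local[OF assms(1-4) z assms(5)])
  moreover have "v (\<lambda>x. 0 * f x + 0 * f x) = 0 * v f + 0 * v f"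
    using assms(3,4) unfolding tangent_def by blast
  ultimately show ?thesis by simp
qed

text \<open>The quotient is kept abstract: \<open>q\<close> maps \<open>C\<close> onto
  \<open>Q\<close>, and identifications along its fibres are those recorded in
  \<open>reduced\<close>. That the leaf space has this form is established when the locale is
  interpreted.\<close>

locale reduction = embedded M C k S for M :: "'m manifold" and C k S +
  fixes E :: "('m, 'v::real_vector) courant" and K :: "'m \<Rightarrow> 'v set"
    and Q :: "'n manifold" and q :: "'m \<Rightarrow> 'n" and B :: "('n, 'w::real_vector) courant"
    and \<Phi> :: "'m \<Rightarrow> 'v \<Rightarrow> 'w" and J :: "'m \<Rightarrow> 'v \<Rightarrow> 'v"
  assumes courant: "courant_algebroid M E"
    and K_subbundle: "subbundle S (restrict_bundle E S) K" and K_isotropic: "isotropic E S K"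
    and anchor_orth: "\<forall>p\<in>C. anchor E p ` orth E K p = tangent_map M (\<lambda>x. x) ` tangent S p"
    and basic_span: "\<forall>p\<in>C. span {e p | e. e \<in> basic_sections M E S K} = orth E K p"
    and smooth_Q: "smooth_manifold Q" and q_onto: "q ` C = points Q"
    and reduced: "reduced_courant_algebroid M E S K Q q B \<Phi>"
    and gcs: "generalized_complex_structure M E J"
    and rank: "\<exists>d. \<forall>p\<in>C. dim (J p ` K p \<inter> orth E K p) = d"
    and JK: "\<forall>p\<in>C. J p ` K p \<inter> orth E K p \<subseteq> K p"
    and J_basic: "\<forall>e\<in>basic_sections M E S K. (\<forall>p\<in>C. e p \<in> J p ` orth E K p \<inter> orth E K p) \<longrightarrow>
           apply_endo S J e \<in> basic_sections M E S K"
begin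

abbreviation g where "g \<equiv> pairing E"
abbreviation "P \<equiv> orth E K"
abbreviation "RE \<equiv> restrict_bundle E S"
abbreviation "basic \<equiv> basic_sections M E S K"

section \<open>Consequences of the Courant axioms along \<open>C\<close>\<close>

lemmas bundle_E = courant[unfolded courant_algebroid_def, THEN conjunct1, rule_format]
  and metric_E = courant[unfolded courant_algebroid_def, THEN conjunct2, THEN conjunct1, rule_format]
  and anchor_E = courant[unfolded courant_algebroid_def, THEN conjunct2, THEN conjunct2, THEN conjunct1, rule_format]
  and bracket_section = courant[unfolded courant_algebroid_def, THEN conjunct2, THEN conjunct2, THEN conjunct2, THEN conjunct1, rule_format]

sublocale EM: vbundle_over M E
  using M bundle_E by unfold_locales

sublocale ER: vbundle_over S "restrict_bundle E S"
  using smooth_manifold_S vector_bundle_restrict[OF bundle_E] by unfold_locales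

lemma C_M: "p \<in> C \<Longrightarrow> p \<in> points M"
  using C_subset by blast

lemma g_lin: "p \<in> points M \<Longrightarrow> v \<in> fibre E p \<Longrightarrow> linear_on_space (fibre E p) (g p v)"
  and g_sym: "p \<in> points M \<Longrightarrow> v \<in> fibre E p \<Longrightarrow> w \<in> fibre E p \<Longrightarrow> g p v w = g p w v"
  and g_nondeg: "p \<in> points M \<Longrightarrow> v \<in> fibre E p \<Longrightarrow> (\<And>w. w \<in> fibre E p \<Longrightarrow> g p v w = 0) \<Longrightarrow> v = 0"
proof -
  note * = conjunct1[OF metric_E[unfolded smooth_metric_def]]
  show "linear_on_space (fibre E p) (g p v)" if "p \<in> points M" "v \<in> fibre E p"
    by (rule bspec[OF conjunct1[OF bspec[OF * that(1)]] that(2)])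
  show "g p v w = g p w v" if "p \<in> points M" "v \<in> fibre E p" "w \<in> fibre E p"
    by (rule bspec[OF bspec[OF conjunct1[OF conjunct2[OF bspec[OF * that(1)]]] that(2)] that(3)])
  show "v = 0" if "p \<in> points M" "v \<in> fibre E p" "\<And>w. w \<in> fibre E p \<Longrightarrow> g p v w = 0"
    by (rule mp[OF bspec[OF conjunct2[OF conjunct2[OF bspec[OF * that(1)]]] that(2)]]) (use that(3) in blast)
qed

lemma form_at:
  assumes "p \<in> points M"
  obtains b where "nondegenerate_form (fibre E p) (g p) (fibre_dim E) b"
proof -
  obtain U b where b: "(U, b) \<in> frames E" "p \<in> U" by (rule EM.frame_exists[OF assms])
  have "nondegenerate_form (fibre E p) (g p) (fibre_dim E) (\<lambda>i. b i p)"
    by (rule nondegenerate_form.intro[OF EM.frame_basis[OF b] g_lin[OF assms] g_sym[OF assms] g_nondeg[OF assms]])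
  then show ?thesis using that by blast
qed

lemma K_subspace: "p \<in> C \<Longrightarrow> subspace (K p)" and K_fibre: "p \<in> C \<Longrightarrow> K p \<subseteq> fibre E p"
  using K_subbundle by (simp_all add: subbundle_def)

lemma P_fibre: "P p \<subseteq> fibre E p"
  by (auto simp: orth_def)

lemma K_P: "p \<in> C \<Longrightarrow> K p \<subseteq> P p"
  using K_isotropic by (simp add: isotropic_def)

lemma g_P_K: "v \<in> P p \<Longrightarrow> w \<in> K p \<Longrightarrow> g p v w = 0"
  by (simp add: orth_def)

lemma g_K_P: "p \<in> C \<Longrightarrow> w \<in> K p \<Longrightarrow> v \<in> P p \<Longrightarrow> g p w v = 0"
  using g_P_K[of v p w] g_sym[OF C_M, of p w v] subsetD[OF K_fibre, of p w] subsetD[OF P_fibre, of v p] by simp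

lemma P_subspace: "p \<in> C \<Longrightarrow> subspace (P p)"
  using subspace_span[of "{e p | e. e \<in> basic}"] basic_span by simp

text \<open>Basic sections span \<open>P\<close> pointwise, so this is the double orthogonal of
  \<open>K\<close>. It replaces arbitrary test vectors by basic sections, whose brackets with
  \<open>K\<close> are under control.\<close>

lemma in_K_if_orthogonal_basic:
  assumes p: "p \<in> C" and v: "v \<in> fibre E p" and perp: "\<And>e. e \<in> basic \<Longrightarrow> g p v (e p) = 0"
  shows "v \<in> K p"
proof -
  note pM = C_M[OF p]
  obtain b where "nondegenerate_form (fibre E p) (g p) (fibre_dim E) b" by (rule form_at[OF pM])
  then interpret nondegenerate_form "fibre E p" "g p" "fibre_dim E" b .
  have "span {e p | e. e \<in> basic} \<subseteq> {w \<in> fibre E p. g p v w = 0}"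
  proof (rule span_minimal[OF _ subspace_kernel_on[OF g_lin[OF pM v] EM.fibre_subspace[OF pM]]])
    have "e p \<in> fibre E p" if "e \<in> basic" for e
      using that p P_fibre[of p] unfolding basic_sections_def sections_in_def by auto
    then show "{e p | e. e \<in> basic} \<subseteq> {w \<in> fibre E p. g p v w = 0}"
      using perp by blast
  qed
  then have Pv: "g p v w = 0" if "w \<in> P p" for w
    using that basic_span p by blast
  show ?thesis
  proof (rule orthogonal_orthogonal[OF K_subspace[OF p] K_fibre[OF p] v])
    fix u assume u: "u \<in> fibre E p" "\<And>w. w \<in> K p \<Longrightarrow> g p u w = 0"
    then have "u \<in> P p" by (simp add: orth_def)
    then show "g p u v = 0" using Pv g_sym[OF pM u(1) v] by simp
  qed
qed

text \<open>The anchor of a vector in \<open>P\<close> is tangent to \<open>C\<close>, so it sees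
  only the values of \<open>f\<close> on \<open>C\<close>. It is applied to pairings of extensions,
  which are known to vanish only there.\<close>

lemma anchor_vanishing:
  assumes p: "p \<in> C" and v: "v \<in> P p" and f: "eventually (\<lambda>x. x \<in> C \<longrightarrow> f x = 0) (nbhds M p)"
  shows "anchor E p v f = 0"
proof -
  have "anchor E p v \<in> tangent_map M (\<lambda>x. x) ` tangent S p"
    using anchor_orth p v by blast
  then obtain X where X: "X \<in> tangent S p" "anchor E p v = tangent_map M (\<lambda>x. x) X" by blast
  show ?thesis
  proof (cases "smooth_fun M f")
    case True
    have "smooth_fun S f"
      unfolding smooth_fun_iff_smooth_at[OF atlas_S]
      using True smooth_at_S_of_M C_M unfolding smooth_fun_iff_smooth_at[OF atlas_M] by auto
    then have "X f = 0"
      using f p X(1) unfolding eventually_nbhds_S[OF p, symmetric]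
      by (intro vanishing_function_tangent[OF smooth_manifold_S]) auto
    then show ?thesis using True X(2) by (simp add: tangent_map_def o_def)
  qed (simp add: X(2) tangent_map_def)
qed

lemma bracket_fibre: "e1 \<in> sections M E \<Longrightarrow> e2 \<in> sections M E \<Longrightarrow> p \<in> points M \<Longrightarrow> bracket E e1 e2 p \<in> fibre E p"
  by (rule EM.sections_fibre[OF bracket_section])

lemma bracket_bilinear:
  assumes "e1 \<in> sections M E" "e2 \<in> sections M E" "e3 \<in> sections M E" "p \<in> points M"
  shows "bracket E (\<lambda>q. a *\<^sub>R e1 q + b *\<^sub>R e2 q) e3 p = a *\<^sub>R bracket E e1 e3 p + b *\<^sub>R bracket E e2 e3 p \<and>
    bracket E e3 (\<lambda>q. a *\<^sub>R e1 q + b *\<^sub>R e2 q) p = a *\<^sub>R bracket E e3 e1 p + b *\<^sub>R bracket E e3 e2 p"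
  using bspec[OF spec[OF spec[OF bspec[OF bspec[OF bspec[OF courant[unfolded courant_algebroid_def, THEN conjunct2, THEN conjunct2, THEN conjunct2, THEN conjunct2, THEN conjunct1] assms(1)] assms(2)] assms(3)]]] assms(4), of a b]
  by blast

lemma bracket_left:
  assumes "e1 \<in> sections M E" "e2 \<in> sections M E" "e3 \<in> sections M E" "p \<in> points M"
  shows "bracket E (\<lambda>q. e1 q + e2 q) e3 p = bracket E e1 e3 p + bracket E e2 e3 p"
  using conjunct1[OF bracket_bilinear[OF assms, of 1 1]] by simp

lemma bracket_right:
  assumes "e1 \<in> sections M E" "e2 \<in> sections M E" "e3 \<in> sections M E" "p \<in> points M"
  shows "bracket E e3 (\<lambda>q. e1 q + e2 q) p = bracket E e3 e1 p + bracket E e3 e2 p"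
  using conjunct2[OF bracket_bilinear[OF assms, of 1 1]] by simp

lemmas metric_invariance = courant[unfolded courant_algebroid_def, THEN conjunct2, THEN conjunct2, THEN conjunct2, THEN conjunct2, THEN conjunct2, THEN conjunct2, THEN conjunct2, THEN conjunct2, THEN conjunct1, rule_format]
  and bracket_self = courant[unfolded courant_algebroid_def, THEN conjunct2, THEN conjunct2, THEN conjunct2, THEN conjunct2, THEN conjunct2, THEN conjunct2, THEN conjunct2, THEN conjunct2, THEN conjunct2, rule_format]

lemma anchor_tangent: "p \<in> points M \<Longrightarrow> v \<in> fibre E p \<Longrightarrow> anchor E p v \<in> tangent M p"
  using anchor_E unfolding smooth_anchor_def by blast

text \<open>The definite description in \<open>anchor_dual\<close> denotes a vector because the
  nondegenerate pairing represents every functional; from here on \<open>courant_D\<close> enters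
  only through this formula.\<close>

lemma courant_D_pairing:
  assumes p: "p \<in> points M" and v: "v \<in> fibre E p"
  shows "g p (courant_D M E f p) v = 1/2 * anchor E p v f"
proof -
  obtain b where "nondegenerate_form (fibre E p) (g p) (fibre_dim E) b" by (rule form_at[OF p])
  then interpret nondegenerate_form "fibre E p" "g p" "fibre_dim E" b .
  have comb: "anchor E p (a *\<^sub>R v + b *\<^sub>R w) = (\<lambda>f. a * anchor E p v f + b * anchor E p w f)"
    if "v \<in> fibre E p" "w \<in> fibre E p" for a b v w
    using anchor_E p that unfolding smooth_anchor_def by blast
  have "linear_on_space (fibre E p) (\<lambda>v. anchor E p v f)"
    unfolding linear_on_space_def by (simp add: comb)
  then have "\<exists>!w. w \<in> fibre E p \<and> (\<forall>v\<in>fibre E p. g p w v = anchor E p v f)"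
    by (rule riesz_representation)
  moreover have "differential M f p (anchor E p v) = anchor E p v f" if "v \<in> fibre E p" for v
    using anchor_tangent[OF p that] by (simp add: differential_def)
  ultimately have "\<exists>!w. w \<in> fibre E p \<and> (\<forall>v\<in>fibre E p. g p w v = differential M f p (anchor E p v))"
    by simp
  from theI'[OF this] have w: "anchor_dual E p (differential M f p) \<in> fibre E p"
    "g p (anchor_dual E p (differential M f p)) v = differential M f p (anchor E p v)"
    using v by (auto simp: anchor_dual_def)
  have "g p (courant_D M E f p) v = (1/2) *\<^sub>R g p (anchor_dual E p (differential M f p)) v"
    unfolding courant_D_def by (rule linear_on_space_scale[OF lin_left[OF v] w(1)])
  then show ?thesis
    using w(2) anchor_tangent[OF p v] by (simp add: differential_def)
qed

lemma pairing_smooth_fun: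
  assumes "e1 \<in> sections M E" "e2 \<in> sections M E"
  shows "smooth_fun M (\<lambda>q. g q (e1 q) (e2 q))"
  unfolding smooth_fun_iff_smooth_at[OF atlas_M]
  using assms EM.sections_iff pairing_smooth_at[OF M bundle_E metric_E] by blast

text \<open>Polarization of the axiom for \<open>[e, e]\<close>, paired with \<open>v\<close>. The
  factor 1/2 in \<open>courant_D\<close> cancels the 2 of the mixed term.\<close>

lemma bracket_symmetric_part:
  assumes e: "e1 \<in> sections M E" "e2 \<in> sections M E" and p: "p \<in> points M" and v: "v \<in> fibre E p"
  shows "g p (bracket E e1 e2 p) v + g p (bracket E e2 e1 p) v = anchor E p v (\<lambda>q. g q (e1 q) (e2 q))"
proof -
  let ?s = "\<lambda>q. e1 q + e2 q"
  let ?F = "\<lambda>q. g q (e1 q) (e1 q)" and ?G = "\<lambda>q. g q (e2 q) (e2 q)" and ?H = "\<lambda>q. g q (e1 q) (e2 q)"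
  let ?X = "anchor E p v"
  obtain b where "nondegenerate_form (fibre E p) (g p) (fibre_dim E) b" by (rule form_at[OF p])
  then interpret nondegenerate_form "fibre E p" "g p" "fibre_dim E" b .
  note gl = linear_on_space_add[OF lin_left[OF v]]
  have s: "?s \<in> sections M E"
    using e EM.section_at_add unfolding EM.sections_iff by auto
  note X = anchor_tangent[OF p v]
  have bf: "bracket E x y p \<in> fibre E p" if "x \<in> {e1, e2}" "y \<in> {e1, e2}" for x y
    using that bracket_fibre e p by auto
  have "bracket E ?s ?s p = bracket E e1 e1 p + bracket E e1 e2 p + (bracket E e2 e1 p + bracket E e2 e2 p)"
    using bracket_left[OF e s p] bracket_right[OF e e(1) p] bracket_right[OF e e(2) p] by simp
  then have "g p (bracket E ?s ?s p) v = g p (bracket E e1 e1 p) v + g p (bracket E e1 e2 p) v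
      + (g p (bracket E e2 e1 p) v + g p (bracket E e2 e2 p) v)"
    using bf subspace_V by (simp add: gl subspace_add)
  then have 1: "1/2 * ?X (\<lambda>q. g q (?s q) (?s q)) = 1/2 * ?X ?F + g p (bracket E e1 e2 p) v
      + (g p (bracket E e2 e1 p) v + 1/2 * ?X ?G)"
    using courant_D_pairing[OF p v] bracket_self[OF s p] bracket_self[OF e(1) p] bracket_self[OF e(2) p] by simp
  have sm: "smooth_fun M ?F" "smooth_fun M ?G" "smooth_fun M ?H" "smooth_fun M (\<lambda>q. g q (?s q) (?s q))"
    using pairing_smooth_fun e s by auto
  note sm2 = smooth_fun_linear_combination[OF atlas_M sm(3,2), of 2 1]
  note sm3 = smooth_fun_linear_combination[OF atlas_M sm(1) sm2, of 1 1]
  \<comment> \<open>Off \<open>points M\<close> the pairing is arbitrary and the two total functions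
    may differ, so equality of the derivatives rests on locality of tangent vectors.\<close>
  have "?X (\<lambda>q. g q (?s q) (?s q)) = ?X (\<lambda>q. 1 * ?F q + 1 * (2 * ?H q + 1 * ?G q))"
  proof (rule tangent_local[OF M p X sm(4) sm3])
    show "eventually (\<lambda>q. g q (?s q) (?s q) = 1 * ?F q + 1 * (2 * ?H q + 1 * ?G q)) (nbhds M p)"
      using eventually_nbhds_points[OF atlas_M]
    proof eventually_elim
      case (elim x)
      have f: "e1 x \<in> fibre E x" "e2 x \<in> fibre E x" "?s x \<in> fibre E x"
        using EM.sections_fibre e s elim by blast+
      have "g x (?s x) (?s x) = g x (?s x) (e1 x) + g x (?s x) (e2 x)"
        by (rule linear_on_space_add[OF g_lin[OF elim f(3)] f(1,2)])
      also have "g x (?s x) (e1 x) = g x (e1 x) (?s x)" by (rule g_sym[OF elim f(3,1)])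
      also have "g x (e1 x) (?s x) = g x (e1 x) (e1 x) + g x (e1 x) (e2 x)"
        by (rule linear_on_space_add[OF g_lin[OF elim f(1)] f(1,2)])
      also have "g x (?s x) (e2 x) = g x (e2 x) (?s x)" by (rule g_sym[OF elim f(3,2)])
      also have "g x (e2 x) (?s x) = g x (e2 x) (e1 x) + g x (e2 x) (e2 x)"
        by (rule linear_on_space_add[OF g_lin[OF elim f(2)] f(1,2)])
      also have "g x (e2 x) (e1 x) = g x (e1 x) (e2 x)" by (rule g_sym[OF elim f(2,1)])
      finally show ?case by simp
    qed
  qed
  also have "\<dots> = 1 * ?X ?F + 1 * ?X (\<lambda>q. 2 * ?H q + 1 * ?G q)"
    using X sm(1) sm2 unfolding tangent_def by blast
  also have "?X (\<lambda>q. 2 * ?H q + 1 * ?G q) = 2 * ?X ?H + 1 * ?X ?G"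
    using X sm(2,3) unfolding tangent_def by blast
  finally show ?thesis using 1 by simp
qed

section \<open>Extensions, sections of \<open>K\<close> and brackets over \<open>C\<close>\<close>

lemma extends_near_iff:
  assumes "p \<in> C"
  shows "extends_near M E S p e x \<longleftrightarrow> x \<in> sections M E \<and> eventually (\<lambda>y. y \<in> C \<longrightarrow> x y = e y) (nbhds M p)"
  unfolding extends_near_def eventually_nbhds[OF atlas_M C_M[OF assms]] by auto

lemma extends_near_at: "p \<in> C \<Longrightarrow> extends_near M E S p e x \<Longrightarrow> x p = e p"
  by (auto simp: extends_near_def)

lemma extension_exists:
  assumes "e \<in> sections S RE" "p \<in> C"
  shows "\<exists>x. extends_near M E S p e x"
  using section_at_extension[OF bundle_E, of p e] assms ER.sections_iff[of e]
  unfolding extends_near_iff[OF assms(2)] by auto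

lemma basicD:
  assumes "e \<in> basic"
  shows "e \<in> sections S RE" "p \<in> C \<Longrightarrow> e p \<in> P p"
  using assms by (auto simp: basic_sections_def sections_in_def)

lemma sections_inD:
  assumes "e \<in> sections_in E S L"
  shows "e \<in> sections S RE" "p \<in> C \<Longrightarrow> e p \<in> L p"
  using assms by (auto simp: sections_in_def)

lemma basic_bracket:
  assumes "e \<in> basic" "\<kappa> \<in> sections_in E S K" "p \<in> C"
    "extends_near M E S p \<kappa> x1" "extends_near M E S p e x2"
  shows "bracket E x1 x2 p \<in> K p"
proof -
  have "bracket_values M E S \<kappa> e p \<subseteq> K p"
    using assms(1-3) by (simp add: basic_sections_def)
  moreover have "bracket E x1 x2 p \<in> bracket_values M E S \<kappa> e p"
    unfolding bracket_values_def using assms(4,5) by blast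
  ultimately show ?thesis by blast
qed

text \<open>For basic \<open>e\<close>, invariance of the pairing gives \<open>\<langle>[k1, k2],
  e\<rangle> = \<pi>(k1)\<langle>k2, e\<rangle> - \<langle>k2, [k1, e]\<rangle>\<close>. The first
  term vanishes since \<open>\<langle>k2, e\<rangle>\<close> is 0 on \<open>C\<close>, the second
  since \<open>[k1, e]\<close> lies in the isotropic \<open>K\<close>.\<close>

lemma bracket_sections_of_K:
  assumes p: "p \<in> C" and k: "k1 \<in> sections_in E S K" "k2 \<in> sections_in E S K"
    and x: "extends_near M E S p k1 x1" "extends_near M E S p k2 x2"
  shows "bracket E x1 x2 p \<in> K p"
proof (rule in_K_if_orthogonal_basic[OF p])
  note pM = C_M[OF p]
  have xs: "x1 \<in> sections M E" "x2 \<in> sections M E" using x by (auto simp: extends_near_def)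
  show "bracket E x1 x2 p \<in> fibre E p" by (rule bracket_fibre[OF xs pM])
  fix e assume e: "e \<in> basic"
  obtain x3 where x3: "extends_near M E S p e x3" using extension_exists[OF basicD(1)[OF e] p] by blast
  then have x3s: "x3 \<in> sections M E" by (auto simp: extends_near_def)
  have "eventually (\<lambda>y. y \<in> C \<longrightarrow> x2 y = k2 y) (nbhds M p)" "eventually (\<lambda>y. y \<in> C \<longrightarrow> x3 y = e y) (nbhds M p)"
    using x(2) x3 unfolding extends_near_iff[OF p] by auto
  then have "eventually (\<lambda>y. y \<in> C \<longrightarrow> g y (x2 y) (x3 y) = 0) (nbhds M p)"
    by eventually_elim (use g_K_P sections_inD(2)[OF k(2)] basicD(2)[OF e] in auto)
  from anchor_vanishing[OF p _ this] have "anchor E p (x1 p) (\<lambda>q. g q (x2 q) (x3 q)) = 0" if "x1 p \<in> P p"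
    using that .
  moreover have "x1 p \<in> P p"
    using extends_near_at[OF p x(1)] sections_inD(2)[OF k(1) p] K_P[OF p] by auto
  ultimately have "anchor E p (x1 p) (\<lambda>q. g q (x2 q) (x3 q)) = 0" by blast
  moreover have "bracket E x1 x3 p \<in> P p" using basic_bracket[OF e k(1) p x(1) x3] K_P[OF p] by blast
  then have "g p (x2 p) (bracket E x1 x3 p) = 0"
    using g_K_P[OF p sections_inD(2)[OF k(2) p]] extends_near_at[OF p x(2)] by simp
  ultimately show "g p (bracket E x1 x2 p) (e p) = 0"
    using metric_invariance[OF xs x3s pM] extends_near_at[OF p x3] by simp
qed

lemma basic_add_section_of_K:
  assumes e: "e \<in> basic" and \<kappa>: "\<kappa> \<in> sections_in E S K"
  shows "(\<lambda>x. e x + \<kappa> x) \<in> basic"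
proof -
  have "(\<lambda>x. e x + \<kappa> x) \<in> sections S RE"
    using basicD(1)[OF e] sections_inD(1)[OF \<kappa>] ER.section_at_add unfolding ER.sections_iff by auto
  moreover have "e p + \<kappa> p \<in> P p" if "p \<in> C" for p
    using basicD(2)[OF e that] sections_inD(2)[OF \<kappa> that] K_P[OF that] subspace_add[OF P_subspace[OF that]] by blast
  moreover have "bracket E x1 x2 p \<in> K p"
    if h: "h \<in> sections_in E S K" "p \<in> C" "extends_near M E S p h x1" "extends_near M E S p (\<lambda>x. e x + \<kappa> x) x2"
    for h p x1 x2
  proof -
    note pM = C_M[OF h(2)]
    obtain x3 where x3: "extends_near M E S p \<kappa> x3"
      using extension_exists[OF sections_inD(1)[OF \<kappa>] h(2)] by blast
    have xs: "x1 \<in> sections M E" "x2 \<in> sections M E" "x3 \<in> sections M E"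
      using h x3 by (auto simp: extends_near_def)
    \<comment> \<open>An arbitrary extension of the sum does not come with a splitting. Subtracting
      an extension of \<open>\<kappa>\<close> leaves an extension of \<open>e\<close>.\<close>
    define x4 where "x4 y = x2 y + (-1) *\<^sub>R x3 y" for y
    have x4s: "x4 \<in> sections M E"
      unfolding EM.sections_iff x4_def
    proof (intro conjI ballI allI impI)
      fix z assume z: "z \<in> points M"
      then have "section_at M E z x2" "section_at M E z x3" using xs(2,3) EM.sections_iff by blast+
      then show "section_at M E z (\<lambda>y. x2 y + (-1) *\<^sub>R x3 y)"
        by (intro EM.section_at_add EM.section_at_scale smooth_at_const[OF atlas_M z])
    next
      fix z assume "z \<notin> points M"
      then have "x2 z = 0" "x3 z = 0" using xs(2,3) EM.sections_iff by blast+
      then show "x2 z + (-1) *\<^sub>R x3 z = 0" by simp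
    qed
    have "eventually (\<lambda>y. y \<in> C \<longrightarrow> x4 y = e y) (nbhds M p)"
      using h(4) x3 unfolding extends_near_iff[OF h(2)]
      by (auto simp: x4_def elim: eventually_elim2)
    then have x4: "extends_near M E S p e x4" using x4s unfolding extends_near_iff[OF h(2)] by blast
    have "x2 = (\<lambda>q. x4 q + x3 q)" by (simp add: x4_def fun_eq_iff)
    then have "bracket E x1 x2 p = bracket E x1 x4 p + bracket E x1 x3 p"
      using bracket_right[OF x4s xs(3,1) pM] by simp
    then show ?thesis
      using basic_bracket[OF e h(1,2,3) x4] bracket_sections_of_K[OF h(2,1) \<kappa> h(3) x3]
        subspace_add[OF K_subspace[OF h(2)]] by simp
  qed
  ultimately show ?thesis
    by (auto simp: basic_sections_def sections_in_def bracket_values_def)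
qed

lemma K_local_frame:
  assumes "p \<in> C"
  shows "\<exists>n W b. openin (mtopology S) W \<and> p \<in> W \<and> (\<forall>i<n. smooth_section_on S RE W (b i)) \<and>
    (\<forall>x\<in>W. is_basis n (\<lambda>i. b i x) (K x))"
proof -
  obtain n where "\<forall>p\<in>points S. \<exists>W b. openin (mtopology S) W \<and> p \<in> W \<and>
        (\<forall>i<n. smooth_section_on S RE W (b i)) \<and> (\<forall>x\<in>W. is_basis n (\<lambda>i. b i x) (K x))"
    using conjunct2[OF K_subbundle[unfolded subbundle_def]] by (elim exE)
  from bspec[OF this, of p] assms show ?thesis by (intro exI[of _ n]) simp
qed

text \<open>Lets orthogonality to \<open>K\<close> at a point be tested on sections of
  \<open>K\<close>, to which invariance of the pairing applies.\<close>

lemma section_of_K_through: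
  assumes p: "p \<in> C" and w: "w \<in> K p"
  shows "\<exists>\<kappa>\<in>sections_in E S K. \<kappa> p = w"
proof -
  obtain n W b where W: "openin (mtopology S) W" "p \<in> W" "\<forall>i<n. smooth_section_on S RE W (b i)"
    "\<forall>x\<in>W. is_basis n (\<lambda>i. b i x) (K x)" using K_local_frame[OF p] by (elim exE conjE)
  obtain c where c: "w = (\<Sum>i<n. c i *\<^sub>R b i p)" by (rule is_basis_obtain[OF bspec[OF W(4,2)] w])
  define s where "s x = (\<Sum>i<n. c i *\<^sub>R b i x)" for x
  have WC: "W \<subseteq> C" using openin_subset[OF W(1)] topspace_mtopology[OF atlas_S] by simp
  have at: "section_at S RE x s" if "x \<in> W" for x
  proof -
    have x: "x \<in> points S" using that WC by auto
    show ?thesis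
      unfolding s_def
    proof (intro ER.section_at_sum[OF x] ER.section_at_scale smooth_at_const[OF atlas_S x])
      fix i assume "i \<in> {..<n}"
      then show "section_at S RE x (b i)" unfolding section_at_def using W(1,3) that by blast
    qed
  qed
  have sK: "s x \<in> K x" if "x \<in> W" for x
    unfolding s_def by (rule is_basis_comb[OF bspec[OF W(4) that]])
  show ?thesis
  proof (rule bump_function_exists[OF smooth_manifold_S W(1,2)])
    fix \<rho> D
    assume r: "smooth_fun S \<rho>" "eventually (\<lambda>x. \<rho> x = 1) (nbhds S p)"
      "closedin (mtopology S) D" "D \<subseteq> W" "\<And>x. x \<notin> D \<Longrightarrow> \<rho> x = 0"
    let ?\<kappa> = "\<lambda>x. if x \<in> W then \<rho> x *\<^sub>R s x else 0"
    have "?\<kappa> \<in> sections S RE"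
      by (rule ER.cutoff_section[OF W(1) at r(3,4,5,1)])
    moreover have "?\<kappa> x \<in> K x" if "x \<in> C" for x
      using sK[of x] K_subspace[OF that] by (simp add: subspace_scale subspace_0)
    ultimately have "?\<kappa> \<in> sections_in E S K" by (simp add: sections_in_def)
    moreover have "\<rho> p = 1" using eventually_nbhds_self[OF atlas_S _ r(2)] p by simp
    then have "?\<kappa> p = w" using W(2) c by (simp add: s_def)
    ultimately show ?thesis by (intro bexI[of _ ?\<kappa>])
  qed
qed

text \<open>For \<open>\<kappa>\<close> in \<open>K\<close>,
  \<open>\<langle>e2, \<kappa>\<rangle> = 0\<close> on \<open>C\<close> gives
  \<open>\<langle>[e1, e2], \<kappa>\<rangle> = - \<langle>e2, [e1, \<kappa>]\<rangle>\<close>.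
  Basicness controls only the opposite order \<open>[\<kappa>, e1]\<close>; exchanging the arguments
  costs \<open>\<pi>(e2)\<langle>e1, \<kappa>\<rangle>\<close>, which is 0 because
  \<open>\<langle>e1, \<kappa>\<rangle>\<close> vanishes on \<open>C\<close>.\<close>

lemma bracket_basic_in_orth:
  assumes p: "p \<in> C" and e: "e1 \<in> basic" "e2 \<in> basic"
    and x: "extends_near M E S p e1 x1" "extends_near M E S p e2 x2"
  shows "bracket E x1 x2 p \<in> P p"
proof -
  note pM = C_M[OF p]
  have xs: "x1 \<in> sections M E" "x2 \<in> sections M E" using x by (auto simp: extends_near_def)
  have "g p (bracket E x1 x2 p) w = 0" if w: "w \<in> K p" for w
  proof -
    obtain \<kappa> where \<kappa>: "\<kappa> \<in> sections_in E S K" "\<kappa> p = w" using section_of_K_through[OF p w] by blast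
    obtain x3 where x3: "extends_near M E S p \<kappa> x3" using extension_exists[OF sections_inD(1)[OF \<kappa>(1)] p] by blast
    then have x3s: "x3 \<in> sections M E" by (auto simp: extends_near_def)
    have x3p: "x3 p = w" using extends_near_at[OF p x3] \<kappa>(2) by simp
    have x1P: "x1 p \<in> P p" and x2P: "x2 p \<in> P p"
      using extends_near_at[OF p x(1)] extends_near_at[OF p x(2)] basicD(2)[OF e(1) p] basicD(2)[OF e(2) p] by simp_all
    have x2f: "x2 p \<in> fibre E p" using x2P P_fibre by blast
    have van: "eventually (\<lambda>y. y \<in> C \<longrightarrow> g y (z y) (x3 y) = 0) (nbhds M p)"
      if z: "extends_near M E S p e z" "e \<in> basic" for e z
    proof -
      have "eventually (\<lambda>y. y \<in> C \<longrightarrow> z y = e y) (nbhds M p)" "eventually (\<lambda>y. y \<in> C \<longrightarrow> x3 y = \<kappa> y) (nbhds M p)"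
        using z x3 unfolding extends_near_iff[OF p] by auto
      then show ?thesis
        by eventually_elim (use g_P_K sections_inD(2)[OF \<kappa>(1)] basicD(2)[OF z(2)] in auto)
    qed
    have 1: "0 = g p (bracket E x1 x2 p) w + g p (x2 p) (bracket E x1 x3 p)"
      using metric_invariance[OF xs x3s pM] anchor_vanishing[OF p x1P van[OF x(2) e(2)]] x3p by simp
    have 2: "g p (bracket E x1 x3 p) (x2 p) + g p (bracket E x3 x1 p) (x2 p) = 0"
      using bracket_symmetric_part[OF xs(1) x3s pM x2f] anchor_vanishing[OF p x2P van[OF x(1) e(1)]] by simp
    have "bracket E x3 x1 p \<in> K p" by (rule basic_bracket[OF e(1) \<kappa>(1) p x3 x(1)])
    then have "g p (bracket E x3 x1 p) (x2 p) = 0" using g_K_P[OF p _ x2P] by blast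
    then have "g p (x2 p) (bracket E x1 x3 p) = 0"
      using 2 g_sym[OF pM x2f bracket_fibre[OF xs(1) x3s pM]] by simp
    then show ?thesis using 1 by simp
  qed
  then show ?thesis using bracket_fibre[OF xs pM] by (simp add: orth_def)
qed

end

section \<open>Correcting basic sections\<close>

context reduction
begin

abbreviation D where "D p \<equiv> P p \<inter> J p ` P p"

lemma J_endo: "bundle_endomorphism M E J"
  using gcs unfolding generalized_complex_structure_def by (elim conjE)

lemma J_lin: "p \<in> points M \<Longrightarrow> linear_on_space (fibre E p) (J p)"
  using J_endo by (simp add: bundle_endomorphism_def)

lemma J_fibre: "p \<in> points M \<Longrightarrow> v \<in> fibre E p \<Longrightarrow> J p v \<in> fibre E p"
  using J_endo unfolding bundle_endomorphism_def by blast

lemma J_orthogonal: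
  assumes "p \<in> points M" "v \<in> fibre E p" "w \<in> fibre E p"
  shows "g p (J p v) (J p w) = g p v w"
proof -
  have "\<forall>p\<in>points M. \<forall>v\<in>fibre E p. \<forall>w\<in>fibre E p. g p (J p v) (J p w) = g p v w"
    using gcs unfolding generalized_complex_structure_def by (elim conjE)
  from bspec[OF bspec[OF bspec[OF this assms(1)] assms(2)] assms(3)] show ?thesis .
qed

lemma J_square:
  assumes "p \<in> points M" "v \<in> fibre E p"
  shows "J p (J p v) = - v"
proof -
  have "\<forall>p\<in>points M. \<forall>v\<in>fibre E p. J p (J p v) = - v"
    using gcs unfolding generalized_complex_structure_def by (elim conjE)
  from bspec[OF bspec[OF this assms(1)] assms(2)] show ?thesis .
qed

lemma J_nijenhuis:
  assumes "e1 \<in> sections M E" "e2 \<in> sections M E" "p \<in> points M"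
  shows "nijenhuis M E J e1 e2 p = 0"
proof -
  have "\<forall>e1\<in>sections M E. \<forall>e2\<in>sections M E. \<forall>p\<in>points M. nijenhuis M E J e1 e2 p = 0"
    using gcs unfolding generalized_complex_structure_def by (elim conjE)
  from bspec[OF bspec[OF bspec[OF this assms(1)] assms(2)] assms(3)] show ?thesis .
qed

lemma J_uminus: "p \<in> points M \<Longrightarrow> v \<in> fibre E p \<Longrightarrow> J p (- v) = - J p v"
  by (rule linear_on_space_uminus[OF J_lin])

section \<open>Pointwise algebra of \<open>D\<close>\<close>

lemma J_skew:
  assumes p: "p \<in> points M" and v: "v \<in> fibre E p" and w: "w \<in> fibre E p"
  shows "g p v (J p w) = - g p (J p v) w"
proof -
  have "g p v (J p w) = g p (J p v) (J p (J p w))"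
    using J_orthogonal[OF p v J_fibre[OF p w]] by simp
  also have "\<dots> = - g p (J p v) w"
    unfolding J_square[OF p w] by (rule linear_on_space_uminus[OF g_lin[OF p J_fibre[OF p v]] w])
  finally show ?thesis .
qed

text \<open>As \<open>J\<close> is orthogonal, \<open>J P\<close> is the orthogonal of
  \<open>J K\<close>. This turns membership in \<open>D\<close> into linear equations for the
  correction.\<close>

lemma D_iff:
  assumes p: "p \<in> C" and v: "v \<in> P p"
  shows "v \<in> D p \<longleftrightarrow> (\<forall>w\<in>K p. g p v (J p w) = 0)"
proof -
  note pM = C_M[OF p]
  have vf: "v \<in> fibre E p" using v P_fibre by blast
  have wf: "w \<in> fibre E p" if "w \<in> K p" for w using that K_fibre[OF p] by blast
  show ?thesis
  proof
    assume "v \<in> D p"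
    then obtain u where u: "u \<in> P p" "v = J p u" by blast
    then show "\<forall>w\<in>K p. g p v (J p w) = 0"
      using J_orthogonal[OF pM _ wf] g_P_K P_fibre by (metis subsetD)
  next
    assume *: "\<forall>w\<in>K p. g p v (J p w) = 0"
    have "g p (J p v) w = 0" if "w \<in> K p" for w
      using J_skew[OF pM vf wf[OF that]] * that by simp
    then have "J p v \<in> P p"
      using J_fibre[OF pM vf] by (simp add: orth_def)
    then have "- J p v \<in> P p" by (rule subspace_neg[OF P_subspace[OF p]])
    moreover have "v = J p (- J p v)"
      using J_uminus[OF pM J_fibre[OF pM vf]] J_square[OF pM vf] by simp
    ultimately show "v \<in> D p" using v by blast
  qed
qed

lemma J_D:
  assumes p: "p \<in> C" and v: "v \<in> D p"
  shows "J p v \<in> D p"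
proof -
  note pM = C_M[OF p]
  obtain u where u: "u \<in> P p" "v = J p u" using v by blast
  have "J p v = - u" unfolding u(2) using J_square[OF pM] u(1) P_fibre by blast
  then have "J p v \<in> P p" using subspace_neg[OF P_subspace[OF p] u(1)] by simp
  then show ?thesis using v by blast
qed

text \<open>The left side is the radical of the skew form \<open>\<langle>v, J w\<rangle>\<close> on
  \<open>K\<close>, so the rank hypothesis of the theorem becomes the constant dimension required by
  \<open>smooth_linear_solution\<close>.\<close>

lemma K_D_eq:
  assumes p: "p \<in> C"
  shows "{v \<in> K p. \<forall>w\<in>K p. g p v (J p w) = 0} = J p ` K p \<inter> P p"
proof (intro set_eqI iffI)
  note pM = C_M[OF p]
  fix v assume v: "v \<in> J p ` K p \<inter> P p"
  then obtain u where u: "u \<in> K p" "v = J p u" by blast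
  have "v \<in> K p" using v JK p by blast
  moreover have "g p v (J p w) = 0" if "w \<in> K p" for w
    unfolding u(2) using J_orthogonal[OF pM] u(1) that K_fibre[OF p] g_K_P[OF p u(1)] K_P[OF p] by (metis subsetD)
  ultimately show "v \<in> {v \<in> K p. \<forall>w\<in>K p. g p v (J p w) = 0}" by blast
next
  note pM = C_M[OF p]
  fix v assume v: "v \<in> {v \<in> K p. \<forall>w\<in>K p. g p v (J p w) = 0}"
  then have vP: "v \<in> P p" and vf: "v \<in> fibre E p" using K_P[OF p] P_fibre by blast+
  have "v \<in> D p" using D_iff[OF p vP] v by blast
  then have "J p v \<in> J p ` K p \<inter> P p" using J_D[OF p] v by blast
  then have "J p v \<in> K p" using JK p by blast
  then have "- J p v \<in> K p" by (rule subspace_neg[OF K_subspace[OF p]])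
  moreover have "v = J p (- J p v)"
    using J_uminus[OF pM J_fibre[OF pM vf]] J_square[OF pM vf] by simp
  ultimately show "v \<in> J p ` K p \<inter> P p" using vP by blast
qed

lemma J_K_D: "p \<in> C \<Longrightarrow> v \<in> K p \<inter> D p \<Longrightarrow> J p v \<in> K p"
  using J_D[of p v] JK by blast

lemma D_sum:
  assumes p: "p \<in> C" and e: "e \<in> P p"
  shows "\<exists>k\<in>K p. e + k \<in> D p"
proof -
  note pM = C_M[OF p]
  obtain b where "nondegenerate_form (fibre E p) (g p) (fibre_dim E) b" by (rule form_at[OF pM])
  then interpret nondegenerate_form "fibre E p" "g p" "fibre_dim E" b .
  have "\<exists>k\<in>K p. e + k \<in> J p ` P p"
  proof (rule orthogonal_subset_sum[OF J_lin[OF pM] _ J_orthogonal[OF pM] J_square[OF pM] K_subspace[OF p] K_fibre[OF p] _ _ e])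
    show "J p ` fibre E p \<subseteq> fibre E p" using J_fibre[OF pM] by blast
    show "P p = {v \<in> fibre E p. \<forall>w\<in>K p. g p v w = 0}" by (simp add: orth_def)
    show "J p ` K p \<inter> P p \<subseteq> K p" using JK p by blast
  qed
  then show ?thesis
    using e K_P[OF p] subspace_add[OF P_subspace[OF p]] by blast
qed

section \<open>The correction equation, solved locally and globally\<close>

lemma section_at_J:
  assumes "section_at S RE p s"
  shows "section_at S RE p (\<lambda>x. J x (s x))"
proof -
  have p: "p \<in> C" using ER.section_at_point[OF assms] by simp
  obtain x where x: "x \<in> sections M E" "eventually (\<lambda>y. y \<in> C \<longrightarrow> x y = s y) (nbhds M p)"
    using section_at_extension[OF bundle_E assms] by blast
  have "section_at M E p x" using x(1) C_M[OF p] EM.sections_iff by blast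
  from section_at_restrict[OF bundle_E endomorphism_section_at[OF M bundle_E J_endo this] p]
  have "section_at S RE p (\<lambda>y. J y (x y))" .
  then show ?thesis
    by (rule ER.section_at_cong) (use x(2) in \<open>auto simp: eventually_nbhds_S[OF p] elim!: eventually_mono\<close>)
qed

lemma smooth_at_S_pairing:
  assumes "section_at S RE p s" "section_at S RE p t"
  shows "smooth_at S p (\<lambda>x. g x (s x) (t x))"
proof -
  have p: "p \<in> C" using ER.section_at_point[OF assms(1)] by simp
  obtain x where x: "x \<in> sections M E" "eventually (\<lambda>z. z \<in> C \<longrightarrow> x z = s z) (nbhds M p)"
    using section_at_extension[OF bundle_E assms(1)] by blast
  obtain y where y: "y \<in> sections M E" "eventually (\<lambda>z. z \<in> C \<longrightarrow> y z = t z) (nbhds M p)"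
    using section_at_extension[OF bundle_E assms(2)] by blast
  have "section_at M E p x" "section_at M E p y" using x(1) y(1) C_M[OF p] EM.sections_iff by blast+
  from smooth_at_S_of_M[OF pairing_smooth_at[OF M bundle_E metric_E this] p]
  have "smooth_at S p (\<lambda>z. g z (x z) (y z))" .
  then show ?thesis
  proof (rule smooth_at_cong[OF atlas_S])
    show "eventually (\<lambda>z. g z (x z) (y z) = g z (s z) (t z)) (nbhds S p)"
      unfolding eventually_nbhds_S[OF p] using x(2) y(2) by eventually_elim simp
  qed
qed

lemma local_correction:
  assumes e: "e \<in> sections_in E S P" and p: "p \<in> C"
  shows "\<exists>W \<kappa>. openin (mtopology S) W \<and> p \<in> W \<and>
     (\<forall>x\<in>W. section_at S RE x \<kappa> \<and> \<kappa> x \<in> K x \<and> (\<forall>w\<in>K x. g x (\<kappa> x) (J x w) = - g x (e x) (J x w)))"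
proof -
  obtain n W b where W: "openin (mtopology S) W" "p \<in> W" "\<forall>i<n. smooth_section_on S RE W (b i)"
    "\<forall>x\<in>W. is_basis n (\<lambda>i. b i x) (K x)" using K_local_frame[OF p] by (elim exE conjE)
  obtain d where d: "\<forall>p\<in>C. dim (J p ` K p \<inter> P p) = d" using rank by blast
  have WC: "W \<subseteq> C" using openin_subset[OF W(1)] topspace_mtopology[OF atlas_S] by simp
  have pS: "p \<in> points S" using p by simp
  have sec: "section_at S RE p (b i)" if "i < n" for i
    unfolding section_at_def using W(1,2,3) that by blast
  have es: "section_at S RE p e"
    using sections_inD(1)[OF e] pS ER.sections_iff by blast
  have span_K: "span ((\<lambda>i. b i x) ` {..<n}) = K x" if "x \<in> W" for x
    using W(4) that by (simp add: is_basis_def)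
  \<comment> \<open>Linearity and skewness are supplied on the whole fibre of \<open>E\<close>,
    since \<open>J\<close> need not preserve \<open>K\<close>; the system itself lives on the span
    of the frame of \<open>K\<close>.\<close>
  have "\<exists>\<kappa>. section_at S RE p \<kappa> \<and> eventually (\<lambda>x. \<kappa> x \<in> span ((\<lambda>i. b i x) ` {..<n}) \<and>
      (\<forall>w\<in>span ((\<lambda>i. b i x) ` {..<n}). g x (\<kappa> x) (J x w) = - g x (e x) (J x w))) (nbhds S p)"
  proof (rule ER.smooth_linear_solution[OF pS, where U="fibre E" and d=d and \<omega>="\<lambda>x v w. g x v (J x w)"
        and \<alpha>="\<lambda>x w. - g x (e x) (J x w)"])
    show "finite {..<n}" by simp
    show "section_at S RE p (b i)" if "i \<in> {..<n}" for i using sec that by simp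
    show "smooth_at S p (\<lambda>x. g x (b i x) (J x (b j x)))" if "i \<in> {..<n}" "j \<in> {..<n}" for i j
      using smooth_at_S_pairing[OF sec section_at_J[OF sec]] that by simp
    show "smooth_at S p (\<lambda>x. - g x (e x) (J x (b i x)))" if "i \<in> {..<n}" for i
      using smooth_at_uminus[OF atlas_S smooth_at_S_pairing[OF es section_at_J[OF sec]]] that by simp
    show "eventually (\<lambda>x. subspace (fibre E x) \<and>
        (\<forall>v\<in>fibre E x. linear_on_space (fibre E x) (\<lambda>w. g x v (J x w))) \<and>
        (\<forall>v\<in>fibre E x. \<forall>w\<in>fibre E x. g x v (J x w) = - g x w (J x v)) \<and>
        linear_on_space (fibre E x) (\<lambda>w. - g x (e x) (J x w)) \<and>
        (\<forall>i\<in>{..<n}. b i x \<in> fibre E x) \<and> lin_indep_family {..<n} (\<lambda>i. b i x) \<and>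
        dim {v \<in> span ((\<lambda>i. b i x) ` {..<n}). \<forall>w\<in>span ((\<lambda>i. b i x) ` {..<n}). g x v (J x w) = 0} = d \<and>
        (\<exists>v\<in>span ((\<lambda>i. b i x) ` {..<n}). \<forall>w\<in>span ((\<lambda>i. b i x) ` {..<n}). g x v (J x w) = - g x (e x) (J x w)))
      (nbhds S p)"
      using eventually_nbhds_open[OF W(1,2)]
    proof (rule eventually_mono)
      fix x assume x: "x \<in> W"
      then have xC: "x \<in> C" using WC by blast
      note xM = C_M[OF xC]
      have lin: "linear_on_space (fibre E x) (\<lambda>w. g x v (J x w))" if v: "v \<in> fibre E x" for v
        unfolding linear_on_space_def
      proof (intro ballI allI)
        fix w u a b assume wu: "w \<in> fibre E x" "u \<in> fibre E x"
        have "J x (a *\<^sub>R w + b *\<^sub>R u) = a *\<^sub>R J x w + b *\<^sub>R J x u"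
          using J_lin[OF xM] wu unfolding linear_on_space_def by blast
        then show "g x v (J x (a *\<^sub>R w + b *\<^sub>R u)) = a *\<^sub>R g x v (J x w) + b *\<^sub>R g x v (J x u)"
          using g_lin[OF xM v] J_fibre[OF xM wu(1)] J_fibre[OF xM wu(2)] unfolding linear_on_space_def by simp
      qed
      have eP: "e x \<in> P x" using sections_inD(2)[OF e xC] .
      then have ef: "e x \<in> fibre E x" using P_fibre by blast
      have 3: "g x v (J x w) = - g x w (J x v)" if vw: "v \<in> fibre E x" "w \<in> fibre E x" for v w
        using J_skew[OF xM vw] g_sym[OF xM J_fibre[OF xM vw(1)] vw(2)] by simp
      have 4: "linear_on_space (fibre E x) (\<lambda>w. - g x (e x) (J x w))"
        using lin[OF ef] unfolding linear_on_space_def by simp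
      have 5: "b i x \<in> fibre E x" if "i \<in> {..<n}" for i
      proof -
        have "b i x \<in> span ((\<lambda>i. b i x) ` {..<n})" using that by (intro span_base) blast
        then show ?thesis using span_K[OF x] K_fibre[OF xC] by blast
      qed
      have 6: "lin_indep_family {..<n} (\<lambda>i. b i x)"
        by (rule is_basis_lin_indep[OF bspec[OF W(4) x]])
      have 7: "dim {v \<in> K x. \<forall>w\<in>K x. g x v (J x w) = 0} = d"
        unfolding K_D_eq[OF xC] using d xC by blast
      \<comment> \<open>A degenerate form does not solve every equation. This one is solvable at
        each point because \<open>e x\<close> can be moved into \<open>D x\<close> by a vector of
        \<open>K x\<close>.\<close>
      have 8: "\<exists>v\<in>K x. \<forall>w\<in>K x. g x v (J x w) = - g x (e x) (J x w)"
      proof -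
        obtain k where k: "k \<in> K x" "e x + k \<in> D x" using D_sum[OF xC eP] by blast
        have kf: "k \<in> fibre E x" using k(1) K_fibre[OF xC] by blast
        have "g x k (J x w) = - g x (e x) (J x w)" if w: "w \<in> K x" for w
        proof -
          have Jw: "J x w \<in> fibre E x" using J_fibre[OF xM] w K_fibre[OF xC] by blast
          have "0 = g x (e x + k) (J x w)" using D_iff[OF xC, of "e x + k"] k(2) w by simp
          also have "\<dots> = g x (J x w) (e x + k)"
            using g_sym[OF xM _ Jw] subspace_add[OF EM.fibre_subspace[OF xM] ef kf] by blast
          also have "\<dots> = g x (J x w) (e x) + g x (J x w) k"
            by (rule linear_on_space_add[OF g_lin[OF xM Jw] ef kf])
          also have "\<dots> = g x (e x) (J x w) + g x k (J x w)"
            using g_sym[OF xM Jw ef] g_sym[OF xM Jw kf] by simp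
          finally show ?thesis by simp
        qed
        then show ?thesis using k(1) by blast
      qed
      show "subspace (fibre E x) \<and>
        (\<forall>v\<in>fibre E x. linear_on_space (fibre E x) (\<lambda>w. g x v (J x w))) \<and>
        (\<forall>v\<in>fibre E x. \<forall>w\<in>fibre E x. g x v (J x w) = - g x w (J x v)) \<and>
        linear_on_space (fibre E x) (\<lambda>w. - g x (e x) (J x w)) \<and>
        (\<forall>i\<in>{..<n}. b i x \<in> fibre E x) \<and> lin_indep_family {..<n} (\<lambda>i. b i x) \<and>
        dim {v \<in> span ((\<lambda>i. b i x) ` {..<n}). \<forall>w\<in>span ((\<lambda>i. b i x) ` {..<n}). g x v (J x w) = 0} = d \<and>
        (\<exists>v\<in>span ((\<lambda>i. b i x) ` {..<n}). \<forall>w\<in>span ((\<lambda>i. b i x) ` {..<n}). g x v (J x w) = - g x (e x) (J x w))"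
        unfolding span_K[OF x]
        by (intro conjI ballI EM.fibre_subspace[OF xM] lin 3 4 5 6 7 8)
    qed
  qed
  then obtain \<kappa> where \<kappa>: "section_at S RE p \<kappa>" "eventually (\<lambda>x. \<kappa> x \<in> span ((\<lambda>i. b i x) ` {..<n}) \<and>
      (\<forall>w\<in>span ((\<lambda>i. b i x) ` {..<n}). g x (\<kappa> x) (J x w) = - g x (e x) (J x w))) (nbhds S p)" by blast
  obtain W1 where W1: "openin (mtopology S) W1" "p \<in> W1" "smooth_section_on S RE W1 \<kappa>"
    using \<kappa>(1) unfolding section_at_def by blast
  obtain W2 where W2: "openin (mtopology S) W2" "p \<in> W2" "\<forall>x\<in>W2. \<kappa> x \<in> span ((\<lambda>i. b i x) ` {..<n}) \<and>
      (\<forall>w\<in>span ((\<lambda>i. b i x) ` {..<n}). g x (\<kappa> x) (J x w) = - g x (e x) (J x w))"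
    using \<kappa>(2) unfolding eventually_nbhds[OF atlas_S pS] by blast
  let ?W = "W \<inter> (W1 \<inter> W2)"
  have "\<forall>x\<in>?W. section_at S RE x \<kappa> \<and> \<kappa> x \<in> K x \<and> (\<forall>w\<in>K x. g x (\<kappa> x) (J x w) = - g x (e x) (J x w))"
  proof
    fix x assume x: "x \<in> ?W"
    have "section_at S RE x \<kappa>" unfolding section_at_def using W1(1,3) x by blast
    moreover have "\<kappa> x \<in> K x \<and> (\<forall>w\<in>K x. g x (\<kappa> x) (J x w) = - g x (e x) (J x w))"
      using W2(3) x span_K[of x] by auto
    ultimately show "section_at S RE x \<kappa> \<and> \<kappa> x \<in> K x \<and> (\<forall>w\<in>K x. g x (\<kappa> x) (J x w) = - g x (e x) (J x w))" by blast
  qed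
  moreover have "openin (mtopology S) ?W" "p \<in> ?W" using W(1,2) W1(1,2) W2(1,2) by auto
  ultimately show ?thesis by blast
qed

lemma global_correction:
  assumes e: "e \<in> sections_in E S P"
  shows "\<exists>\<kappa>\<in>sections_in E S K. \<forall>p\<in>C. e p + \<kappa> p \<in> D p"
\<comment> \<open>The partition of unity is indexed by a sequence of points of the manifold, so the
  empty submanifold is treated apart.\<close>
proof (cases "C = {}")
  case True
  then have "(\<lambda>x. 0) \<in> sections_in E S K"
    using ER.sections_iff[of "\<lambda>x. 0"] by (simp add: sections_in_def)
  then show ?thesis using True by blast
next
  case False
  obtain W \<kappa> where loc: "\<And>p. p \<in> C \<Longrightarrow> openin (mtopology S) (W p) \<and> p \<in> W p \<and>
     (\<forall>x\<in>W p. section_at S RE x (\<kappa> p) \<and> \<kappa> p x \<in> K x \<and> (\<forall>w\<in>K x. g x (\<kappa> p x) (J x w) = - g x (e x) (J x w)))"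
    using local_correction[OF e] by metis
  show ?thesis
  proof (rule partition_of_unity[OF smooth_manifold_S, of W])
    show "points S \<noteq> {}" using False by simp
    show "openin (mtopology S) (W p) \<and> p \<in> W p" if "p \<in> points S" for p using loc that by simp
    fix \<psi> :: "nat \<Rightarrow> 'm \<Rightarrow> real" and c :: "nat \<Rightarrow> 'm" and Z :: "nat \<Rightarrow> 'm set"
    assume c: "\<And>n. c n \<in> points S" and psi: "\<And>n. smooth_fun S (\<psi> n)"
      and Z: "\<And>n. closedin (mtopology S) (Z n)" "\<And>n. Z n \<subseteq> W (c n)" "\<And>n x. x \<notin> Z n \<Longrightarrow> \<psi> n x = 0"
      and fin: "\<And>p. p \<in> points S \<Longrightarrow> \<exists>N. eventually (\<lambda>x. (\<forall>n\<ge>N. \<psi> n x = 0) \<and> (\<Sum>n<N. \<psi> n x) = 1) (nbhds S p)"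
    define s where "s n x = (if x \<in> W (c n) then \<psi> n x *\<^sub>R \<kappa> (c n) x else 0)" for n x
    define t where "t x = (\<Sum>n | \<psi> n x \<noteq> 0. s n x)" for x
    have s_sec: "s n \<in> sections S RE" for n
      unfolding s_def using loc[of "c n"] c[of n]
      by (intro ER.cutoff_section[OF _ _ Z(1)[of n] Z(2)[of n] Z(3)[of _ n] psi[of n]]) auto
    have t_eq: "t x = (\<Sum>n<N. s n x)" if "\<forall>n\<ge>N. \<psi> n x = 0" for N x
      unfolding t_def
    proof (rule sum.mono_neutral_left)
      show "{n. \<psi> n x \<noteq> 0} \<subseteq> {..<N}" using that not_le by auto
      show "\<forall>n\<in>{..<N} - {n. \<psi> n x \<noteq> 0}. s n x = 0" by (simp add: s_def)
    qed simp
    have sK: "s n x \<in> K x" if "x \<in> C" for n x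
      using loc[of "c n"] c[of n] K_subspace[OF that] by (simp add: s_def subspace_scale subspace_0)
    have t_sec: "t \<in> sections S RE"
      unfolding ER.sections_iff
    proof (intro conjI ballI allI impI)
      fix p assume p: "p \<in> points S"
      obtain N where N: "eventually (\<lambda>x. (\<forall>n\<ge>N. \<psi> n x = 0) \<and> (\<Sum>n<N. \<psi> n x) = 1) (nbhds S p)"
        using fin[OF p] by blast
      have "section_at S RE p (s n)" for n
        using s_sec p ER.sections_iff by blast
      then have "section_at S RE p (\<lambda>x. \<Sum>n<N. s n x)"
        by (intro ER.section_at_sum[OF p])
      then show "section_at S RE p t"
        by (rule ER.section_at_cong) (use N t_eq in \<open>auto elim!: eventually_mono\<close>)
    next
      fix p assume "p \<notin> points S"
      then have "s n p = 0" for n using s_sec ER.sections_iff by blast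
      then show "t p = 0" by (simp add: t_def)
    qed
    have t_prop: "t x \<in> K x \<and> (\<forall>w\<in>K x. g x (t x) (J x w) = - g x (e x) (J x w))" if x: "x \<in> C" for x
    proof -
      note xM = C_M[OF x]
      have xS: "x \<in> points S" using x by simp
      obtain N where N: "(\<forall>n\<ge>N. \<psi> n x = 0) \<and> (\<Sum>n<N. \<psi> n x) = 1"
        using fin[OF xS] eventually_nbhds_self[OF atlas_S xS] by blast
      have t: "t x = (\<Sum>n<N. s n x)" using t_eq N by blast
      have "t x \<in> K x" unfolding t by (intro subspace_sum[OF K_subspace[OF x]] sK[OF x])
      moreover have "g x (t x) (J x w) = - g x (e x) (J x w)" if w: "w \<in> K x" for w
      proof -
        have Jw: "J x w \<in> fibre E x" using J_fibre[OF xM] w K_fibre[OF x] by blast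
        have sf: "s n x \<in> fibre E x" for n using sK[OF x] K_fibre[OF x] by blast
        \<comment> \<open>All local solutions satisfy the same equation, so the weights multiply a
          common right side and, summing to 1, disappear from the total.\<close>
        have summand: "g x (J x w) (s n x) = \<psi> n x * (- g x (e x) (J x w))" for n
        proof (cases "x \<in> W (c n)")
          case True
          have cn: "c n \<in> C" using c[of n] by simp
          have kp: "\<kappa> (c n) x \<in> K x" "g x (\<kappa> (c n) x) (J x w) = - g x (e x) (J x w)"
            using loc[OF cn] True w by blast+
          have kf: "\<kappa> (c n) x \<in> fibre E x" using kp(1) K_fibre[OF x] by blast
          have "g x (J x w) (s n x) = \<psi> n x *\<^sub>R g x (J x w) (\<kappa> (c n) x)"
            using True linear_on_space_scale[OF g_lin[OF xM Jw] kf] by (simp add: s_def)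
          then show ?thesis using g_sym[OF xM Jw kf] kp(2) by simp
        next
          case False
          then have "\<psi> n x = 0" using Z(2,3) by blast
          then show ?thesis
            using False linear_on_space_zero[OF g_lin[OF xM Jw] EM.fibre_subspace[OF xM]] by (simp add: s_def)
        qed
        have "g x (t x) (J x w) = g x (J x w) (\<Sum>n<N. 1 *\<^sub>R s n x)"
          using g_sym[OF xM _ Jw, of "t x"] \<open>t x \<in> K x\<close> K_fibre[OF x] t by auto
        also have "\<dots> = (\<Sum>n<N. 1 *\<^sub>R g x (J x w) (s n x))"
          by (rule linear_on_space_sum[OF g_lin[OF xM Jw] EM.fibre_subspace[OF xM] _ sf]) simp
        also have "\<dots> = (\<Sum>n<N. \<psi> n x) * (- g x (e x) (J x w))"
          unfolding sum_distrib_right using summand by simp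
        finally show ?thesis using N by simp
      qed
      ultimately show ?thesis by blast
    qed
    show ?thesis
    proof (intro bexI ballI)
      show "t \<in> sections_in E S K" using t_sec t_prop by (simp add: sections_in_def)
      fix p assume p: "p \<in> C"
      note pM = C_M[OF p]
      have eP: "e p \<in> P p" using sections_inD(2)[OF e p] .
      have tP: "t p \<in> P p" using t_prop[OF p] K_P[OF p] by blast
      have f: "e p \<in> fibre E p" "t p \<in> fibre E p" using eP tP P_fibre by blast+
      have etP: "e p + t p \<in> P p" by (rule subspace_add[OF P_subspace[OF p] eP tP])
      have "g p (e p + t p) (J p w) = 0" if w: "w \<in> K p" for w
      proof -
        have Jw: "J p w \<in> fibre E p" using J_fibre[OF pM] w K_fibre[OF p] by blast
        have "g p (e p + t p) (J p w) = g p (J p w) (e p + t p)"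
          using g_sym[OF pM _ Jw] etP P_fibre by blast
        also have "\<dots> = g p (J p w) (e p) + g p (J p w) (t p)"
          by (rule linear_on_space_add[OF g_lin[OF pM Jw] f])
        also have "\<dots> = g p (e p) (J p w) + g p (t p) (J p w)"
          using g_sym[OF pM Jw f(1)] g_sym[OF pM Jw f(2)] by simp
        finally show ?thesis using t_prop[OF p] w by simp
      qed
      then show "e p + t p \<in> D p" using D_iff[OF p etP] by blast
    qed
  qed
qed

text \<open>The correction is invisible in the quotient, as \<open>\<Phi>\<close> kills
  \<open>K\<close>, but brings the section into the range where the hypothesis on \<open>J\<close>
  applies.\<close>

lemma basic_correction:
  assumes e: "e \<in> basic"
  shows "\<exists>e'\<in>basic. \<forall>p\<in>C. e' p \<in> D p \<and> e' p - e p \<in> K p"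
proof -
  have "e \<in> sections_in E S P" using e by (simp add: basic_sections_def)
  then obtain \<kappa> where \<kappa>: "\<kappa> \<in> sections_in E S K" "\<forall>p\<in>C. e p + \<kappa> p \<in> D p"
    using global_correction by blast
  show ?thesis
    using basic_add_section_of_K[OF e \<kappa>(1)] \<kappa>(2) sections_inD(2)[OF \<kappa>(1)]
    by (intro bexI[of _ "\<lambda>x. e x + \<kappa> x"]) auto
qed

lemma J_of_basic:
  assumes "e \<in> basic" "\<forall>p\<in>C. e p \<in> D p"
  shows "apply_endo S J e \<in> basic"
proof -
  have "\<forall>p\<in>C. e p \<in> J p ` P p \<inter> P p" using assms(2) by blast
  then show ?thesis using J_basic assms(1) by blast
qed

end

section \<open>The reduced structure\<close>

context reduction
begin

lemma exact_B: "exact_courant_algebroid Q B"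
  and Phi_fibre: "\<forall>p\<in>C. linear_on_space (P p) (\<Phi> p) \<and> \<Phi> p ` P p = fibre B (q p) \<and> {v \<in> P p. \<Phi> p v = 0} = K p"
  and identification: "\<forall>p\<in>C. \<forall>p'\<in>C. q p = q p' \<longrightarrow> (\<forall>v\<in>P p. \<forall>v'\<in>P p'.
           \<Phi> p v = \<Phi> p' v' \<longleftrightarrow> (\<exists>e\<in>basic. v - e p \<in> K p \<and> v' - e p' \<in> K p'))"
  and basic_descends: "\<forall>e\<in>basic. \<exists>s\<in>sections Q B. section_maps_to S q \<Phi> e s"
  and section_lifts: "\<forall>s\<in>sections Q B. \<exists>e\<in>basic. section_maps_to S q \<Phi> e s"
  and Phi_pairing: "\<forall>p\<in>C. \<forall>v\<in>P p. \<forall>w\<in>P p. pairing B (q p) (\<Phi> p v) (\<Phi> p w) = g p v w"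
  and Phi_bracket: "\<forall>e1\<in>basic. \<forall>e2\<in>basic. \<forall>s1\<in>sections Q B. \<forall>s2\<in>sections Q B.
        section_maps_to S q \<Phi> e1 s1 \<longrightarrow> section_maps_to S q \<Phi> e2 s2 \<longrightarrow>
        (\<forall>p\<in>C. \<forall>x\<in>bracket_values M E S e1 e2 p. \<Phi> p x = bracket B s1 s2 (q p))"
proof -
  note R = reduced[unfolded reduced_courant_algebroid_def points_S]
  show "exact_courant_algebroid Q B" by (rule conjunct1[OF R])
  note R1 = conjunct2[OF R]
  show "\<forall>p\<in>C. linear_on_space (P p) (\<Phi> p) \<and> \<Phi> p ` P p = fibre B (q p) \<and> {v \<in> P p. \<Phi> p v = 0} = K p"
    by (rule conjunct1[OF R1])
  note R2 = conjunct2[OF R1]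
  show "\<forall>p\<in>C. \<forall>p'\<in>C. q p = q p' \<longrightarrow> (\<forall>v\<in>P p. \<forall>v'\<in>P p'.
           \<Phi> p v = \<Phi> p' v' \<longleftrightarrow> (\<exists>e\<in>basic. v - e p \<in> K p \<and> v' - e p' \<in> K p'))"
    by (rule conjunct1[OF R2])
  note R3 = conjunct2[OF R2]
  show "\<forall>e\<in>basic. \<exists>s\<in>sections Q B. section_maps_to S q \<Phi> e s" by (rule conjunct1[OF R3])
  note R4 = conjunct2[OF R3]
  show "\<forall>s\<in>sections Q B. \<exists>e\<in>basic. section_maps_to S q \<Phi> e s" by (rule conjunct1[OF R4])
  note R5 = conjunct2[OF R4]
  show "\<forall>p\<in>C. \<forall>v\<in>P p. \<forall>w\<in>P p. pairing B (q p) (\<Phi> p v) (\<Phi> p w) = g p v w" by (rule conjunct1[OF R5])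
  note R6 = conjunct2[OF conjunct2[OF R5]]
  show "\<forall>e1\<in>basic. \<forall>e2\<in>basic. \<forall>s1\<in>sections Q B. \<forall>s2\<in>sections Q B.
        section_maps_to S q \<Phi> e1 s1 \<longrightarrow> section_maps_to S q \<Phi> e2 s2 \<longrightarrow>
        (\<forall>p\<in>C. \<forall>x\<in>bracket_values M E S e1 e2 p. \<Phi> p x = bracket B s1 s2 (q p))"
    by (rule R6)
qed

section \<open>Fibres of the reduced bundle as quotients of \<open>D\<close>\<close>

lemma bundle_B: "vector_bundle Q B"
  using exact_B unfolding exact_courant_algebroid_def courant_algebroid_def by (elim conjE)

sublocale BQ: vbundle_over Q B
  using smooth_Q bundle_B by unfold_locales

lemma q_surjective: "l \<in> points Q \<Longrightarrow> \<exists>p. p \<in> C \<and> q p = l"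
  unfolding q_onto[symmetric] by blast

lemma Phi_lin: "p \<in> C \<Longrightarrow> linear_on_space (P p) (\<Phi> p)"
  and Phi_onto: "p \<in> C \<Longrightarrow> \<Phi> p ` P p = fibre B (q p)"
  and Phi_kernel: "p \<in> C \<Longrightarrow> {v \<in> P p. \<Phi> p v = 0} = K p"
  using conjunct1[OF bspec[OF Phi_fibre, of p]] conjunct1[OF conjunct2[OF bspec[OF Phi_fibre, of p]]]
    conjunct2[OF conjunct2[OF bspec[OF Phi_fibre, of p]]] by simp_all

lemma Phi_in: "p \<in> C \<Longrightarrow> v \<in> P p \<Longrightarrow> \<Phi> p v \<in> fibre B (q p)"
  using imageI[of v "P p" "\<Phi> p"] by (simp add: Phi_onto)

lemma Phi_eq:
  assumes p: "p \<in> C" and uv: "u \<in> P p" "v \<in> P p" and "u - v \<in> K p"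
  shows "\<Phi> p u = \<Phi> p v"
proof -
  have "\<Phi> p (u - v) = 0" using Phi_kernel[OF p] assms(4) by blast
  then show ?thesis using linear_on_space_diff[OF Phi_lin[OF p] uv] by simp
qed

lemma D_combination:
  assumes p: "p \<in> C" and v: "v \<in> D p" and w: "w \<in> D p"
  shows "a *\<^sub>R v + b *\<^sub>R w \<in> D p" "J p (a *\<^sub>R v + b *\<^sub>R w) = a *\<^sub>R J p v + b *\<^sub>R J p w"
proof -
  note pM = C_M[OF p]
  have lin: "J p (a *\<^sub>R x + b *\<^sub>R y) = a *\<^sub>R J p x + b *\<^sub>R J p y" if "x \<in> P p" "y \<in> P p" for x y
    using J_lin[OF pM] that P_fibre unfolding linear_on_space_def by blast
  obtain x y where xy: "x \<in> P p" "v = J p x" "y \<in> P p" "w = J p y" using v w by blast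
  have in_P: "a *\<^sub>R x + b *\<^sub>R y \<in> P p" if "x \<in> P p" "y \<in> P p" for x y
    using that by (intro subspace_add[OF P_subspace[OF p]] subspace_scale[OF P_subspace[OF p]])
  have "a *\<^sub>R v + b *\<^sub>R w = J p (a *\<^sub>R x + b *\<^sub>R y)" using lin[OF xy(1,3)] xy by simp
  then have "a *\<^sub>R v + b *\<^sub>R w \<in> J p ` P p" using in_P[OF xy(1,3)] by blast
  then show "a *\<^sub>R v + b *\<^sub>R w \<in> D p" using in_P v w by blast
  show "J p (a *\<^sub>R v + b *\<^sub>R w) = a *\<^sub>R J p v + b *\<^sub>R J p w" using lin v w by blast
qed

text \<open>\<open>P = D + K\<close>, and \<open>\<Phi>\<close> vanishes on \<open>K\<close>; hence
  every element downstairs has a representative on which \<open>J\<close> can act.\<close>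

lemma D_onto:
  assumes p: "p \<in> C" and x: "x \<in> fibre B (q p)"
  shows "\<exists>v\<in>D p. \<Phi> p v = x"
proof -
  obtain v where v: "v \<in> P p" "\<Phi> p v = x" using x unfolding Phi_onto[OF p, symmetric] by blast
  obtain k where k: "k \<in> K p" "v + k \<in> D p" using D_sum[OF p v(1)] by blast
  have "\<Phi> p (v + k) = \<Phi> p v" using k v(1) by (intro Phi_eq[OF p]) auto
  then show ?thesis using k(2) v(2) by blast
qed

text \<open>The difference of two representatives lies in \<open>K \<inter> D\<close>, which
  \<open>J\<close> maps into \<open>K\<close>.\<close>

lemma Phi_J_eq:
  assumes p: "p \<in> C" and v: "v \<in> D p" and w: "w \<in> D p" and vw: "v - w \<in> K p"
  shows "\<Phi> p (J p v) = \<Phi> p (J p w)"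
proof (rule Phi_eq[OF p])
  show "J p v \<in> P p" "J p w \<in> P p" using J_D[OF p] v w by blast+
  have "v - w \<in> D p" "J p (v - w) = J p v - J p w"
    using D_combination[OF p v w, of 1 "-1"] by simp_all
  then show "J p v - J p w \<in> K p" using J_K_D[OF p, of "v - w"] vw by simp
qed

text \<open>A basic section joining the two vectors, corrected by a section of \<open>K\<close> so as to take
  values in \<open>J K\<^sup>\<bottom> \<inter> K\<^sup>\<bottom>\<close>, stays basic after applying \<open>J\<close>.\<close>

lemma Phi_J_well_defined:
  assumes p: "p \<in> C" "p' \<in> C" "q p = q p'" and v: "v \<in> D p" "v' \<in> D p'" and eq: "\<Phi> p v = \<Phi> p' v'"
  shows "\<Phi> p (J p v) = \<Phi> p' (J p' v')"
proof -
  have vP: "v \<in> P p" "v' \<in> P p'" using v by auto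
  have iff: "\<Phi> p x = \<Phi> p' x' \<longleftrightarrow> (\<exists>e\<in>basic. x - e p \<in> K p \<and> x' - e p' \<in> K p')" if "x \<in> P p" "x' \<in> P p'" for x x'
    using identification[rule_format, OF p that] .
  obtain e where e: "e \<in> basic" "v - e p \<in> K p" "v' - e p' \<in> K p'" using iff[OF vP] eq by blast
  obtain e' where e': "e' \<in> basic" "\<forall>p\<in>C. e' p \<in> D p \<and> e' p - e p \<in> K p" using basic_correction[OF e(1)] by blast
  let ?f = "apply_endo S J e'"
  have f: "?f \<in> basic" using J_of_basic[OF e'(1)] e'(2) by blast
  have fp: "?f x = J x (e' x)" if "x \<in> C" for x using that by (simp add: apply_endo_def)
  have "v - e' p = (v - e p) - (e' p - e p)" "v' - e' p' = (v' - e p') - (e' p' - e p')" by simp_all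
  then have "v - e' p \<in> K p" "v' - e' p' \<in> K p'"
    using e e' p subspace_diff[OF K_subspace] by metis+
  then have "\<Phi> p (J p v) = \<Phi> p (?f p)" "\<Phi> p' (J p' v') = \<Phi> p' (?f p')"
    using Phi_J_eq[OF p(1) v(1)] Phi_J_eq[OF p(2) v(2)] e'(2) p fp by simp_all
  \<comment> \<open>The basic section \<open>?f\<close> itself witnesses the identification of its
    two values.\<close>
  moreover have "\<Phi> p (?f p) = \<Phi> p' (?f p')"
  proof -
    have "?f p - ?f p \<in> K p" "?f p' - ?f p' \<in> K p'"
      using subspace_0[OF K_subspace[OF p(1)]] subspace_0[OF K_subspace[OF p(2)]] by simp_all
    then show ?thesis using iff[OF basicD(2)[OF f p(1)] basicD(2)[OF f p(2)]] f by blast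
  qed
  ultimately show ?thesis by simp
qed

text \<open>Neither choice matters: \<open>Phi_J_well_defined\<close> covers both another point over
  \<open>l\<close> and another representative in \<open>D\<close>.\<close>

definition J' :: "'n \<Rightarrow> 'w \<Rightarrow> 'w" where
  "J' l x = (let p = (SOME p. p \<in> C \<and> q p = l) in \<Phi> p (J p (SOME v. v \<in> D p \<and> \<Phi> p v = x)))"

lemma J'_Phi:
  assumes p: "p \<in> C" and v: "v \<in> D p"
  shows "J' (q p) (\<Phi> p v) = \<Phi> p (J p v)"
proof -
  define p' where "p' = (SOME p'. p' \<in> C \<and> q p' = q p)"
  have p': "p' \<in> C \<and> q p' = q p"
    unfolding p'_def by (rule someI[of _ p]) (use p in simp)
  have "\<Phi> p v \<in> fibre B (q p')" using Phi_in[OF p] v p' by auto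
  then obtain v0 where v0: "v0 \<in> D p'" "\<Phi> p' v0 = \<Phi> p v" using D_onto p' by blast
  define v' where "v' = (SOME v'. v' \<in> D p' \<and> \<Phi> p' v' = \<Phi> p v)"
  have v': "v' \<in> D p' \<and> \<Phi> p' v' = \<Phi> p v"
    unfolding v'_def by (rule someI[of _ v0]) (use v0 in simp)
  have "J' (q p) (\<Phi> p v) = \<Phi> p' (J p' v')"
    unfolding J'_def Let_def p'_def[symmetric] v'_def[symmetric] ..
  also have "\<dots> = \<Phi> p (J p v)"
    by (rule Phi_J_well_defined) (use p v p' v' in auto)
  finally show ?thesis .
qed

lemma fibre_B_obtain:
  assumes "l \<in> points Q" "x \<in> fibre B l"
  shows "\<exists>p v. p \<in> C \<and> q p = l \<and> v \<in> D p \<and> \<Phi> p v = x"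
proof -
  obtain p where p: "p \<in> C" "q p = l" using q_surjective[OF assms(1)] by blast
  then show ?thesis using D_onto[OF p(1), of x] assms(2) by blast
qed

text \<open>Smoothness of \<open>J'\<close> comes from upstairs: lift to a basic section, correct it
  into \<open>D\<close>, apply \<open>J\<close>, and descend, since basic sections descend to smooth
  ones. The lift is returned as well, for the bracket computation.\<close>

lemma J'_section:
  assumes s: "s \<in> sections Q B"
  shows "\<exists>e\<in>basic. (\<forall>p\<in>C. e p \<in> D p) \<and> section_maps_to S q \<Phi> e s \<and>
    apply_endo Q J' s \<in> sections Q B \<and> section_maps_to S q \<Phi> (apply_endo S J e) (apply_endo Q J' s)"
proof -
  obtain e where e: "e \<in> basic" "section_maps_to S q \<Phi> e s" using section_lifts s by blast
  obtain e' where e': "e' \<in> basic" "\<forall>p\<in>C. e' p \<in> D p \<and> e' p - e p \<in> K p" using basic_correction[OF e(1)] by blast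
  have es: "\<Phi> p (e' p) = s (q p)" if p: "p \<in> C" for p
  proof -
    have "\<Phi> p (e' p) = \<Phi> p (e p)"
      by (rule Phi_eq[OF p basicD(2)[OF e'(1) p] basicD(2)[OF e(1) p]]) (use e'(2) p in blast)
    then show ?thesis using e(2) p by (simp add: section_maps_to_def)
  qed
  have "apply_endo S J e' \<in> basic" using J_of_basic[OF e'(1)] e'(2) by blast
  then obtain t where t: "t \<in> sections Q B" "section_maps_to S q \<Phi> (apply_endo S J e') t"
    using basic_descends by blast
  have "apply_endo Q J' s l = t l" for l
  proof (cases "l \<in> points Q")
    case True
    then obtain p where p: "p \<in> C" "q p = l" using q_surjective by blast
    have "t l = \<Phi> p (J p (e' p))" using t(2) p by (simp add: section_maps_to_def apply_endo_def)
    also have "\<dots> = J' l (s l)"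
      using J'_Phi[OF p(1), of "e' p"] e'(2) p es[OF p(1)] by simp
    finally show ?thesis using True by (simp add: apply_endo_def)
  next
    \<comment> \<open>Off the base both sides are 0 by the normalisation of global sections.\<close>
    case False
    then show ?thesis using t(1) by (simp add: apply_endo_def sections_def)
  qed
  then have "apply_endo Q J' s = t" by (rule ext)
  then show ?thesis using e' t es by (intro bexI[of _ e']) (auto simp: section_maps_to_def)
qed

lemma J'_fibre: "l \<in> points Q \<Longrightarrow> x \<in> fibre B l \<Longrightarrow> J' l x \<in> fibre B l"
proof -
  assume "l \<in> points Q" "x \<in> fibre B l"
  then obtain p v where pv: "p \<in> C" "q p = l" "v \<in> D p" "\<Phi> p v = x" using fibre_B_obtain by blast
  then have "J' l x = \<Phi> p (J p v)" using J'_Phi[OF pv(1,3)] by simp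
  moreover have "J p v \<in> P p" using J_D[OF pv(1,3)] by blast
  ultimately show "J' l x \<in> fibre B l" using Phi_in[OF pv(1)] pv(2) by auto
qed

lemma J'_lin:
  assumes l: "l \<in> points Q"
  shows "linear_on_space (fibre B l) (J' l)"
  unfolding linear_on_space_def
proof (intro ballI allI)
  fix x y a b assume xy: "x \<in> fibre B l" "y \<in> fibre B l"
  obtain p v where pv: "p \<in> C" "q p = l" "v \<in> D p" "\<Phi> p v = x" using fibre_B_obtain[OF l xy(1)] by blast
  obtain w where w: "w \<in> D p" "\<Phi> p w = y" using D_onto[OF pv(1), of y] xy(2) pv(2) by blast
  have Plin: "\<Phi> p (a *\<^sub>R u + b *\<^sub>R z) = a *\<^sub>R \<Phi> p u + b *\<^sub>R \<Phi> p z" if "u \<in> P p" "z \<in> P p" for u z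
    using Phi_lin[OF pv(1)] that unfolding linear_on_space_def by blast
  note comb = D_combination[OF pv(1,3) w(1), of a b]
  have JP: "J p v \<in> P p" "J p w \<in> P p" using J_D[OF pv(1)] pv(3) w(1) by blast+
  have "J' l (a *\<^sub>R x + b *\<^sub>R y) = J' (q p) (\<Phi> p (a *\<^sub>R v + b *\<^sub>R w))"
    using Plin[of v w] pv w by auto
  also have "\<dots> = \<Phi> p (J p (a *\<^sub>R v + b *\<^sub>R w))" by (rule J'_Phi[OF pv(1) comb(1)])
  also have "\<dots> = a *\<^sub>R \<Phi> p (J p v) + b *\<^sub>R \<Phi> p (J p w)" unfolding comb(2) by (rule Plin[OF JP])
  also have "\<dots> = a *\<^sub>R J' l x + b *\<^sub>R J' l y"
    using J'_Phi[OF pv(1,3)] J'_Phi[OF pv(1) w(1)] pv(2,4) w(2) by simp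
  finally show "J' l (a *\<^sub>R x + b *\<^sub>R y) = a *\<^sub>R J' l x + b *\<^sub>R J' l y" .
qed

lemma section_at_J':
  assumes "section_at Q B l s"
  shows "section_at Q B l (\<lambda>x. J' x (s x))"
proof -
  obtain x where x: "x \<in> sections Q B" "eventually (\<lambda>y. x y = s y) (nbhds Q l)"
    by (rule BQ.section_at_globalize[OF assms])
  have "apply_endo Q J' x \<in> sections Q B" using J'_section[OF x(1)] by blast
  then have "section_at Q B l (apply_endo Q J' x)"
    using BQ.sections_iff BQ.section_at_point[OF assms] by blast
  then show ?thesis
  proof (rule BQ.section_at_cong)
    show "eventually (\<lambda>y. apply_endo Q J' x y = J' y (s y)) (nbhds Q l)"
      using x(2) eventually_nbhds_points[OF BQ.atlas_N] by eventually_elim (simp add: apply_endo_def)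
  qed
qed

text \<open>Matrix entries are chosen pointwise in a frame. Uniqueness of coordinates identifies
  them with the smooth coefficients of the image of a frame member.\<close>

lemma J'_endomorphism: "bundle_endomorphism Q B J'"
proof -
  have frames: "\<exists>h. (\<forall>i<fibre_dim B. \<forall>j<fibre_dim B. smooth_fun_on Q U (h i j)) \<and>
        (\<forall>l\<in>U. \<forall>j<fibre_dim B. J' l (b j l) = (\<Sum>i<fibre_dim B. h i j l *\<^sub>R b i l))"
    if b: "(U, b) \<in> frames B" for U b
  proof -
    note op = BQ.frame_open[OF b]
    have UQ: "l \<in> points Q" if "l \<in> U" for l
      using openin_subset[OF op] that topspace_mtopology[OF BQ.atlas_N] by auto
    have "\<exists>c. J' l (b j l) = (\<Sum>i<fibre_dim B. c i *\<^sub>R b i l)" if lj: "l \<in> U" "j < fibre_dim B" for j l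
    proof -
      have "b j l \<in> fibre B l"
        using BQ.section_at_fibre[OF BQ.section_at_frame[OF b lj]] .
      then have "J' l (b j l) \<in> fibre B l" by (rule J'_fibre[OF UQ[OF lj(1)]])
      then obtain c where "J' l (b j l) = (\<Sum>i<fibre_dim B. c i *\<^sub>R b i l)"
        by (rule is_basis_obtain[OF BQ.frame_basis[OF b lj(1)]])
      then show ?thesis by blast
    qed
    then obtain h where h: "\<And>l j. l \<in> U \<Longrightarrow> j < fibre_dim B \<Longrightarrow> J' l (b j l) = (\<Sum>i<fibre_dim B. h l j i *\<^sub>R b i l)"
      by metis
    have "smooth_fun_on Q U (\<lambda>l. h l j i)" if ij: "i < fibre_dim B" "j < fibre_dim B" for i j
      unfolding smooth_fun_on_iff_smooth_at[OF BQ.atlas_N op]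
    proof
      fix l assume l: "l \<in> U"
      have "section_at Q B l (\<lambda>x. J' x (b j x))"
        by (rule section_at_J'[OF BQ.section_at_frame[OF b l ij(2)]])
      then obtain a where a: "\<forall>i<fibre_dim B. smooth_at Q l (a i)"
        "eventually (\<lambda>x. J' x (b j x) = (\<Sum>i<fibre_dim B. a i x *\<^sub>R b i x)) (nbhds Q l)"
        unfolding BQ.section_at_iff_frame[OF b l] by (elim exE conjE)
      have "eventually (\<lambda>x. a i x = h x j i) (nbhds Q l)"
        using a(2) eventually_nbhds_open[OF op l]
      proof eventually_elim
        case (elim x)
        show ?case
          by (rule is_basis_unique[OF BQ.frame_basis[OF b elim(2)] _ ij(1)])
            (use elim(1) h[OF elim(2) ij(2)] in simp)
      qed
      then show "smooth_at Q l (\<lambda>l. h l j i)"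
        by (rule smooth_at_cong[OF BQ.atlas_N a(1)[rule_format, OF ij(1)]])
    qed
    then show ?thesis using h by (intro exI[of _ "\<lambda>i j l. h l j i"]) blast
  qed
  have "J' l ` fibre B l \<subseteq> fibre B l" if "l \<in> points Q" for l
    using J'_fibre[OF that] by blast
  moreover have "case f of (U, b) \<Rightarrow> \<exists>h. (\<forall>i<fibre_dim B. \<forall>j<fibre_dim B. smooth_fun_on Q U (h i j)) \<and>
        (\<forall>p\<in>U. \<forall>j<fibre_dim B. J' p (b j p) = (\<Sum>i<fibre_dim B. h i j p *\<^sub>R b i p))" if "f \<in> frames B" for f
    using frames[of "fst f" "snd f"] that by (simp add: split_beta)
  ultimately show ?thesis
    unfolding bundle_endomorphism_def using J'_lin by blast
qed

section \<open>Integrability of the reduced structure\<close>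

lemma bracket_B:
  assumes p: "p \<in> C" and e: "e1 \<in> basic" "e2 \<in> basic" and s: "s1 \<in> sections Q B" "s2 \<in> sections Q B"
    and maps: "section_maps_to S q \<Phi> e1 s1" "section_maps_to S q \<Phi> e2 s2"
    and x: "extends_near M E S p e1 x1" "extends_near M E S p e2 x2"
  shows "bracket B s1 s2 (q p) = \<Phi> p (bracket E x1 x2 p)"
proof -
  have "bracket E x1 x2 p \<in> bracket_values M E S e1 e2 p"
    unfolding bracket_values_def using x by blast
  from Phi_bracket[rule_format, OF e s maps p this] show ?thesis by simp
qed

text \<open>Lets all four brackets of the Nijenhuis tensor be computed from a single pair of
  extensions, to which integrability of \<open>J\<close> on \<open>M\<close> applies.\<close>

lemma extends_near_J:
  assumes p: "p \<in> C" and x: "extends_near M E S p e x"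
  shows "extends_near M E S p (apply_endo S J e) (apply_endo M J x)"
  unfolding extends_near_iff[OF p]
proof
  note x' = x[unfolded extends_near_iff[OF p]]
  show "apply_endo M J x \<in> sections M E"
    unfolding EM.sections_iff
  proof (intro conjI ballI allI impI)
    fix z assume z: "z \<in> points M"
    have "section_at M E z x" using x' z EM.sections_iff by blast
    from endomorphism_section_at[OF M bundle_E J_endo this]
    show "section_at M E z (apply_endo M J x)"
      by (rule EM.section_at_cong)
        (rule eventually_mono[OF eventually_nbhds_points[OF atlas_M]], simp add: apply_endo_def)
  qed (simp add: apply_endo_def)
  have "eventually (\<lambda>y. y \<in> C \<longrightarrow> x y = e y) (nbhds M p)" using x' by blast
  then show "eventually (\<lambda>y. y \<in> C \<longrightarrow> apply_endo M J x y = apply_endo S J e y) (nbhds M p)"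
    by eventually_elim (use C_M in \<open>auto simp: apply_endo_def\<close>)
qed

lemma J'_nijenhuis:
  assumes s: "s1 \<in> sections Q B" "s2 \<in> sections Q B" and l: "l \<in> points Q"
  shows "nijenhuis Q B J' s1 s2 l = 0"
proof -
  obtain p where p: "p \<in> C" "q p = l" using q_surjective[OF l] by blast
  note pM = C_M[OF p(1)]
  let ?t1 = "apply_endo Q J' s1" and ?t2 = "apply_endo Q J' s2"
  obtain e1 where e1: "e1 \<in> basic" "\<forall>p\<in>C. e1 p \<in> D p" "section_maps_to S q \<Phi> e1 s1"
    "?t1 \<in> sections Q B" "section_maps_to S q \<Phi> (apply_endo S J e1) ?t1"
    using J'_section[OF s(1)] by blast
  obtain e2 where e2: "e2 \<in> basic" "\<forall>p\<in>C. e2 p \<in> D p" "section_maps_to S q \<Phi> e2 s2"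
    "?t2 \<in> sections Q B" "section_maps_to S q \<Phi> (apply_endo S J e2) ?t2"
    using J'_section[OF s(2)] by blast
  note f1 = J_of_basic[OF e1(1,2)] and f2 = J_of_basic[OF e2(1,2)]
  obtain x1 where x1: "extends_near M E S p e1 x1" using extension_exists[OF basicD(1)[OF e1(1)] p(1)] by blast
  obtain x2 where x2: "extends_near M E S p e2 x2" using extension_exists[OF basicD(1)[OF e2(1)] p(1)] by blast
  note y1 = extends_near_J[OF p(1) x1] and y2 = extends_near_J[OF p(1) x2]
  define a where "a = bracket E (apply_endo M J x1) (apply_endo M J x2) p"
  define b where "b = bracket E x1 x2 p"
  define c where "c = bracket E x1 (apply_endo M J x2) p"
  define d where "d = bracket E (apply_endo M J x1) x2 p"
  have inP: "a \<in> P p" "b \<in> P p" "c \<in> P p" "d \<in> P p"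
    unfolding a_def b_def c_def d_def
    using bracket_basic_in_orth[OF p(1) f1 f2 y1 y2] bracket_basic_in_orth[OF p(1) e1(1) e2(1) x1 x2]
      bracket_basic_in_orth[OF p(1) e1(1) f2 x1 y2] bracket_basic_in_orth[OF p(1) f1 e2(1) y1 x2] by simp_all
  have brackets: "bracket B ?t1 ?t2 l = \<Phi> p a" "bracket B s1 s2 l = \<Phi> p b"
    "bracket B s1 ?t2 l = \<Phi> p c" "bracket B ?t1 s2 l = \<Phi> p d"
    unfolding a_def b_def c_def d_def p(2)[symmetric]
    using bracket_B[OF p(1) f1 f2 e1(4) e2(4) e1(5) e2(5) y1 y2] bracket_B[OF p(1) e1(1) e2(1) s e1(3) e2(3) x1 x2]
      bracket_B[OF p(1) e1(1) f2 s(1) e2(4) e1(3) e2(5) x1 y2] bracket_B[OF p(1) f1 e2(1) e1(4) s(2) e1(5) e2(3) y1 x2]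
    by simp_all
  have xs: "x1 \<in> sections M E" "x2 \<in> sections M E" using x1 x2 by (auto simp: extends_near_def)
  \<comment> \<open>Integrability upstairs. Since \<open>a - b\<close> lies in \<open>P\<close>, so
    does \<open>J p (c + d)\<close>, and this is what places \<open>c + d\<close> in
    \<open>D\<close>, where \<open>J'\<close> is computed by \<open>J\<close>.\<close>
  have Jcd: "J p (c + d) = a - b"
    using J_nijenhuis[OF xs pM] by (simp add: nijenhuis_def a_def b_def c_def d_def)
  have cdP: "c + d \<in> P p" by (rule subspace_add[OF P_subspace[OF p(1)] inP(3,4)])
  then have cdf: "c + d \<in> fibre E p" using P_fibre by blast
  have "- J p (c + d) \<in> P p"
    unfolding Jcd by (intro subspace_neg subspace_diff P_subspace p(1) inP)
  moreover have "c + d = J p (- J p (c + d))"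
    using J_uminus[OF pM J_fibre[OF pM cdf]] J_square[OF pM cdf] by simp
  ultimately have cdD: "c + d \<in> D p" using cdP by blast
  have "J' l (\<Phi> p c + \<Phi> p d) = J' (q p) (\<Phi> p (c + d))"
    using linear_on_space_add[OF Phi_lin[OF p(1)] inP(3,4)] p(2) by simp
  also have "\<dots> = \<Phi> p (a - b)" using J'_Phi[OF p(1) cdD] Jcd by simp
  also have "\<dots> = \<Phi> p a - \<Phi> p b" by (rule linear_on_space_diff[OF Phi_lin[OF p(1)] inP(1,2)])
  finally show ?thesis by (simp add: nijenhuis_def brackets)
qed

lemma J'_generalized_complex: "generalized_complex_structure Q B J'"
  unfolding generalized_complex_structure_def
proof (intro conjI ballI J'_endomorphism J'_nijenhuis)
  fix l x y assume l: "l \<in> points Q" and xy: "x \<in> fibre B l" "y \<in> fibre B l"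
  obtain p v where pv: "p \<in> C" "q p = l" "v \<in> D p" "\<Phi> p v = x" using fibre_B_obtain[OF l xy(1)] by blast
  obtain w where w: "w \<in> D p" "\<Phi> p w = y" using D_onto[OF pv(1), of y] xy(2) pv(2) by blast
  have vw: "v \<in> P p" "w \<in> P p" using pv w by auto
  have JP: "J p v \<in> P p" "J p w \<in> P p" using J_D[OF pv(1)] pv(3) w(1) by blast+
  have "pairing B l (J' l x) (J' l y) = pairing B (q p) (\<Phi> p (J p v)) (\<Phi> p (J p w))"
    using J'_Phi[OF pv(1,3)] J'_Phi[OF pv(1) w(1)] pv(2,4) w(2) by simp
  also have "\<dots> = g p (J p v) (J p w)" by (rule Phi_pairing[rule_format, OF pv(1) JP])
  also have "\<dots> = g p v w" using J_orthogonal[OF C_M[OF pv(1)]] vw P_fibre by blast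
  also have "\<dots> = pairing B l x y" using Phi_pairing[rule_format, OF pv(1) vw] pv(2,4) w(2) by simp
  finally show "pairing B l (J' l x) (J' l y) = pairing B l x y" .
next
  fix l x assume l: "l \<in> points Q" and x: "x \<in> fibre B l"
  obtain p v where pv: "p \<in> C" "q p = l" "v \<in> D p" "\<Phi> p v = x" using fibre_B_obtain[OF l x] by blast
  have vP: "v \<in> P p" using pv(3) by blast
  then have vf: "v \<in> fibre E p" using P_fibre by blast
  have "J' l (J' l x) = J' (q p) (\<Phi> p (J p v))"
    using J'_Phi[OF pv(1,3)] pv(2,4) by simp
  also have "\<dots> = \<Phi> p (J p (J p v))" by (rule J'_Phi[OF pv(1) J_D[OF pv(1,3)]])
  also have "\<dots> = \<Phi> p (- v)" unfolding J_square[OF C_M[OF pv(1)] vf] ..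
  also have "\<dots> = - \<Phi> p v" by (rule linear_on_space_uminus[OF Phi_lin[OF pv(1)] vP])
  finally show "J' l (J' l x) = - x" using pv(4) by simp
qed

lemma descends: "descends_to E S K Q q B \<Phi> J J'"
  unfolding descends_to_def
proof (intro conjI ballI)
  fix p e assume "p \<in> points S" and e: "e \<in> D p"
  then have p: "p \<in> C" by simp
  show "J p e \<in> P p" using J_D[OF p e] by blast
  show "\<Phi> p (J p e) = J' (q p) (\<Phi> p e)" using J'_Phi[OF p e] by simp
next
  fix l x assume "l \<in> points Q" "x \<in> fibre B l"
  then show "\<exists>p\<in>points S. q p = l \<and> (\<exists>e\<in>D p. \<Phi> p e = x)"
    using fibre_B_obtain[of l x] by auto
qed

end

text \<open>Two maximal integral manifolds through a common point contain each other, so the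
  description in \<open>leaf_of\<close> denotes the given leaf; as leaves are nonempty, each of them
  is hit.\<close>

lemma leaf_of_image:
  assumes "q = leaf_of S \<Delta>" "q ` points S \<subseteq> leaves S \<Delta>"
  shows "q ` points S = leaves S \<Delta>"
proof
  show "leaves S \<Delta> \<subseteq> q ` points S"
  proof
    fix l assume l: "l \<in> leaves S \<Delta>"
    then obtain L where L: "l = points L" "connected_integral_manifold S \<Delta> L" by (auto simp: leaves_def)
    then obtain p where p: "p \<in> l" "p \<in> points S" by (auto simp: connected_integral_manifold_def)
    have sub: "l1 \<subseteq> l2" if l12: "l1 \<in> leaves S \<Delta>" "l2 \<in> leaves S \<Delta>" "p \<in> l1" "p \<in> l2" for l1 l2
    proof -
      obtain L1 where L1: "l1 = points L1" "connected_integral_manifold S \<Delta> L1" using l12(1) by (auto simp: leaves_def)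
      have "\<exists>L2. l2 = points L2 \<and> connected_integral_manifold S \<Delta> L2 \<and>
          (\<forall>L'. connected_integral_manifold S \<Delta> L' \<longrightarrow> points L' \<inter> points L2 \<noteq> {} \<longrightarrow> points L' \<subseteq> points L2)"
        using l12(2) by (simp add: leaves_def)
      then obtain L2 where L2: "l2 = points L2" "connected_integral_manifold S \<Delta> L2"
        "\<forall>L'. connected_integral_manifold S \<Delta> L' \<longrightarrow> points L' \<inter> points L2 \<noteq> {} \<longrightarrow> points L' \<subseteq> points L2"
        by (elim exE conjE)
      show ?thesis using L2(3)[rule_format, OF L1(2)] L1(1) L2(1) l12(3,4) by blast
    qed
    have "leaf_of S \<Delta> p = l"
      unfolding leaf_of_def
    proof (rule the_equality)
      show "l \<in> leaves S \<Delta> \<and> p \<in> l" using l p by blast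
      show "l' = l" if "l' \<in> leaves S \<Delta> \<and> p \<in> l'" for l'
        using sub[of l' l] sub[of l l'] that l p(1) by blast
    qed
    then show "l \<in> q ` points S" using p(2) assms(1) by blast
  qed
qed (rule assms(2))

theorem proposition6p1:
  fixes M :: "'m manifold" and E :: "('m, 'v::real_vector) courant"
    and C :: "'m set" and k :: nat and S :: "'m manifold" and K :: "'m \<Rightarrow> 'v set"
    and Q :: "'m set manifold" and q :: "'m \<Rightarrow> 'm set"
    and B :: "('m set, 'w::real_vector) courant" and \<Phi> :: "'m \<Rightarrow> 'v \<Rightarrow> 'w"
    and J :: "'m \<Rightarrow> 'v \<Rightarrow> 'v"
  defines "S \<equiv> submanifold_of M C k"
    and "q \<equiv> leaf_of S (anchor_distribution M E S K)"
  assumes "smooth_manifold M" and "exact_courant_algebroid M E"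
    and "embedded_submanifold M C k"
    and "subbundle S (restrict_bundle E S) K" and "isotropic E S K"
    and "\<forall>p\<in>C. anchor E p ` orth E K p = tangent_map M (\<lambda>x. x) ` tangent S p"
    and "\<forall>p\<in>C. span {e p | e. e \<in> basic_sections M E S K} = orth E K p"
    and "smooth_manifold Q" and "points Q = leaves S (anchor_distribution M E S K)"
    and "submersion S Q q"
    and "reduced_courant_algebroid M E S K Q q B \<Phi>"
    and "generalized_complex_structure M E J"
    and "\<exists>d. \<forall>p\<in>C. dim (J p ` K p \<inter> orth E K p) = d"
    and "\<forall>p\<in>C. J p ` K p \<inter> orth E K p \<subseteq> K p"
    and "\<forall>e\<in>basic_sections M E S K. (\<forall>p\<in>C. e p \<in> J p ` orth E K p \<inter> orth E K p) \<longrightarrow>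
           apply_endo S J e \<in> basic_sections M E S K"
  shows "\<exists>J'. generalized_complex_structure Q B J' \<and> descends_to E S K Q q B \<Phi> J J'"
proof -
  interpret embedded M C k S
    using assms(3,5) by unfold_locales (simp_all add: S_def)
  \<comment> \<open>That \<open>q\<close> takes values in the leaf space is part of its being a
    smooth map into \<open>Q\<close>; surjectivity is then added by maximality of leaves.\<close>
  have "q ` points S \<subseteq> leaves S (anchor_distribution M E S K)"
    using assms(12) unfolding submersion_def smooth_map_def assms(11) by blast
  from leaf_of_image[OF q_def[THEN meta_eq_to_obj_eq] this]
  have "q ` C = points Q" using assms(11) by simp
  then interpret reduction M C k S E K Q q B \<Phi> J
    using assms(4,6-10,13-17) by (intro reduction.intro embedded_axioms reduction_axioms.intro)
      (simp_all add: exact_courant_algebroid_def)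
  show ?thesis using J'_generalized_complex descends by blast
qed

end
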